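(* Let $\mathcal A$ be a category with finite limits and colimits, and let $\otimes$ be a monoidal structure on $\mathcal A$. Let $\underline I=(I,i_0,i_1,p,v,S,r_0,r_1,s,\Gamma_{ul},\Gamma_{lr},\Gamma_{ur})$ be an interval in $\mathcal A$ equipped with a contraction structure $p$, an involution structure $v$ compatible with $p$, a subdivision structure $(S,r_0,r_1,s)$ compatible with $p$, an upper left connection structure $\Gamma_{ul}$, a lower right connection structure $\Gamma_{lr}$ compatible with $p$, and an upper right connection structure $\Gamma_{ur}$. Suppose that: (i) $\Gamma_{lr}$ and $\Gamma_{ur}$ are compatible with $(S,r_0,r_1,s)$; (ii) $I$ and $S$ are exponentiable with respect to $\otimes$; (iii) for every object $a$ of $\mathcal A$, the square $(a\otimes r_0)\circ(a\otimes i_0)=(a\otimes r_1)\circ(a\otimes i_1)$ exhibits $a\otimes S$ as the pushout of $a\otimes i_0:a\to a\otimes I$ and $a\otimes i_1:a\to a\otimes I$; (iv) $\underline I$ has strictness of identities. Then one obtains a model structure on $\mathcal A$ by taking: weak equivalences to be the homotopy equivalences with respect to the cylinder $\underline{\mathsf{Cyl}}(\underline I)$ (equivalently, with respect to the co-cylinder $\underline{\mathsf{coCyl}}(\underline I)$); fibrations to be the normally cloven fibrations with respect to $\underline{\mathsf{coCyl}}(\underline I)$; cofibrations to be the cofibrations with respect to $\underline{\mathsf{Cyl}}(\underline I)$.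
   Context: Let $1$ be the unit of $\otimes$; $a\otimes 1$ is identified with $a$, and associativity isomorphisms are suppressed. The monoidal structure is not assumed symmetric. An object $b$ is exponentiable if $-\otimes b$ has a right adjoint $(-)^b$; an arrow $f:b_0\to b_1$ between exponentiable objects induces $a^f:a^{b_1}\to a^{b_0}$. An interval is an object $I$ with arrows $i_0,i_1:1\to I$. Write $I^2=I\otimes I$. Structures: - Contraction: $p:I\to 1$ with $pi_0=pi_1=\mathrm{id}$. - Involution: $v:I\to I$ with $vi_0=i_1$, $vi_1=i_0$; compatible with $p$ if $pv=p$. - Subdivision: an object $S$ with $r_0,r_1:I\to S$, $r_0i_0=r_1i_1$ being a pushout square of $i_0$ and $i_1$, and $s:I\to S$ with $si_0=r_1i_0$, $si_1=r_0i_1$; compatible with $p$ if $\overline ps=p$, where $\overline p:S\to 1$ is the unique arrow with $\overline pr_0=\overline pr_1=p$. - Upper left connection: $\Gamma_{ul}:I^2\to I$ with $\Gamma_{ul}(i_0\otimes I)=\Gamma_{ul}(I\otimes i_0)=\mathrm{id}$, $\Gamma_{ul}(i_1\otimes I)=\Gamma_{ul}(I\otimes i_1)=i_1p$. - Lower right connection: $\Gamma_{lr}:I^2\to I$ with $\Gamma_{lr}(i_1\otimes I)=\Gamma_{lr}(I\otimes i_1)=\mathrm{id}$, $\Gamma_{lr}(i_0\otimes I)=\Gamma_{lr}(I\otimes i_0)=i_0p$; compatible with $p$ if $p\Gamma_{lr}=p(I\otimes p)$. - Upper right connection: $\Gamma_{ur}:I^2\to I$ with $\Gamma_{ur}(I\otimes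 i_0)=\mathrm{id}$, $\Gamma_{ur}(i_1\otimes I)=v$, $\Gamma_{ur}(i_0\otimes I)=\Gamma_{ur}(I\otimes i_1)=i_0p$. - $\Gamma_{lr},\Gamma_{ur}$ are compatible with $(S,r_0,r_1,s)$ if $x(I\otimes s)=I\otimes p$, where $x:I\otimes S\to I$ is the unique arrow with $x(I\otimes r_0)=\Gamma_{lr}$, $x(I\otimes r_1)=\Gamma_{ur}$. - Strictness of identities: $q_ls=\mathrm{id}=q_rs$, where $q_l,q_r:S\to I$ are the unique arrows with $q_lr_0=\mathrm{id}$, $q_lr_1=i_0p$, $q_rr_0=i_1p$, $q_rr_1=\mathrm{id}$. $\underline{\mathsf{Cyl}}(\underline I)$: the functor $\mathsf{Cyl}=-\otimes I$ with the natural transformations $-\otimes i_0,-\otimes i_1:\mathrm{id}\to\mathsf{Cyl}$ (again written $i_0,i_1$), and contraction $-\otimes p$. $\underline{\mathsf{coCyl}}(\underline I)$: the functor $\mathsf{coCyl}=(-)^I$ with $e_0=(-)^{i_0},e_1=(-)^{i_1}:\mathsf{coCyl}\to\mathrm{id}$ and contraction $c=(-)^p:\mathrm{id}\to\mathsf{coCyl}$. A homotopy from $f_0$ to $f_1$ ($f_0,f_1:a_0\to a_1$) with respect to the cylinder is $h:\mathsf{Cyl}(a_0)\to a_1$ with $h\circ i_0(a_0)=f_0$, $h\circ i_1(a_0)=f_1$; with respect to the co-cylinder it is $h:a_0\to\mathsf{coCyl}(a_1)$ with $e_0(a_1)\circ h=f_0$, $e_1(a_1)\circ h=f_1$. $f:a_0\to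 a_1$ is a homotopy equivalence if there are $f^{-1}:a_1\to a_0$ and homotopies from $f^{-1}f$ to $\mathrm{id}(a_0)$ and from $ff^{-1}$ to $\mathrm{id}(a_1)$. Cofibration with respect to the cylinder: $j:a_0\to a_1$ such that for all $f:a_1\to a_2$, $h:\mathsf{Cyl}(a_0)\to a_2$ with $h\circ i_0(a_0)=f\circ j$ there is $k:\mathsf{Cyl}(a_1)\to a_2$ with $k\circ\mathsf{Cyl}(j)=h$, $k\circ i_0(a_1)=f$. Normally cloven fibration with respect to the co-cylinder: $f:a_1\to a_2$ for which one can choose, for every object $a_0$ and all $g:a_0\to a_1$, $h:a_0\to\mathsf{coCyl}(a_2)$ with $e_0(a_2)\circ h=f\circ g$, an arrow $k_{a_0}(g,h):a_0\to\mathsf{coCyl}(a_1)$ with $\mathsf{coCyl}(f)\circ k_{a_0}(g,h)=h$, $e_0(a_1)\circ k_{a_0}(g,h)=g$, such that (i) $k_{a_0}(g,c(a_2)\circ f\circ g)=c(a_1)\circ g$, and (ii) $k_{a_{-1}}(g\circ u,h\circ u)=k_{a_0}(g,h)\circ u$ for all $u:a_{-1}\to a_0$. A model structure means a (closed) model structure in the sense of Quillen: two-out-of-three for weak equivalences; (trivial) fibrations are exactly the arrows with the right lifting property with respect to trivial cofibrations (resp. cofibrations); (trivial) cofibrations are exactly the arrows with the left lifting property with respect to trivial fibrations (resp. fibrations); both factorisations exist (not required functorial). *)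

theory Defs
  imports Main
begin

section \<open>Categories, functors, natural transformations\<close>

record ('o, 'm) cat =
  Ob :: "'o set"
  Arr :: "'m set"
  Dom :: "'m \<Rightarrow> 'o"
  Cod :: "'m \<Rightarrow> 'o"
  Ide :: "'o \<Rightarrow> 'm" ("\<i>\<d>\<index>")
  Comp :: "'m \<Rightarrow> 'm \<Rightarrow> 'm" (infixl "\<cdot>\<index>" 70)

definition hom :: "('o, 'm, 'z) cat_scheme \<Rightarrow> 'o \<Rightarrow> 'o \<Rightarrow> 'm set" where
  "hom C x y = {f \<in> Arr C. Dom C f = x \<and> Cod C f = y}"

locale category =
  fixes C :: "('o, 'm, 'z) cat_scheme" (structure)
  assumes dom_in_Ob: "f \<in> Arr C \<Longrightarrow> Dom C f \<in> Ob C"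
    and cod_in_Ob: "f \<in> Arr C \<Longrightarrow> Cod C f \<in> Ob C"
    and ide_in_hom: "x \<in> Ob C \<Longrightarrow> \<i>\<d> x \<in> hom C x x"
    and comp_in_hom: "f \<in> hom C x y \<Longrightarrow> g \<in> hom C y z \<Longrightarrow> g \<cdot> f \<in> hom C x z"
    and comp_ide: "f \<in> hom C x y \<Longrightarrow> f \<cdot> \<i>\<d> x = f"
    and ide_comp: "f \<in> hom C x y \<Longrightarrow> \<i>\<d> y \<cdot> f = f"
    and comp_assoc: "f \<in> hom C w x \<Longrightarrow> g \<in> hom C x y \<Longrightarrow> h \<in> hom C y z
      \<Longrightarrow> (h \<cdot> g) \<cdot> f = h \<cdot> (g \<cdot> f)"

definition inverse_arrows :: "('o, 'm, 'z) cat_scheme \<Rightarrow> 'm \<Rightarrow> 'm \<Rightarrow> bool" where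
  "inverse_arrows C f g \<longleftrightarrow> f \<in> Arr C \<and> g \<in> hom C (Cod C f) (Dom C f) \<and>
     g \<cdot>\<^bsub>C\<^esub> f = \<i>\<d>\<^bsub>C\<^esub> (Dom C f) \<and> f \<cdot>\<^bsub>C\<^esub> g = \<i>\<d>\<^bsub>C\<^esub> (Cod C f)"

definition iso :: "('o, 'm, 'z) cat_scheme \<Rightarrow> 'm \<Rightarrow> bool" where
  "iso C f \<longleftrightarrow> (\<exists>g. inverse_arrows C f g)"

definition inv_arr :: "('o, 'm, 'z) cat_scheme \<Rightarrow> 'm \<Rightarrow> 'm" where
  "inv_arr C f = (THE g. inverse_arrows C f g)"

record ('o, 'm, 'p, 'n) ftr =
  OnOb :: "'o \<Rightarrow> 'p"
  OnArr :: "'m \<Rightarrow> 'n"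

locale is_functor = C: category C + D: category D
  for C :: "('o, 'm, 'z) cat_scheme" and D :: "('p, 'n, 'y) cat_scheme"
    and F :: "('o, 'm, 'p, 'n) ftr" +
  assumes on_ob: "x \<in> Ob C \<Longrightarrow> OnOb F x \<in> Ob D"
    and on_arr: "f \<in> hom C x y \<Longrightarrow> OnArr F f \<in> hom D (OnOb F x) (OnOb F y)"
    and on_ide: "x \<in> Ob C \<Longrightarrow> OnArr F (\<i>\<d>\<^bsub>C\<^esub> x) = \<i>\<d>\<^bsub>D\<^esub> (OnOb F x)"
    and on_comp: "f \<in> hom C x y \<Longrightarrow> g \<in> hom C y z
      \<Longrightarrow> OnArr F (g \<cdot>\<^bsub>C\<^esub> f) = OnArr F g \<cdot>\<^bsub>D\<^esub> OnArr F f"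

definition id_functor :: "('o, 'm, 'o, 'm) ftr" where
  "id_functor = \<lparr>OnOb = (\<lambda>x. x), OnArr = (\<lambda>f. f)\<rparr>"

definition comp_functor ::
    "('p, 'n, 'q, 'k) ftr \<Rightarrow> ('o, 'm, 'p, 'n) ftr \<Rightarrow> ('o, 'm, 'q, 'k) ftr" where
  "comp_functor G F = \<lparr>OnOb = OnOb G \<circ> OnOb F, OnArr = OnArr G \<circ> OnArr F\<rparr>"

definition nat_trans :: "('o, 'm, 'z) cat_scheme \<Rightarrow> ('p, 'n, 'y) cat_scheme
    \<Rightarrow> ('o, 'm, 'p, 'n) ftr \<Rightarrow> ('o, 'm, 'p, 'n) ftr \<Rightarrow> ('o \<Rightarrow> 'n) \<Rightarrow> bool" where
  "nat_trans C D F G \<tau> \<longleftrightarrow> is_functor C D F \<and> is_functor C D G \<and>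
     (\<forall>x \<in> Ob C. \<tau> x \<in> hom D (OnOb F x) (OnOb G x)) \<and>
     (\<forall>x y. \<forall>f \<in> hom C x y. \<tau> y \<cdot>\<^bsub>D\<^esub> OnArr F f = OnArr G f \<cdot>\<^bsub>D\<^esub> \<tau> x)"

text \<open>\<open>G\<close> is right adjoint to \<open>F\<close>, with counit \<open>\<epsilon>\<close>.\<close>

definition right_adjoint :: "('o, 'm, 'z) cat_scheme \<Rightarrow> ('p, 'n, 'y) cat_scheme
    \<Rightarrow> ('o, 'm, 'p, 'n) ftr \<Rightarrow> ('p, 'n, 'o, 'm) ftr \<Rightarrow> ('p \<Rightarrow> 'n) \<Rightarrow> bool" where
  "right_adjoint C D F G \<epsilon> \<longleftrightarrow> is_functor C D F \<and> is_functor D C G \<and>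
     nat_trans D D (comp_functor F G) id_functor \<epsilon> \<and>
     (\<forall>x \<in> Ob C. \<forall>y \<in> Ob D. \<forall>f \<in> hom D (OnOb F x) y.
        \<exists>!g. g \<in> hom C x (OnOb G y) \<and> \<epsilon> y \<cdot>\<^bsub>D\<^esub> OnArr F g = f)"

section \<open>Limits and colimits\<close>

definition cone :: "('i, 'j, 'y) cat_scheme \<Rightarrow> ('o, 'm, 'z) cat_scheme
    \<Rightarrow> ('i, 'j, 'o, 'm) ftr \<Rightarrow> 'o \<Rightarrow> ('i \<Rightarrow> 'm) \<Rightarrow> bool" where
  "cone J C D x \<tau> \<longleftrightarrow> x \<in> Ob C \<and> (\<forall>i \<in> Ob J. \<tau> i \<in> hom C x (OnOb D i)) \<and>
     (\<forall>i j. \<forall>u \<in> hom J i j. OnArr D u \<cdot>\<^bsub>C\<^esub> \<tau> i = \<tau> j)"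

definition limit_cone :: "('i, 'j, 'y) cat_scheme \<Rightarrow> ('o, 'm, 'z) cat_scheme
    \<Rightarrow> ('i, 'j, 'o, 'm) ftr \<Rightarrow> 'o \<Rightarrow> ('i \<Rightarrow> 'm) \<Rightarrow> bool" where
  "limit_cone J C D x \<tau> \<longleftrightarrow> cone J C D x \<tau> \<and>
     (\<forall>y \<sigma>. cone J C D y \<sigma> \<longrightarrow>
        (\<exists>!h. h \<in> hom C y x \<and> (\<forall>i \<in> Ob J. \<tau> i \<cdot>\<^bsub>C\<^esub> h = \<sigma> i)))"

definition cocone :: "('i, 'j, 'y) cat_scheme \<Rightarrow> ('o, 'm, 'z) cat_scheme
    \<Rightarrow> ('i, 'j, 'o, 'm) ftr \<Rightarrow> 'o \<Rightarrow> ('i \<Rightarrow> 'm) \<Rightarrow> bool" where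
  "cocone J C D x \<tau> \<longleftrightarrow> x \<in> Ob C \<and> (\<forall>i \<in> Ob J. \<tau> i \<in> hom C (OnOb D i) x) \<and>
     (\<forall>i j. \<forall>u \<in> hom J i j. \<tau> j \<cdot>\<^bsub>C\<^esub> OnArr D u = \<tau> i)"

definition colimit_cocone :: "('i, 'j, 'y) cat_scheme \<Rightarrow> ('o, 'm, 'z) cat_scheme
    \<Rightarrow> ('i, 'j, 'o, 'm) ftr \<Rightarrow> 'o \<Rightarrow> ('i \<Rightarrow> 'm) \<Rightarrow> bool" where
  "colimit_cocone J C D x \<tau> \<longleftrightarrow> cocone J C D x \<tau> \<and>
     (\<forall>y \<sigma>. cocone J C D y \<sigma> \<longrightarrow>
        (\<exists>!h. h \<in> hom C x y \<and> (\<forall>i \<in> Ob J. h \<cdot>\<^bsub>C\<^esub> \<tau> i = \<sigma> i)))"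

definition finite_category :: "('i, 'j) cat \<Rightarrow> bool" where
  "finite_category J \<longleftrightarrow> category J \<and> finite (Ob J) \<and> finite (Arr J)"

text \<open>Every finite category is isomorphic to one whose objects and arrows are natural
  numbers, so it is no restriction to take index categories of type \<open>(nat, nat) cat\<close>.\<close>

definition has_finite_limits :: "('o, 'm, 'z) cat_scheme \<Rightarrow> bool" where
  "has_finite_limits C \<longleftrightarrow> (\<forall>(J :: (nat, nat) cat) D.
     finite_category J \<longrightarrow> is_functor J C D \<longrightarrow> (\<exists>x \<tau>. limit_cone J C D x \<tau>))"

definition has_finite_colimits :: "('o, 'm, 'z) cat_scheme \<Rightarrow> bool" where
  "has_finite_colimits C \<longleftrightarrow> (\<forall>(J :: (nat, nat) cat) D.
     finite_category J \<longrightarrow> is_functor J C D \<longrightarrow> (\<exists>x \<tau>. colimit_cocone J C D x \<tau>))"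

text \<open>\<open>u \<cdot> f = v \<cdot> g\<close> is a pushout square of the span \<open>f, g\<close>.\<close>

definition pushout :: "('o, 'm, 'z) cat_scheme \<Rightarrow> 'm \<Rightarrow> 'm \<Rightarrow> 'm \<Rightarrow> 'm \<Rightarrow> bool" where
  "pushout C f g u v \<longleftrightarrow>
     f \<in> Arr C \<and> g \<in> Arr C \<and> Dom C f = Dom C g \<and>
     u \<in> hom C (Cod C f) (Cod C u) \<and> v \<in> hom C (Cod C g) (Cod C u) \<and>
     u \<cdot>\<^bsub>C\<^esub> f = v \<cdot>\<^bsub>C\<^esub> g \<and>
     (\<forall>z. \<forall>a \<in> hom C (Cod C f) z. \<forall>b \<in> hom C (Cod C g) z.
        a \<cdot>\<^bsub>C\<^esub> f = b \<cdot>\<^bsub>C\<^esub> g \<longrightarrow>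
        (\<exists>!h. h \<in> hom C (Cod C u) z \<and> h \<cdot>\<^bsub>C\<^esub> u = a \<and> h \<cdot>\<^bsub>C\<^esub> v = b))"

text \<open>The arrow out of the vertex of a pushout square \<open>u, v\<close> with prescribed composites.\<close>

definition copair :: "('o, 'm, 'z) cat_scheme \<Rightarrow> 'm \<Rightarrow> 'm \<Rightarrow> 'm \<Rightarrow> 'm \<Rightarrow> 'm" where
  "copair C u v a b =
     (THE h. h \<in> hom C (Cod C u) (Cod C a) \<and> h \<cdot>\<^bsub>C\<^esub> u = a \<and> h \<cdot>\<^bsub>C\<^esub> v = b)"

section \<open>Monoidal structures and exponentiable objects\<close>

record ('o, 'm) moncat = "('o, 'm) cat" +
  Unit :: 'o ("\<one>\<index>")
  TensOb :: "'o \<Rightarrow> 'o \<Rightarrow> 'o" (infixl "\<otimes>\<index>" 75)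
  TensArr :: "'m \<Rightarrow> 'm \<Rightarrow> 'm" (infixl "\<boxtimes>\<index>" 75)
  Assoc :: "'o \<Rightarrow> 'o \<Rightarrow> 'o \<Rightarrow> 'm" ("\<alpha>\<index>")
  Lunit :: "'o \<Rightarrow> 'm" ("\<l>\<index>")
  Runit :: "'o \<Rightarrow> 'm" ("\<r>\<index>")

locale monoidal_category = category A
  for A :: "('o, 'm, 'z) moncat_scheme" (structure) +
  assumes unit_in_Ob: "\<one> \<in> Ob A"
    and tens_in_Ob: "a \<in> Ob A \<Longrightarrow> b \<in> Ob A \<Longrightarrow> a \<otimes> b \<in> Ob A"
    and tens_in_hom: "f \<in> hom A a b \<Longrightarrow> g \<in> hom A c d \<Longrightarrow> f \<boxtimes> g \<in> hom A (a \<otimes> c) (b \<otimes> d)"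
    and tens_ide: "a \<in> Ob A \<Longrightarrow> b \<in> Ob A \<Longrightarrow> \<i>\<d> a \<boxtimes> \<i>\<d> b = \<i>\<d> (a \<otimes> b)"
    and tens_comp: "f \<in> hom A a b \<Longrightarrow> f' \<in> hom A b c \<Longrightarrow> g \<in> hom A a' b' \<Longrightarrow> g' \<in> hom A b' c'
      \<Longrightarrow> (f' \<cdot> f) \<boxtimes> (g' \<cdot> g) = (f' \<boxtimes> g') \<cdot> (f \<boxtimes> g)"
    and assoc_in_hom: "a \<in> Ob A \<Longrightarrow> b \<in> Ob A \<Longrightarrow> c \<in> Ob A
      \<Longrightarrow> \<alpha> a b c \<in> hom A ((a \<otimes> b) \<otimes> c) (a \<otimes> (b \<otimes> c))"
    and assoc_iso: "a \<in> Ob A \<Longrightarrow> b \<in> Ob A \<Longrightarrow> c \<in> Ob A \<Longrightarrow> iso A (\<alpha> a b c)"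
    and assoc_natural: "f \<in> hom A a a' \<Longrightarrow> g \<in> hom A b b' \<Longrightarrow> h \<in> hom A c c'
      \<Longrightarrow> \<alpha> a' b' c' \<cdot> ((f \<boxtimes> g) \<boxtimes> h) = (f \<boxtimes> (g \<boxtimes> h)) \<cdot> \<alpha> a b c"
    and lunit_in_hom: "a \<in> Ob A \<Longrightarrow> \<l> a \<in> hom A (\<one> \<otimes> a) a"
    and lunit_iso: "a \<in> Ob A \<Longrightarrow> iso A (\<l> a)"
    and lunit_natural: "f \<in> hom A a b \<Longrightarrow> \<l> b \<cdot> (\<i>\<d> \<one> \<boxtimes> f) = f \<cdot> \<l> a"
    and runit_in_hom: "a \<in> Ob A \<Longrightarrow> \<r> a \<in> hom A (a \<otimes> \<one>) a"
    and runit_iso: "a \<in> Ob A \<Longrightarrow> iso A (\<r> a)"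
    and runit_natural: "f \<in> hom A a b \<Longrightarrow> \<r> b \<cdot> (f \<boxtimes> \<i>\<d> \<one>) = f \<cdot> \<r> a"
    and pentagon: "a \<in> Ob A \<Longrightarrow> b \<in> Ob A \<Longrightarrow> c \<in> Ob A \<Longrightarrow> d \<in> Ob A
      \<Longrightarrow> \<alpha> a b (c \<otimes> d) \<cdot> \<alpha> (a \<otimes> b) c d
        = (\<i>\<d> a \<boxtimes> \<alpha> b c d) \<cdot> \<alpha> a (b \<otimes> c) d \<cdot> (\<alpha> a b c \<boxtimes> \<i>\<d> d)"
    and triangle: "a \<in> Ob A \<Longrightarrow> b \<in> Ob A
      \<Longrightarrow> (\<i>\<d> a \<boxtimes> \<l> b) \<cdot> \<alpha> a \<one> b = \<r> a \<boxtimes> \<i>\<d> b"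

definition tensor_right :: "('o, 'm, 'z) moncat_scheme \<Rightarrow> 'o \<Rightarrow> ('o, 'm, 'o, 'm) ftr" where
  "tensor_right A b = \<lparr>OnOb = (\<lambda>a. a \<otimes>\<^bsub>A\<^esub> b), OnArr = (\<lambda>f. f \<boxtimes>\<^bsub>A\<^esub> \<i>\<d>\<^bsub>A\<^esub> b)\<rparr>"

definition exponential ::
    "('o, 'm, 'z) moncat_scheme \<Rightarrow> 'o \<Rightarrow> ('o, 'm, 'o, 'm) ftr \<Rightarrow> ('o \<Rightarrow> 'm) \<Rightarrow> bool" where
  "exponential A b E ev \<longleftrightarrow> b \<in> Ob A \<and> right_adjoint A A (tensor_right A b) E ev"

definition exponentiable :: "('o, 'm, 'z) moncat_scheme \<Rightarrow> 'o \<Rightarrow> bool" where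
  "exponentiable A b \<longleftrightarrow> (\<exists>E ev. exponential A b E ev)"

text \<open>For \<open>f : b\<^sub>0 \<rightarrow> b\<^sub>1\<close> and exponentials \<open>(E\<^sub>0, ev\<^sub>0)\<close> of \<open>b\<^sub>0\<close> and \<open>(E\<^sub>1, ev\<^sub>1)\<close> of \<open>b\<^sub>1\<close>,
  the arrow \<open>a\<^sup>f : E\<^sub>1 a \<rightarrow> E\<^sub>0 a\<close>.\<close>

definition exp_arr :: "('o, 'm, 'z) moncat_scheme
    \<Rightarrow> ('o, 'm, 'o, 'm) ftr \<Rightarrow> ('o \<Rightarrow> 'm) \<Rightarrow> ('o, 'm, 'o, 'm) ftr \<Rightarrow> ('o \<Rightarrow> 'm)
    \<Rightarrow> 'm \<Rightarrow> 'o \<Rightarrow> 'm" where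
  "exp_arr A E\<^sub>0 ev\<^sub>0 E\<^sub>1 ev\<^sub>1 f a =
     (THE g. g \<in> hom A (OnOb E\<^sub>1 a) (OnOb E\<^sub>0 a) \<and>
        ev\<^sub>0 a \<cdot>\<^bsub>A\<^esub> (g \<boxtimes>\<^bsub>A\<^esub> \<i>\<d>\<^bsub>A\<^esub> (Dom A f)) = ev\<^sub>1 a \<cdot>\<^bsub>A\<^esub> (\<i>\<d>\<^bsub>A\<^esub> (OnOb E\<^sub>1 a) \<boxtimes>\<^bsub>A\<^esub> f))"

text \<open>The identification of \<open>a \<otimes> \<one>\<close> with \<open>a\<close> makes the identity functor, with the right
  unitor as counit, the exponential of the unit. This is the choice of \<open>(-)\<^sup>\<one>\<close> in the
  co-cylinder below.\<close>

lemma (in monoidal_category) exponential_unit: "exponential A \<one> id_functor \<r>"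
proof -
  have F: "is_functor A A (tensor_right A \<one>)"
    unfolding tensor_right_def
    by unfold_locales
      (auto simp: unit_in_Ob tens_in_Ob tens_in_hom ide_in_hom tens_ide
        tens_comp[OF _ _ ide_in_hom[OF unit_in_Ob] ide_in_hom[OF unit_in_Ob],
          unfolded comp_ide[OF ide_in_hom[OF unit_in_Ob]]])
  have I: "is_functor A A id_functor"
    unfolding id_functor_def by unfold_locales auto
  have FI: "comp_functor (tensor_right A \<one>) id_functor = tensor_right A \<one>"
    by (simp add: comp_functor_def id_functor_def tensor_right_def o_def)
  have N: "nat_trans A A (tensor_right A \<one>) id_functor \<r>"
    using F I runit_in_hom runit_natural
    by (auto simp: nat_trans_def tensor_right_def id_functor_def)
  have U: "\<exists>!g. g \<in> hom A x y \<and> \<r> y \<cdot> (g \<boxtimes> \<i>\<d> \<one>) = f"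
    if x: "x \<in> Ob A" and f: "f \<in> hom A (x \<otimes> \<one>) y" for x y f
  proof -
    have rx: "\<r> x \<in> hom A (x \<otimes> \<one>) x" using x by (rule runit_in_hom)
    obtain k where k: "k \<in> hom A x (x \<otimes> \<one>)" "k \<cdot> \<r> x = \<i>\<d> (x \<otimes> \<one>)" "\<r> x \<cdot> k = \<i>\<d> x"
      using runit_iso[OF x] rx by (auto simp: iso_def inverse_arrows_def hom_def)
    have fk: "f \<cdot> k \<in> hom A x y" using k(1) f by (rule comp_in_hom)
    show ?thesis
    proof (rule ex1I[of _ "f \<cdot> k"])
      show "f \<cdot> k \<in> hom A x y \<and> \<r> y \<cdot> ((f \<cdot> k) \<boxtimes> \<i>\<d> \<one>) = f"
        using fk runit_natural[OF fk] comp_assoc[OF rx k(1) f] k(2) comp_ide[OF f] by simp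
    next
      fix g assume "g \<in> hom A x y \<and> \<r> y \<cdot> (g \<boxtimes> \<i>\<d> \<one>) = f"
      then have g: "g \<in> hom A x y" and "g \<cdot> \<r> x = f" using runit_natural by auto
      then show "g = f \<cdot> k"
        using comp_assoc[OF k(1) rx g] k(3) comp_ide[OF g] by simp
    qed
  qed
  show ?thesis
    unfolding exponential_def right_adjoint_def FI
    using unit_in_Ob F I N U by (simp add: tensor_right_def id_functor_def)
qed

section \<open>Intervals and structures upon them\<close>

text \<open>Unitors are inserted wherever \<open>a \<otimes> \<one>\<close> or \<open>\<one> \<otimes> a\<close> is identified with \<open>a\<close>.\<close>

definition interval :: "('o, 'm, 'z) moncat_scheme \<Rightarrow> 'o \<Rightarrow> 'm \<Rightarrow> 'm \<Rightarrow> bool" where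
  "interval A I i\<^sub>0 i\<^sub>1 \<longleftrightarrow> I \<in> Ob A \<and> i\<^sub>0 \<in> hom A \<one>\<^bsub>A\<^esub> I \<and> i\<^sub>1 \<in> hom A \<one>\<^bsub>A\<^esub> I"

definition contraction :: "('o, 'm, 'z) moncat_scheme \<Rightarrow> 'o \<Rightarrow> 'm \<Rightarrow> 'm \<Rightarrow> 'm \<Rightarrow> bool" where
  "contraction A I i\<^sub>0 i\<^sub>1 p \<longleftrightarrow> p \<in> hom A I \<one>\<^bsub>A\<^esub> \<and>
     p \<cdot>\<^bsub>A\<^esub> i\<^sub>0 = \<i>\<d>\<^bsub>A\<^esub> \<one>\<^bsub>A\<^esub> \<and> p \<cdot>\<^bsub>A\<^esub> i\<^sub>1 = \<i>\<d>\<^bsub>A\<^esub> \<one>\<^bsub>A\<^esub>"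

definition involution :: "('o, 'm, 'z) moncat_scheme \<Rightarrow> 'o \<Rightarrow> 'm \<Rightarrow> 'm \<Rightarrow> 'm \<Rightarrow> bool" where
  "involution A I i\<^sub>0 i\<^sub>1 v \<longleftrightarrow> v \<in> hom A I I \<and> v \<cdot>\<^bsub>A\<^esub> i\<^sub>0 = i\<^sub>1 \<and> v \<cdot>\<^bsub>A\<^esub> i\<^sub>1 = i\<^sub>0"

definition involution_compatible :: "('o, 'm, 'z) moncat_scheme \<Rightarrow> 'm \<Rightarrow> 'm \<Rightarrow> bool" where
  "involution_compatible A p v \<longleftrightarrow> p \<cdot>\<^bsub>A\<^esub> v = p"

definition subdivision :: "('o, 'm, 'z) moncat_scheme \<Rightarrow> 'o \<Rightarrow> 'm \<Rightarrow> 'm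
    \<Rightarrow> 'o \<Rightarrow> 'm \<Rightarrow> 'm \<Rightarrow> 'm \<Rightarrow> bool" where
  "subdivision A I i\<^sub>0 i\<^sub>1 S r\<^sub>0 r\<^sub>1 s \<longleftrightarrow> S \<in> Ob A \<and>
     r\<^sub>0 \<in> hom A I S \<and> r\<^sub>1 \<in> hom A I S \<and> pushout A i\<^sub>0 i\<^sub>1 r\<^sub>0 r\<^sub>1 \<and>
     s \<in> hom A I S \<and> s \<cdot>\<^bsub>A\<^esub> i\<^sub>0 = r\<^sub>1 \<cdot>\<^bsub>A\<^esub> i\<^sub>0 \<and> s \<cdot>\<^bsub>A\<^esub> i\<^sub>1 = r\<^sub>0 \<cdot>\<^bsub>A\<^esub> i\<^sub>1"

definition subdivision_compatible ::
    "('o, 'm, 'z) moncat_scheme \<Rightarrow> 'm \<Rightarrow> 'm \<Rightarrow> 'm \<Rightarrow> 'm \<Rightarrow> bool" where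
  "subdivision_compatible A p r\<^sub>0 r\<^sub>1 s \<longleftrightarrow> copair A r\<^sub>0 r\<^sub>1 p p \<cdot>\<^bsub>A\<^esub> s = p"

definition connection_ul ::
    "('o, 'm, 'z) moncat_scheme \<Rightarrow> 'o \<Rightarrow> 'm \<Rightarrow> 'm \<Rightarrow> 'm \<Rightarrow> 'm \<Rightarrow> bool" where
  "connection_ul A I i\<^sub>0 i\<^sub>1 p \<Gamma> \<longleftrightarrow> \<Gamma> \<in> hom A (I \<otimes>\<^bsub>A\<^esub> I) I \<and>
     \<Gamma> \<cdot>\<^bsub>A\<^esub> (i\<^sub>0 \<boxtimes>\<^bsub>A\<^esub> \<i>\<d>\<^bsub>A\<^esub> I) = \<l>\<^bsub>A\<^esub> I \<and>
     \<Gamma> \<cdot>\<^bsub>A\<^esub> (\<i>\<d>\<^bsub>A\<^esub> I \<boxtimes>\<^bsub>A\<^esub> i\<^sub>0) = \<r>\<^bsub>A\<^esub> I \<and>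
     \<Gamma> \<cdot>\<^bsub>A\<^esub> (i\<^sub>1 \<boxtimes>\<^bsub>A\<^esub> \<i>\<d>\<^bsub>A\<^esub> I) = i\<^sub>1 \<cdot>\<^bsub>A\<^esub> p \<cdot>\<^bsub>A\<^esub> \<l>\<^bsub>A\<^esub> I \<and>
     \<Gamma> \<cdot>\<^bsub>A\<^esub> (\<i>\<d>\<^bsub>A\<^esub> I \<boxtimes>\<^bsub>A\<^esub> i\<^sub>1) = i\<^sub>1 \<cdot>\<^bsub>A\<^esub> p \<cdot>\<^bsub>A\<^esub> \<r>\<^bsub>A\<^esub> I"

definition connection_lr ::
    "('o, 'm, 'z) moncat_scheme \<Rightarrow> 'o \<Rightarrow> 'm \<Rightarrow> 'm \<Rightarrow> 'm \<Rightarrow> 'm \<Rightarrow> bool" where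
  "connection_lr A I i\<^sub>0 i\<^sub>1 p \<Gamma> \<longleftrightarrow> \<Gamma> \<in> hom A (I \<otimes>\<^bsub>A\<^esub> I) I \<and>
     \<Gamma> \<cdot>\<^bsub>A\<^esub> (i\<^sub>1 \<boxtimes>\<^bsub>A\<^esub> \<i>\<d>\<^bsub>A\<^esub> I) = \<l>\<^bsub>A\<^esub> I \<and>
     \<Gamma> \<cdot>\<^bsub>A\<^esub> (\<i>\<d>\<^bsub>A\<^esub> I \<boxtimes>\<^bsub>A\<^esub> i\<^sub>1) = \<r>\<^bsub>A\<^esub> I \<and>
     \<Gamma> \<cdot>\<^bsub>A\<^esub> (i\<^sub>0 \<boxtimes>\<^bsub>A\<^esub> \<i>\<d>\<^bsub>A\<^esub> I) = i\<^sub>0 \<cdot>\<^bsub>A\<^esub> p \<cdot>\<^bsub>A\<^esub> \<l>\<^bsub>A\<^esub> I \<and>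
     \<Gamma> \<cdot>\<^bsub>A\<^esub> (\<i>\<d>\<^bsub>A\<^esub> I \<boxtimes>\<^bsub>A\<^esub> i\<^sub>0) = i\<^sub>0 \<cdot>\<^bsub>A\<^esub> p \<cdot>\<^bsub>A\<^esub> \<r>\<^bsub>A\<^esub> I"

definition connection_lr_compatible ::
    "('o, 'm, 'z) moncat_scheme \<Rightarrow> 'o \<Rightarrow> 'm \<Rightarrow> 'm \<Rightarrow> bool" where
  "connection_lr_compatible A I p \<Gamma> \<longleftrightarrow>
     p \<cdot>\<^bsub>A\<^esub> \<Gamma> = p \<cdot>\<^bsub>A\<^esub> (\<r>\<^bsub>A\<^esub> I \<cdot>\<^bsub>A\<^esub> (\<i>\<d>\<^bsub>A\<^esub> I \<boxtimes>\<^bsub>A\<^esub> p))"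

definition connection_ur ::
    "('o, 'm, 'z) moncat_scheme \<Rightarrow> 'o \<Rightarrow> 'm \<Rightarrow> 'm \<Rightarrow> 'm \<Rightarrow> 'm \<Rightarrow> 'm \<Rightarrow> bool" where
  "connection_ur A I i\<^sub>0 i\<^sub>1 p v \<Gamma> \<longleftrightarrow> \<Gamma> \<in> hom A (I \<otimes>\<^bsub>A\<^esub> I) I \<and>
     \<Gamma> \<cdot>\<^bsub>A\<^esub> (\<i>\<d>\<^bsub>A\<^esub> I \<boxtimes>\<^bsub>A\<^esub> i\<^sub>0) = \<r>\<^bsub>A\<^esub> I \<and>
     \<Gamma> \<cdot>\<^bsub>A\<^esub> (i\<^sub>1 \<boxtimes>\<^bsub>A\<^esub> \<i>\<d>\<^bsub>A\<^esub> I) = v \<cdot>\<^bsub>A\<^esub> \<l>\<^bsub>A\<^esub> I \<and>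
     \<Gamma> \<cdot>\<^bsub>A\<^esub> (i\<^sub>0 \<boxtimes>\<^bsub>A\<^esub> \<i>\<d>\<^bsub>A\<^esub> I) = i\<^sub>0 \<cdot>\<^bsub>A\<^esub> p \<cdot>\<^bsub>A\<^esub> \<l>\<^bsub>A\<^esub> I \<and>
     \<Gamma> \<cdot>\<^bsub>A\<^esub> (\<i>\<d>\<^bsub>A\<^esub> I \<boxtimes>\<^bsub>A\<^esub> i\<^sub>1) = i\<^sub>0 \<cdot>\<^bsub>A\<^esub> p \<cdot>\<^bsub>A\<^esub> \<r>\<^bsub>A\<^esub> I"

definition connections_subdivision_compatible ::
    "('o, 'm, 'z) moncat_scheme \<Rightarrow> 'o \<Rightarrow> 'm \<Rightarrow> 'm \<Rightarrow> 'm \<Rightarrow> 'm \<Rightarrow> 'm \<Rightarrow> 'm \<Rightarrow> bool" where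
  "connections_subdivision_compatible A I p r\<^sub>0 r\<^sub>1 s \<Gamma>\<^sub>l\<^sub>r \<Gamma>\<^sub>u\<^sub>r \<longleftrightarrow>
     copair A (\<i>\<d>\<^bsub>A\<^esub> I \<boxtimes>\<^bsub>A\<^esub> r\<^sub>0) (\<i>\<d>\<^bsub>A\<^esub> I \<boxtimes>\<^bsub>A\<^esub> r\<^sub>1) \<Gamma>\<^sub>l\<^sub>r \<Gamma>\<^sub>u\<^sub>r \<cdot>\<^bsub>A\<^esub> (\<i>\<d>\<^bsub>A\<^esub> I \<boxtimes>\<^bsub>A\<^esub> s)
       = \<r>\<^bsub>A\<^esub> I \<cdot>\<^bsub>A\<^esub> (\<i>\<d>\<^bsub>A\<^esub> I \<boxtimes>\<^bsub>A\<^esub> p)"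

definition strictness_of_identities ::
    "('o, 'm, 'z) moncat_scheme \<Rightarrow> 'o \<Rightarrow> 'm \<Rightarrow> 'm \<Rightarrow> 'm \<Rightarrow> 'm \<Rightarrow> 'm \<Rightarrow> 'm \<Rightarrow> bool" where
  "strictness_of_identities A I i\<^sub>0 i\<^sub>1 p r\<^sub>0 r\<^sub>1 s \<longleftrightarrow>
     copair A r\<^sub>0 r\<^sub>1 (\<i>\<d>\<^bsub>A\<^esub> I) (i\<^sub>0 \<cdot>\<^bsub>A\<^esub> p) \<cdot>\<^bsub>A\<^esub> s = \<i>\<d>\<^bsub>A\<^esub> I \<and>
     copair A r\<^sub>0 r\<^sub>1 (i\<^sub>1 \<cdot>\<^bsub>A\<^esub> p) (\<i>\<d>\<^bsub>A\<^esub> I) \<cdot>\<^bsub>A\<^esub> s = \<i>\<d>\<^bsub>A\<^esub> I"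

section \<open>Cylinders, co-cylinders and homotopy\<close>

record ('o, 'm) cylinder =
  Cyl :: "('o, 'm, 'o, 'm) ftr"
  cyl_i0 :: "'o \<Rightarrow> 'm"
  cyl_i1 :: "'o \<Rightarrow> 'm"
  cyl_p :: "'o \<Rightarrow> 'm"

record ('o, 'm) cocylinder =
  CoCyl :: "('o, 'm, 'o, 'm) ftr"
  cocyl_e0 :: "'o \<Rightarrow> 'm"
  cocyl_e1 :: "'o \<Rightarrow> 'm"
  cocyl_c :: "'o \<Rightarrow> 'm"

definition interval_cylinder ::
    "('o, 'm, 'z) moncat_scheme \<Rightarrow> 'o \<Rightarrow> 'm \<Rightarrow> 'm \<Rightarrow> 'm \<Rightarrow> ('o, 'm) cylinder" where
  "interval_cylinder A I i\<^sub>0 i\<^sub>1 p =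
     \<lparr>Cyl = tensor_right A I,
      cyl_i0 = (\<lambda>a. (\<i>\<d>\<^bsub>A\<^esub> a \<boxtimes>\<^bsub>A\<^esub> i\<^sub>0) \<cdot>\<^bsub>A\<^esub> inv_arr A (\<r>\<^bsub>A\<^esub> a)),
      cyl_i1 = (\<lambda>a. (\<i>\<d>\<^bsub>A\<^esub> a \<boxtimes>\<^bsub>A\<^esub> i\<^sub>1) \<cdot>\<^bsub>A\<^esub> inv_arr A (\<r>\<^bsub>A\<^esub> a)),
      cyl_p = (\<lambda>a. \<r>\<^bsub>A\<^esub> a \<cdot>\<^bsub>A\<^esub> (\<i>\<d>\<^bsub>A\<^esub> a \<boxtimes>\<^bsub>A\<^esub> p))\<rparr>"

definition interval_cocylinder ::
    "('o, 'm, 'z) moncat_scheme \<Rightarrow> 'm \<Rightarrow> 'm \<Rightarrow> 'm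
      \<Rightarrow> ('o, 'm, 'o, 'm) ftr \<Rightarrow> ('o \<Rightarrow> 'm) \<Rightarrow> ('o, 'm) cocylinder" where
  "interval_cocylinder A i\<^sub>0 i\<^sub>1 p E ev =
     \<lparr>CoCyl = E,
      cocyl_e0 = exp_arr A id_functor (Runit A) E ev i\<^sub>0,
      cocyl_e1 = exp_arr A id_functor (Runit A) E ev i\<^sub>1,
      cocyl_c = exp_arr A E ev id_functor (Runit A) p\<rparr>"

definition cyl_homotopic ::
    "('o, 'm, 'z) cat_scheme \<Rightarrow> ('o, 'm) cylinder \<Rightarrow> 'm \<Rightarrow> 'm \<Rightarrow> bool" where
  "cyl_homotopic C K f\<^sub>0 f\<^sub>1 \<longleftrightarrow> (\<exists>a\<^sub>0 a\<^sub>1 h. f\<^sub>0 \<in> hom C a\<^sub>0 a\<^sub>1 \<and> f\<^sub>1 \<in> hom C a\<^sub>0 a\<^sub>1 \<and>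
     h \<in> hom C (OnOb (Cyl K) a\<^sub>0) a\<^sub>1 \<and>
     h \<cdot>\<^bsub>C\<^esub> cyl_i0 K a\<^sub>0 = f\<^sub>0 \<and> h \<cdot>\<^bsub>C\<^esub> cyl_i1 K a\<^sub>0 = f\<^sub>1)"

definition cocyl_homotopic ::
    "('o, 'm, 'z) cat_scheme \<Rightarrow> ('o, 'm) cocylinder \<Rightarrow> 'm \<Rightarrow> 'm \<Rightarrow> bool" where
  "cocyl_homotopic C P f\<^sub>0 f\<^sub>1 \<longleftrightarrow> (\<exists>a\<^sub>0 a\<^sub>1 h. f\<^sub>0 \<in> hom C a\<^sub>0 a\<^sub>1 \<and> f\<^sub>1 \<in> hom C a\<^sub>0 a\<^sub>1 \<and>
     h \<in> hom C a\<^sub>0 (OnOb (CoCyl P) a\<^sub>1) \<and>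
     cocyl_e0 P a\<^sub>1 \<cdot>\<^bsub>C\<^esub> h = f\<^sub>0 \<and> cocyl_e1 P a\<^sub>1 \<cdot>\<^bsub>C\<^esub> h = f\<^sub>1)"

text \<open>Homotopy equivalences for a homotopy relation \<open>H\<close>, to be instantiated by
  \<open>cyl_homotopic\<close> or \<open>cocyl_homotopic\<close>.\<close>

definition homotopy_equivalence ::
    "('o, 'm, 'z) cat_scheme \<Rightarrow> ('m \<Rightarrow> 'm \<Rightarrow> bool) \<Rightarrow> 'm \<Rightarrow> bool" where
  "homotopy_equivalence C H f \<longleftrightarrow> (\<exists>a\<^sub>0 a\<^sub>1. f \<in> hom C a\<^sub>0 a\<^sub>1 \<and>
     (\<exists>g \<in> hom C a\<^sub>1 a\<^sub>0. H (g \<cdot>\<^bsub>C\<^esub> f) (\<i>\<d>\<^bsub>C\<^esub> a\<^sub>0) \<and> H (f \<cdot>\<^bsub>C\<^esub> g) (\<i>\<d>\<^bsub>C\<^esub> a\<^sub>1)))"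

definition cofibration ::
    "('o, 'm, 'z) cat_scheme \<Rightarrow> ('o, 'm) cylinder \<Rightarrow> 'm \<Rightarrow> bool" where
  "cofibration C K j \<longleftrightarrow> (\<exists>a\<^sub>0 a\<^sub>1. j \<in> hom C a\<^sub>0 a\<^sub>1 \<and>
     (\<forall>a\<^sub>2. \<forall>f \<in> hom C a\<^sub>1 a\<^sub>2. \<forall>h \<in> hom C (OnOb (Cyl K) a\<^sub>0) a\<^sub>2.
        h \<cdot>\<^bsub>C\<^esub> cyl_i0 K a\<^sub>0 = f \<cdot>\<^bsub>C\<^esub> j \<longrightarrow>
        (\<exists>k \<in> hom C (OnOb (Cyl K) a\<^sub>1) a\<^sub>2.
           k \<cdot>\<^bsub>C\<^esub> OnArr (Cyl K) j = h \<and> k \<cdot>\<^bsub>C\<^esub> cyl_i0 K a\<^sub>1 = f)))"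

definition normally_cloven_fibration ::
    "('o, 'm, 'z) cat_scheme \<Rightarrow> ('o, 'm) cocylinder \<Rightarrow> 'm \<Rightarrow> bool" where
  "normally_cloven_fibration C P f \<longleftrightarrow> (\<exists>a\<^sub>1 a\<^sub>2. f \<in> hom C a\<^sub>1 a\<^sub>2 \<and>
     (\<exists>k :: 'o \<Rightarrow> 'm \<Rightarrow> 'm \<Rightarrow> 'm.
        (\<forall>a\<^sub>0. \<forall>g \<in> hom C a\<^sub>0 a\<^sub>1. \<forall>h \<in> hom C a\<^sub>0 (OnOb (CoCyl P) a\<^sub>2).
           cocyl_e0 P a\<^sub>2 \<cdot>\<^bsub>C\<^esub> h = f \<cdot>\<^bsub>C\<^esub> g \<longrightarrow>
           k a\<^sub>0 g h \<in> hom C a\<^sub>0 (OnOb (CoCyl P) a\<^sub>1) \<and>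
           OnArr (CoCyl P) f \<cdot>\<^bsub>C\<^esub> k a\<^sub>0 g h = h \<and>
           cocyl_e0 P a\<^sub>1 \<cdot>\<^bsub>C\<^esub> k a\<^sub>0 g h = g) \<and>
        (\<forall>a\<^sub>0. \<forall>g \<in> hom C a\<^sub>0 a\<^sub>1.
           k a\<^sub>0 g (cocyl_c P a\<^sub>2 \<cdot>\<^bsub>C\<^esub> f \<cdot>\<^bsub>C\<^esub> g) = cocyl_c P a\<^sub>1 \<cdot>\<^bsub>C\<^esub> g) \<and>
        (\<forall>a\<^sub>0 b. \<forall>g \<in> hom C a\<^sub>0 a\<^sub>1. \<forall>h \<in> hom C a\<^sub>0 (OnOb (CoCyl P) a\<^sub>2). \<forall>u \<in> hom C b a\<^sub>0.
           cocyl_e0 P a\<^sub>2 \<cdot>\<^bsub>C\<^esub> h = f \<cdot>\<^bsub>C\<^esub> g \<longrightarrow>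
           k b (g \<cdot>\<^bsub>C\<^esub> u) (h \<cdot>\<^bsub>C\<^esub> u) = k a\<^sub>0 g h \<cdot>\<^bsub>C\<^esub> u)))"

section \<open>Model structures\<close>

definition lifts :: "('o, 'm, 'z) cat_scheme \<Rightarrow> 'm \<Rightarrow> 'm \<Rightarrow> bool" where
  "lifts C j f \<longleftrightarrow>
     (\<forall>g \<in> hom C (Dom C j) (Dom C f). \<forall>h \<in> hom C (Cod C j) (Cod C f).
        f \<cdot>\<^bsub>C\<^esub> g = h \<cdot>\<^bsub>C\<^esub> j \<longrightarrow>
        (\<exists>l \<in> hom C (Cod C j) (Dom C f). l \<cdot>\<^bsub>C\<^esub> j = g \<and> f \<cdot>\<^bsub>C\<^esub> l = h))"

definition rlp :: "('o, 'm, 'z) cat_scheme \<Rightarrow> 'm set \<Rightarrow> 'm set" where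
  "rlp C X = {f \<in> Arr C. \<forall>j \<in> X. lifts C j f}"

definition llp :: "('o, 'm, 'z) cat_scheme \<Rightarrow> 'm set \<Rightarrow> 'm set" where
  "llp C X = {j \<in> Arr C. \<forall>f \<in> X. lifts C j f}"

definition two_out_of_three :: "('o, 'm, 'z) cat_scheme \<Rightarrow> 'm set \<Rightarrow> bool" where
  "two_out_of_three C W \<longleftrightarrow>
     (\<forall>x y z. \<forall>f \<in> hom C x y. \<forall>g \<in> hom C y z.
        (f \<in> W \<and> g \<in> W \<longrightarrow> g \<cdot>\<^bsub>C\<^esub> f \<in> W) \<and>
        (f \<in> W \<and> g \<cdot>\<^bsub>C\<^esub> f \<in> W \<longrightarrow> g \<in> W) \<and>
        (g \<in> W \<and> g \<cdot>\<^bsub>C\<^esub> f \<in> W \<longrightarrow> f \<in> W))"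

definition factorises :: "('o, 'm, 'z) cat_scheme \<Rightarrow> 'm set \<Rightarrow> 'm set \<Rightarrow> bool" where
  "factorises C L R \<longleftrightarrow>
     (\<forall>f \<in> Arr C. \<exists>j \<in> L. \<exists>q \<in> R. Cod C j = Dom C q \<and> f = q \<cdot>\<^bsub>C\<^esub> j)"

locale model_structure = category C
  for C :: "('o, 'm, 'z) cat_scheme"
    and Weq :: "'m set" and Fib :: "'m set" and Cof :: "'m set" +
  assumes weq_arr: "Weq \<subseteq> Arr C"
    and fib_arr: "Fib \<subseteq> Arr C"
    and cof_arr: "Cof \<subseteq> Arr C"
    and weq_two_out_of_three: "two_out_of_three C Weq"
    and fib_eq: "Fib = rlp C (Cof \<inter> Weq)"
    and trivial_fib_eq: "Fib \<inter> Weq = rlp C Cof"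
    and cof_eq: "Cof = llp C (Fib \<inter> Weq)"
    and trivial_cof_eq: "Cof \<inter> Weq = llp C Fib"
    and factorisation_cof: "factorises C Cof (Fib \<inter> Weq)"
    and factorisation_fib: "factorises C (Cof \<inter> Weq) Fib"

end

theory Submission
  imports Defs
begin

text \<open>
  The proof is Strom's construction of the homotopical model structure on spaces, with strict
  equations in place of his fillings of squares. The interval enters through the cylinder
  \<open>T = - \<otimes> I\<close> and its right adjoint \<open>P\<close>, and the subdivision through the pasting of two composable
  homotopies. Strictness of identities makes constant homotopies units for pasting (\<open>paste_const\<close>,
  \<open>const_paste\<close>). The compatibility of the connections with the subdivision makes a reversed
  homotopy followed by the homotopy itself constant (\<open>fold_inverse\<close>, \<open>paste_inverse\<close>).

  By this strict inverse law a cofibration that is a homotopy equivalence is the inclusion of a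
  strong deformation retract (\<open>trivial_cofibration_retract\<close>), and dually a fibration that is a
  homotopy equivalence has a section and shrinks onto it over its base
  (\<open>trivial_fibration_shrinking\<close>). With such data, solutions of lifting problems exist up to
  homotopy, and the end of a chosen path lift corrects them. Lifts that are natural and
  lift constant homotopies to constant ones leave untouched the triangle that commuted before. This
  is how normally cloven fibrations are used in \<open>retract_lifts_fibration\<close> and
  \<open>cofibration_lifts_shrinking\<close>.

  Conversely, each evaluation \<open>P y \<rightarrow> y\<close> at the start of a path is a normally cloven fibration and
  a homotopy equivalence (\<open>e0_cleavage\<close>, \<open>e0_equivalence\<close>), and the cofibrations are exactly the
  arrows that lift against all of these (\<open>cofibration_iff_lifts\<close>). So every arrow with the left
  lifting property against fibrations is a cofibration, in particular the first factor of the
  factorisation through the mapping path object (\<open>mapping_path_cleavage\<close>,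
  \<open>mapping_path_retract\<close>). The other factorisation is that through the mapping cylinder
  (\<open>mapping_cylinder_factorisation\<close>), followed by a factorisation of its second factor. The
  remaining closure properties are retract arguments.
\<close>

section \<open>Composition of arrows\<close>

context category
begin

lemma homD: "f \<in> hom C x y \<Longrightarrow> f \<in> Arr C" "f \<in> hom C x y \<Longrightarrow> Dom C f = x"
    "f \<in> hom C x y \<Longrightarrow> Cod C f = y" "f \<in> hom C x y \<Longrightarrow> x \<in> Ob C" "f \<in> hom C x y \<Longrightarrow> y \<in> Ob C"
  by (auto simp: hom_def dom_in_Ob cod_in_Ob)

lemma arr_hom: "f \<in> Arr C \<Longrightarrow> f \<in> hom C (Dom C f) (Cod C f)"
  by (simp add: hom_def)

lemma ide_arr [simp]:
  assumes "x \<in> Ob C"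
  shows "\<i>\<d> x \<in> Arr C" "Dom C (\<i>\<d> x) = x" "Cod C (\<i>\<d> x) = x"
  using ide_in_hom[OF assms] by (auto simp: hom_def)

lemma comp_arr [simp]:
  assumes "f \<in> Arr C" "g \<in> Arr C" "Dom C g = Cod C f"
  shows "g \<cdot> f \<in> Arr C" "Dom C (g \<cdot> f) = Dom C f" "Cod C (g \<cdot> f) = Cod C g"
  using comp_in_hom[of f "Dom C f" "Cod C f" g "Cod C g"] assms by (auto simp: hom_def)

lemma comp_assoc_arr [simp]:
  "f \<in> Arr C \<Longrightarrow> g \<in> Arr C \<Longrightarrow> h \<in> Arr C \<Longrightarrow> Dom C g = Cod C f \<Longrightarrow> Dom C h = Cod C g
    \<Longrightarrow> (h \<cdot> g) \<cdot> f = h \<cdot> (g \<cdot> f)"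
  by (rule comp_assoc) (auto simp: hom_def)

lemma comp_ide_arr [simp]: "f \<in> Arr C \<Longrightarrow> Dom C f = x \<Longrightarrow> f \<cdot> \<i>\<d> x = f"
  by (rule comp_ide) (auto simp: hom_def)

lemma ide_comp_arr [simp]: "f \<in> Arr C \<Longrightarrow> Cod C f = x \<Longrightarrow> \<i>\<d> x \<cdot> f = f"
  by (rule ide_comp) (auto simp: hom_def)

declare dom_in_Ob [simp] cod_in_Ob [simp]

text \<open>Composites are kept associated to the right, so an equation between composites has to be
  made applicable to a composite with a further arrow on the right.\<close>

lemma reassoc:
  assumes "g \<cdot> f = h" "f \<in> Arr C" "g \<in> Arr C" "Dom C g = Cod C f" "e \<in> Arr C" "Cod C e = Dom C f"
  shows "g \<cdot> (f \<cdot> e) = h \<cdot> e"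
  using assms comp_assoc_arr[of e f g] by simp

lemma inv_arr:
  assumes "iso C f"
  shows "inv_arr C f \<in> hom C (Cod C f) (Dom C f)"
    and "inv_arr C f \<cdot> f = \<i>\<d> (Dom C f)" and "f \<cdot> inv_arr C f = \<i>\<d> (Cod C f)"
proof -
  obtain g where g: "inverse_arrows C f g" using assms by (auto simp: iso_def)
  have "h = g" if h: "inverse_arrows C f h" for h
  proof -
    have "h \<cdot> (f \<cdot> g) = (h \<cdot> f) \<cdot> g"
      using g h by (subst comp_assoc_arr) (auto simp: inverse_arrows_def hom_def)
    then show ?thesis using g h by (auto simp: inverse_arrows_def hom_def)
  qed
  then have "inverse_arrows C f (inv_arr C f)"
    unfolding inv_arr_def using g by (rule theI[of "inverse_arrows C f", rotated])
  then show "inv_arr C f \<in> hom C (Cod C f) (Dom C f)"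
    "inv_arr C f \<cdot> f = \<i>\<d> (Dom C f)" "f \<cdot> inv_arr C f = \<i>\<d> (Cod C f)"
    by (auto simp: inverse_arrows_def)
qed

lemma copair:
  assumes po: "pushout C f g u w" and a: "a \<in> hom C (Cod C f) z" and b: "b \<in> hom C (Cod C g) z"
    and e: "a \<cdot> f = b \<cdot> g"
  shows "copair C u w a b \<in> hom C (Cod C u) z" "copair C u w a b \<cdot> u = a" "copair C u w a b \<cdot> w = b"
    and "h \<in> hom C (Cod C u) z \<Longrightarrow> h \<cdot> u = a \<Longrightarrow> h \<cdot> w = b \<Longrightarrow> copair C u w a b = h"
proof -
  have E: "\<exists>!h. h \<in> hom C (Cod C u) (Cod C a) \<and> h \<cdot> u = a \<and> h \<cdot> w = b"
    using po a b e homD(3)[OF a] unfolding pushout_def by blast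
  show 1: "copair C u w a b \<in> hom C (Cod C u) z" "copair C u w a b \<cdot> u = a" "copair C u w a b \<cdot> w = b"
    using theI'[OF E] homD(3)[OF a] by (simp_all add: copair_def)
  show "copair C u w a b = h" if "h \<in> hom C (Cod C u) z" "h \<cdot> u = a" "h \<cdot> w = b"
    using E 1 that homD(3)[OF a] by blast
qed

lemma liftsE:
  assumes "lifts C j f" "f \<cdot> g = h \<cdot> j" "j \<in> hom C a b" "f \<in> hom C x y" "g \<in> hom C a x" "h \<in> hom C b y"
  obtains l where "l \<in> hom C b x" "l \<cdot> j = g" "f \<cdot> l = h"
  using assms homD[OF assms(3)] homD[OF assms(4)] unfolding lifts_def by metis

lemma llpD:
  "j \<in> llp C X \<Longrightarrow> f \<in> X \<Longrightarrow> lifts C j f" "j \<in> llp C X \<Longrightarrow> j \<in> Arr C"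
  "f \<in> rlp C Y \<Longrightarrow> j \<in> Y \<Longrightarrow> lifts C j f" "f \<in> rlp C Y \<Longrightarrow> f \<in> Arr C"
  by (auto simp: llp_def rlp_def)

lemma rlp_mono: "X \<subseteq> Y \<Longrightarrow> rlp C Y \<subseteq> rlp C X"
  by (auto simp: rlp_def)

end

section \<open>Pullbacks and pushouts from finite limits and colimits\<close>

definition pullback :: "('o, 'm, 'z) cat_scheme \<Rightarrow> 'm \<Rightarrow> 'm \<Rightarrow> 'm \<Rightarrow> 'm \<Rightarrow> bool" where
  "pullback C f g u v \<longleftrightarrow>
     f \<in> Arr C \<and> g \<in> Arr C \<and> Cod C f = Cod C g \<and>
     u \<in> hom C (Dom C u) (Dom C f) \<and> v \<in> hom C (Dom C u) (Dom C g) \<and>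
     f \<cdot>\<^bsub>C\<^esub> u = g \<cdot>\<^bsub>C\<^esub> v \<and>
     (\<forall>z. \<forall>a \<in> hom C z (Dom C f). \<forall>b \<in> hom C z (Dom C g).
        f \<cdot>\<^bsub>C\<^esub> a = g \<cdot>\<^bsub>C\<^esub> b \<longrightarrow>
        (\<exists>!h. h \<in> hom C z (Dom C u) \<and> u \<cdot>\<^bsub>C\<^esub> h = a \<and> v \<cdot>\<^bsub>C\<^esub> h = b))"

text \<open>The shapes \<open>0 \<rightarrow> 2 \<leftarrow> 1\<close> and \<open>0 \<leftarrow> 2 \<rightarrow> 1\<close>: the identity of the object \<open>k\<close> is
  the arrow \<open>k\<close>, and \<open>3\<close>, \<open>4\<close> are the two other arrows.\<close>

definition cospan_shape :: "(nat, nat) cat" where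
  "cospan_shape = \<lparr>Ob = {0, 1, 2}, Arr = {0, 1, 2, 3, 4},
     Dom = (\<lambda>k. if k = 3 then 0 else if k = 4 then 1 else k),
     Cod = (\<lambda>k. if k = 3 \<or> k = 4 then 2 else k),
     Ide = (\<lambda>k. k), Comp = (\<lambda>g f. if g < 3 then f else g)\<rparr>"

definition span_shape :: "(nat, nat) cat" where
  "span_shape = \<lparr>Ob = {0, 1, 2}, Arr = {0, 1, 2, 3, 4},
     Dom = (\<lambda>k. if k = 3 \<or> k = 4 then 2 else k),
     Cod = (\<lambda>k. if k = 3 then 0 else if k = 4 then 1 else k),
     Ide = (\<lambda>k. k), Comp = (\<lambda>g f. if g < 3 then f else g)\<rparr>"

definition span_diagram ::
    "('o, 'm, 'z) cat_scheme \<Rightarrow> 'o \<Rightarrow> 'o \<Rightarrow> 'o \<Rightarrow> 'm \<Rightarrow> 'm \<Rightarrow> (nat, nat, 'o, 'm) ftr" where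
  "span_diagram C a b c f g =
     \<lparr>OnOb = (\<lambda>k. if k = 0 then a else if k = 1 then b else c),
      OnArr = (\<lambda>k. if k = 0 then \<i>\<d>\<^bsub>C\<^esub> a else if k = 1 then \<i>\<d>\<^bsub>C\<^esub> b else if k = 2 then \<i>\<d>\<^bsub>C\<^esub> c
        else if k = 3 then f else g)\<rparr>"

lemma finite_cospan_shape: "finite_category cospan_shape"
  unfolding finite_category_def cospan_shape_def
  by (intro conjI; (unfold_locales)?) (auto simp: hom_def split: if_splits)

lemma finite_span_shape: "finite_category span_shape"
  unfolding finite_category_def span_shape_def
  by (intro conjI; (unfold_locales)?) (auto simp: hom_def split: if_splits)

context category
begin

lemma cospan_functor:
  assumes "f \<in> hom C a c" "g \<in> hom C b c"
  shows "is_functor cospan_shape C (span_diagram C a b c f g)"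
proof -
  interpret J: category cospan_shape using finite_cospan_shape by (simp add: finite_category_def)
  show ?thesis
    by unfold_locales (use assms homD[OF assms(1)] homD[OF assms(2)] in
      \<open>auto simp: cospan_shape_def span_diagram_def hom_def split: if_splits\<close>)
qed

lemma span_functor:
  assumes "f \<in> hom C c a" "g \<in> hom C c b"
  shows "is_functor span_shape C (span_diagram C a b c f g)"
proof -
  interpret J: category span_shape using finite_span_shape by (simp add: finite_category_def)
  show ?thesis
    by unfold_locales (use assms homD[OF assms(1)] homD[OF assms(2)] in
      \<open>auto simp: span_shape_def span_diagram_def hom_def split: if_splits\<close>)
qed

lemma cospan_cone_iff:
  assumes f: "f \<in> hom C a c" and g: "g \<in> hom C b c"
  shows "cone cospan_shape C (span_diagram C a b c f g) x \<tau> \<longleftrightarrow>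
    \<tau> 0 \<in> hom C x a \<and> \<tau> 1 \<in> hom C x b \<and> f \<cdot> \<tau> 0 = \<tau> 2 \<and> g \<cdot> \<tau> 1 = \<tau> 2" (is "?l \<longleftrightarrow> ?r")
proof
  assume l: ?l
  then have "\<tau> 0 \<in> hom C x a" "\<tau> 1 \<in> hom C x b"
    by (auto simp: cone_def cospan_shape_def span_diagram_def)
  moreover have "3 \<in> hom cospan_shape 0 2" "4 \<in> hom cospan_shape 1 2"
    by (auto simp: hom_def cospan_shape_def)
  then have "f \<cdot> \<tau> 0 = \<tau> 2" "g \<cdot> \<tau> 1 = \<tau> 2"
    using l unfolding cone_def by (fastforce simp: span_diagram_def)+
  ultimately show ?r by simp
next
  assume r: ?r
  then have "\<tau> 2 \<in> hom C x c" using f comp_in_hom by fastforce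
  then show ?l using r homD(4)[of "\<tau> 0"]
    by (auto simp: cone_def cospan_shape_def span_diagram_def hom_def split: if_splits)
qed

lemma span_cocone_iff:
  assumes f: "f \<in> hom C c a" and g: "g \<in> hom C c b"
  shows "cocone span_shape C (span_diagram C a b c f g) x \<tau> \<longleftrightarrow>
    \<tau> 0 \<in> hom C a x \<and> \<tau> 1 \<in> hom C b x \<and> \<tau> 0 \<cdot> f = \<tau> 2 \<and> \<tau> 1 \<cdot> g = \<tau> 2" (is "?l \<longleftrightarrow> ?r")
proof
  assume l: ?l
  then have "\<tau> 0 \<in> hom C a x" "\<tau> 1 \<in> hom C b x"
    by (auto simp: cocone_def span_shape_def span_diagram_def)
  moreover have "3 \<in> hom span_shape 2 0" "4 \<in> hom span_shape 2 1"
    by (auto simp: hom_def span_shape_def)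
  then have "\<tau> 0 \<cdot> f = \<tau> 2" "\<tau> 1 \<cdot> g = \<tau> 2"
    using l unfolding cocone_def by (fastforce simp: span_diagram_def)+
  ultimately show ?r by simp
next
  assume r: ?r
  then have "\<tau> 2 \<in> hom C c x" using f comp_in_hom by fastforce
  then show ?l using r homD(5)[of "\<tau> 0"]
    by (auto simp: cocone_def span_shape_def span_diagram_def hom_def split: if_splits)
qed

lemma has_pullbacks:
  assumes lim: "has_finite_limits C" and f: "f \<in> hom C a c" and g: "g \<in> hom C b c"
  shows "\<exists>u v. pullback C f g u v"
proof -
  let ?D = "span_diagram C a b c f g"
  obtain x \<tau> where L: "limit_cone cospan_shape C ?D x \<tau>"
    using lim finite_cospan_shape cospan_functor[OF f g] unfolding has_finite_limits_def by blast
  then have \<tau>: "\<tau> 0 \<in> hom C x a" "\<tau> 1 \<in> hom C x b" "f \<cdot> \<tau> 0 = \<tau> 2" "g \<cdot> \<tau> 1 = \<tau> 2"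
    by (auto simp: limit_cone_def cospan_cone_iff[OF f g])
  have "\<exists>!h. h \<in> hom C z x \<and> \<tau> 0 \<cdot> h = p \<and> \<tau> 1 \<cdot> h = q"
    if p: "p \<in> hom C z a" and q: "q \<in> hom C z b" and e: "f \<cdot> p = g \<cdot> q" for z p q
  proof -
    let ?\<sigma> = "\<lambda>k::nat. if k = 0 then p else if k = 1 then q else f \<cdot> p"
    have "cone cospan_shape C ?D z ?\<sigma>" using p q e by (simp add: cospan_cone_iff[OF f g])
    then have E: "\<exists>!h. h \<in> hom C z x \<and> (\<forall>i \<in> Ob cospan_shape. \<tau> i \<cdot> h = ?\<sigma> i)"
      using L by (simp add: limit_cone_def)
    have "(\<forall>i \<in> Ob cospan_shape. \<tau> i \<cdot> h = ?\<sigma> i) \<longleftrightarrow> \<tau> 0 \<cdot> h = p \<and> \<tau> 1 \<cdot> h = q"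
      if "h \<in> hom C z x" for h
    proof -
      have "\<tau> 2 \<cdot> h = f \<cdot> (\<tau> 0 \<cdot> h)"
        using comp_assoc[OF that \<tau>(1) f] \<tau>(3) by simp
      then show ?thesis by (auto simp: cospan_shape_def)
    qed
    then show ?thesis using E by (simp cong: conj_cong)
  qed
  then have "pullback C f g (\<tau> 0) (\<tau> 1)"
    using \<tau> homD[OF f] homD[OF g] homD[OF \<tau>(1)] by (simp add: pullback_def)
  then show ?thesis by blast
qed

lemma has_pushouts:
  assumes colim: "has_finite_colimits C" and f: "f \<in> hom C c a" and g: "g \<in> hom C c b"
  shows "\<exists>u v. pushout C f g u v"
proof -
  let ?D = "span_diagram C a b c f g"
  obtain x \<tau> where L: "colimit_cocone span_shape C ?D x \<tau>"
    using colim finite_span_shape span_functor[OF f g] unfolding has_finite_colimits_def by blast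
  then have \<tau>: "\<tau> 0 \<in> hom C a x" "\<tau> 1 \<in> hom C b x" "\<tau> 0 \<cdot> f = \<tau> 2" "\<tau> 1 \<cdot> g = \<tau> 2"
    by (auto simp: colimit_cocone_def span_cocone_iff[OF f g])
  have "\<exists>!h. h \<in> hom C x z \<and> h \<cdot> \<tau> 0 = p \<and> h \<cdot> \<tau> 1 = q"
    if p: "p \<in> hom C a z" and q: "q \<in> hom C b z" and e: "p \<cdot> f = q \<cdot> g" for z p q
  proof -
    let ?\<sigma> = "\<lambda>k::nat. if k = 0 then p else if k = 1 then q else p \<cdot> f"
    have "cocone span_shape C ?D z ?\<sigma>" using p q e by (simp add: span_cocone_iff[OF f g])
    then have E: "\<exists>!h. h \<in> hom C x z \<and> (\<forall>i \<in> Ob span_shape. h \<cdot> \<tau> i = ?\<sigma> i)"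
      using L by (simp add: colimit_cocone_def)
    have "(\<forall>i \<in> Ob span_shape. h \<cdot> \<tau> i = ?\<sigma> i) \<longleftrightarrow> h \<cdot> \<tau> 0 = p \<and> h \<cdot> \<tau> 1 = q"
      if "h \<in> hom C x z" for h
    proof -
      have "h \<cdot> \<tau> 2 = (h \<cdot> \<tau> 0) \<cdot> f"
        using comp_assoc[OF f \<tau>(1) that] \<tau>(3) by simp
      then show ?thesis by (auto simp: span_shape_def)
    qed
    then show ?thesis using E by (simp cong: conj_cong)
  qed
  then have "pushout C f g (\<tau> 0) (\<tau> 1)"
    using \<tau> homD[OF f] homD[OF g] homD[OF \<tau>(1)] by (simp add: pushout_def)
  then show ?thesis by blast
qed

end

section \<open>Cylinders with structure\<close>

text \<open>What the argument needs of \<open>- \<otimes> I\<close>, without the monoidal structure. The connection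
  \<open>\<Gamma>\<close> is the lower right one; it provides the initial segments of a path. The operation
  \<open>paste b g h\<close> performs the homotopy \<open>g\<close> and then \<open>h\<close>. It is an operation on arrows rather than
  a subdivided cylinder, since the subdivision is only ever used for pasting. The last three of its
  laws are strict: a constant homotopy is a unit on either side, and a reversed homotopy followed by
  the homotopy itself is constant.\<close>

locale structured_cylinder = category C
  for C :: "('o, 'm, 'z) cat_scheme" (structure) +
  fixes K :: "('o, 'm) cylinder" and Q :: "('o, 'm) cocylinder" and ev :: "'o \<Rightarrow> 'm"
    and v \<Gamma> :: "'o \<Rightarrow> 'm" and paste :: "'o \<Rightarrow> 'm \<Rightarrow> 'm \<Rightarrow> 'm"
  assumes adjoint: "right_adjoint C C (Cyl K) (CoCyl Q) ev"
    and i0_nat: "nat_trans C C id_functor (Cyl K) (cyl_i0 K)"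
    and i1_nat: "nat_trans C C id_functor (Cyl K) (cyl_i1 K)"
    and p_nat: "nat_trans C C (Cyl K) id_functor (cyl_p K)"
    and v_nat: "nat_trans C C (Cyl K) (Cyl K) v"
    and \<Gamma>_nat: "nat_trans C C (comp_functor (Cyl K) (Cyl K)) (Cyl K) \<Gamma>"
    and p_i0: "a \<in> Ob C \<Longrightarrow> cyl_p K a \<cdot> cyl_i0 K a = \<i>\<d> a"
    and p_i1: "a \<in> Ob C \<Longrightarrow> cyl_p K a \<cdot> cyl_i1 K a = \<i>\<d> a"
    and v_i0: "a \<in> Ob C \<Longrightarrow> v a \<cdot> cyl_i0 K a = cyl_i1 K a"
    and v_i1: "a \<in> Ob C \<Longrightarrow> v a \<cdot> cyl_i1 K a = cyl_i0 K a"
    and p_v: "a \<in> Ob C \<Longrightarrow> cyl_p K a \<cdot> v a = cyl_p K a"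
    and \<Gamma>_cyl_i0: "a \<in> Ob C \<Longrightarrow> \<Gamma> a \<cdot> OnArr (Cyl K) (cyl_i0 K a) = cyl_i0 K a \<cdot> cyl_p K a"
    and \<Gamma>_cyl_i1: "a \<in> Ob C \<Longrightarrow> \<Gamma> a \<cdot> OnArr (Cyl K) (cyl_i1 K a) = \<i>\<d> (OnOb (Cyl K) a)"
    and \<Gamma>_i0: "a \<in> Ob C \<Longrightarrow> \<Gamma> a \<cdot> cyl_i0 K (OnOb (Cyl K) a) = cyl_i0 K a \<cdot> cyl_p K a"
    and \<Gamma>_i1: "a \<in> Ob C \<Longrightarrow> \<Gamma> a \<cdot> cyl_i1 K (OnOb (Cyl K) a) = \<i>\<d> (OnOb (Cyl K) a)"
    and p_\<Gamma>: "a \<in> Ob C \<Longrightarrow> cyl_p K a \<cdot> \<Gamma> a = cyl_p K a \<cdot> cyl_p K (OnOb (Cyl K) a)"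
    and paste_in_hom: "b \<in> Ob C \<Longrightarrow> g \<in> hom C (OnOb (Cyl K) b) y \<Longrightarrow> h \<in> hom C (OnOb (Cyl K) b) y
      \<Longrightarrow> g \<cdot> cyl_i1 K b = h \<cdot> cyl_i0 K b
      \<Longrightarrow> paste b g h \<in> hom C (OnOb (Cyl K) b) y \<and>
        paste b g h \<cdot> cyl_i0 K b = g \<cdot> cyl_i0 K b \<and> paste b g h \<cdot> cyl_i1 K b = h \<cdot> cyl_i1 K b"
    and paste_comp_cyl: "m \<in> hom C a b
      \<Longrightarrow> g \<in> hom C (OnOb (Cyl K) b) y \<Longrightarrow> h \<in> hom C (OnOb (Cyl K) b) y
      \<Longrightarrow> g \<cdot> cyl_i1 K b = h \<cdot> cyl_i0 K b
      \<Longrightarrow> paste b g h \<cdot> OnArr (Cyl K) m = paste a (g \<cdot> OnArr (Cyl K) m) (h \<cdot> OnArr (Cyl K) m)"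
    and comp_paste: "n \<in> hom C y z \<Longrightarrow> b \<in> Ob C
      \<Longrightarrow> g \<in> hom C (OnOb (Cyl K) b) y \<Longrightarrow> h \<in> hom C (OnOb (Cyl K) b) y
      \<Longrightarrow> g \<cdot> cyl_i1 K b = h \<cdot> cyl_i0 K b
      \<Longrightarrow> n \<cdot> paste b g h = paste b (n \<cdot> g) (n \<cdot> h)"
    and paste_const: "b \<in> Ob C \<Longrightarrow> g \<in> hom C (OnOb (Cyl K) b) y
      \<Longrightarrow> paste b g (g \<cdot> (cyl_i1 K b \<cdot> cyl_p K b)) = g"
    and const_paste: "b \<in> Ob C \<Longrightarrow> h \<in> hom C (OnOb (Cyl K) b) y
      \<Longrightarrow> paste b (h \<cdot> (cyl_i0 K b \<cdot> cyl_p K b)) h = h"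
    and paste_inverse: "b \<in> Ob C \<Longrightarrow> h \<in> hom C (OnOb (Cyl K) b) y
      \<Longrightarrow> paste b (h \<cdot> v b) h = h \<cdot> (cyl_i1 K b \<cdot> cyl_p K b)"
    and e0_eq: "y \<in> Ob C \<Longrightarrow> cocyl_e0 Q y = ev y \<cdot> cyl_i0 K (OnOb (CoCyl Q) y)"
    and e1_eq: "y \<in> Ob C \<Longrightarrow> cocyl_e1 Q y = ev y \<cdot> cyl_i1 K (OnOb (CoCyl Q) y)"
    and c_in_hom: "y \<in> Ob C \<Longrightarrow> cocyl_c Q y \<in> hom C y (OnOb (CoCyl Q) y)"
    and ev_c: "y \<in> Ob C \<Longrightarrow> ev y \<cdot> OnArr (Cyl K) (cocyl_c Q y) = cyl_p K y"
begin

abbreviation "T \<equiv> OnOb (Cyl K)"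
abbreviation "Ta \<equiv> OnArr (Cyl K)"
abbreviation "P \<equiv> OnOb (CoCyl Q)"
abbreviation "Pa \<equiv> OnArr (CoCyl Q)"
abbreviation "i\<^sub>0 \<equiv> cyl_i0 K"
abbreviation "i\<^sub>1 \<equiv> cyl_i1 K"
abbreviation "p \<equiv> cyl_p K"

abbreviation "homotopic \<equiv> cyl_homotopic C K"
abbreviation "equivalence \<equiv> homotopy_equivalence C homotopic"
abbreviation "fibration \<equiv> normally_cloven_fibration C Q"
abbreviation "cofib \<equiv> cofibration C K"

lemma T_functor: "is_functor C C (Cyl K)" and P_functor: "is_functor C C (CoCyl Q)"
  using adjoint by (auto simp: right_adjoint_def)

lemma T_ob [simp]: "a \<in> Ob C \<Longrightarrow> T a \<in> Ob C"
  by (rule is_functor.on_ob[OF T_functor])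

lemma P_ob [simp]: "a \<in> Ob C \<Longrightarrow> P a \<in> Ob C"
  by (rule is_functor.on_ob[OF P_functor])

lemma T_arr [simp]:
  "f \<in> Arr C \<Longrightarrow> Ta f \<in> Arr C" "f \<in> Arr C \<Longrightarrow> Dom C (Ta f) = T (Dom C f)"
  "f \<in> Arr C \<Longrightarrow> Cod C (Ta f) = T (Cod C f)"
  using is_functor.on_arr[OF T_functor arr_hom] by (auto simp: hom_def)

lemma P_arr [simp]:
  "f \<in> Arr C \<Longrightarrow> Pa f \<in> Arr C" "f \<in> Arr C \<Longrightarrow> Dom C (Pa f) = P (Dom C f)"
  "f \<in> Arr C \<Longrightarrow> Cod C (Pa f) = P (Cod C f)"
  using is_functor.on_arr[OF P_functor arr_hom] by (auto simp: hom_def)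

lemma T_ide [simp]: "a \<in> Ob C \<Longrightarrow> Ta (\<i>\<d> a) = \<i>\<d> (T a)"
  by (rule is_functor.on_ide[OF T_functor])

lemma T_comp [simp]: "f \<in> Arr C \<Longrightarrow> g \<in> Arr C \<Longrightarrow> Dom C g = Cod C f \<Longrightarrow> Ta (g \<cdot> f) = Ta g \<cdot> Ta f"
  using is_functor.on_comp[OF T_functor, of f _ _ g] by (auto simp: hom_def)

lemma structure_arr [simp]:
  assumes "a \<in> Ob C"
  shows "i\<^sub>0 a \<in> Arr C" "Dom C (i\<^sub>0 a) = a" "Cod C (i\<^sub>0 a) = T a"
    "i\<^sub>1 a \<in> Arr C" "Dom C (i\<^sub>1 a) = a" "Cod C (i\<^sub>1 a) = T a"
    "p a \<in> Arr C" "Dom C (p a) = T a" "Cod C (p a) = a"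
    "v a \<in> Arr C" "Dom C (v a) = T a" "Cod C (v a) = T a"
    "\<Gamma> a \<in> Arr C" "Dom C (\<Gamma> a) = T (T a)" "Cod C (\<Gamma> a) = T a"
    "ev a \<in> Arr C" "Dom C (ev a) = T (P a)" "Cod C (ev a) = a"
    "cocyl_c Q a \<in> Arr C" "Dom C (cocyl_c Q a) = a" "Cod C (cocyl_c Q a) = P a"
  using assms i0_nat i1_nat p_nat v_nat \<Gamma>_nat adjoint c_in_hom[OF assms]
  by (auto simp: nat_trans_def right_adjoint_def id_functor_def comp_functor_def hom_def)

lemma structure_natural:
  assumes "f \<in> Arr C"
  shows "Ta f \<cdot> i\<^sub>0 (Dom C f) = i\<^sub>0 (Cod C f) \<cdot> f" "Ta f \<cdot> i\<^sub>1 (Dom C f) = i\<^sub>1 (Cod C f) \<cdot> f"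
    "p (Cod C f) \<cdot> Ta f = f \<cdot> p (Dom C f)" "v (Cod C f) \<cdot> Ta f = Ta f \<cdot> v (Dom C f)"
    "\<Gamma> (Cod C f) \<cdot> Ta (Ta f) = Ta f \<cdot> \<Gamma> (Dom C f)"
    "ev (Cod C f) \<cdot> Ta (Pa f) = f \<cdot> ev (Dom C f)"
proof -
  show "Ta f \<cdot> i\<^sub>0 (Dom C f) = i\<^sub>0 (Cod C f) \<cdot> f" "Ta f \<cdot> i\<^sub>1 (Dom C f) = i\<^sub>1 (Cod C f) \<cdot> f"
    "p (Cod C f) \<cdot> Ta f = f \<cdot> p (Dom C f)" "v (Cod C f) \<cdot> Ta f = Ta f \<cdot> v (Dom C f)"
    "\<Gamma> (Cod C f) \<cdot> Ta (Ta f) = Ta f \<cdot> \<Gamma> (Dom C f)"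
    "ev (Cod C f) \<cdot> Ta (Pa f) = f \<cdot> ev (Dom C f)"
    using arr_hom[OF assms] i0_nat i1_nat p_nat v_nat \<Gamma>_nat adjoint
    by (auto simp: nat_trans_def right_adjoint_def id_functor_def comp_functor_def dest!: spec bspec)
qed

text \<open>As rewrite rules, the naturality equations let an arrow of the category pass to the left of
  \<open>p\<close>, \<open>v\<close>, \<open>\<Gamma>\<close> and \<open>ev\<close>, and to the right of \<open>i\<^sub>0\<close> and \<open>i\<^sub>1\<close>. The
  components of the structure then become adjacent and the remaining equations cancel them.\<close>

lemma structure_simps [simp]:
  "f \<in> Arr C \<Longrightarrow> Dom C f = a \<Longrightarrow> Ta f \<cdot> i\<^sub>0 a = i\<^sub>0 (Cod C f) \<cdot> f"
  "f \<in> Arr C \<Longrightarrow> Dom C f = a \<Longrightarrow> Ta f \<cdot> i\<^sub>1 a = i\<^sub>1 (Cod C f) \<cdot> f"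
  "f \<in> Arr C \<Longrightarrow> Cod C f = b \<Longrightarrow> p b \<cdot> Ta f = f \<cdot> p (Dom C f)"
  "f \<in> Arr C \<Longrightarrow> Cod C f = b \<Longrightarrow> v b \<cdot> Ta f = Ta f \<cdot> v (Dom C f)"
  "f \<in> Arr C \<Longrightarrow> Cod C f = b \<Longrightarrow> \<Gamma> b \<cdot> Ta (Ta f) = Ta f \<cdot> \<Gamma> (Dom C f)"
  "f \<in> Arr C \<Longrightarrow> Cod C f = b \<Longrightarrow> ev b \<cdot> Ta (Pa f) = f \<cdot> ev (Dom C f)"
  "a \<in> Ob C \<Longrightarrow> ev a \<cdot> Ta (cocyl_c Q a) = p a"
  "a \<in> Ob C \<Longrightarrow> p a \<cdot> i\<^sub>0 a = \<i>\<d> a"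
  "a \<in> Ob C \<Longrightarrow> p a \<cdot> i\<^sub>1 a = \<i>\<d> a"
  "a \<in> Ob C \<Longrightarrow> v a \<cdot> i\<^sub>0 a = i\<^sub>1 a"
  "a \<in> Ob C \<Longrightarrow> v a \<cdot> i\<^sub>1 a = i\<^sub>0 a"
  "a \<in> Ob C \<Longrightarrow> p a \<cdot> v a = p a"
  "a \<in> Ob C \<Longrightarrow> \<Gamma> a \<cdot> Ta (i\<^sub>0 a) = i\<^sub>0 a \<cdot> p a"
  "a \<in> Ob C \<Longrightarrow> \<Gamma> a \<cdot> Ta (i\<^sub>1 a) = \<i>\<d> (T a)"
  "a \<in> Ob C \<Longrightarrow> \<Gamma> a \<cdot> i\<^sub>0 (T a) = i\<^sub>0 a \<cdot> p a"
  "a \<in> Ob C \<Longrightarrow> \<Gamma> a \<cdot> i\<^sub>1 (T a) = \<i>\<d> (T a)"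
  "a \<in> Ob C \<Longrightarrow> p a \<cdot> \<Gamma> a = p a \<cdot> p (T a)"
  using structure_natural ev_c p_i0 p_i1 v_i0 v_i1 p_v \<Gamma>_cyl_i0 \<Gamma>_cyl_i1 \<Gamma>_i0 \<Gamma>_i1 p_\<Gamma> by auto

lemma structure_simps' [simp]:
  "f \<in> Arr C \<Longrightarrow> Dom C f = a \<Longrightarrow> e \<in> Arr C \<Longrightarrow> Cod C e = a \<Longrightarrow>
    Ta f \<cdot> (i\<^sub>0 a \<cdot> e) = i\<^sub>0 (Cod C f) \<cdot> (f \<cdot> e)"
  "f \<in> Arr C \<Longrightarrow> Dom C f = a \<Longrightarrow> e \<in> Arr C \<Longrightarrow> Cod C e = a \<Longrightarrow>
    Ta f \<cdot> (i\<^sub>1 a \<cdot> e) = i\<^sub>1 (Cod C f) \<cdot> (f \<cdot> e)"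
  "f \<in> Arr C \<Longrightarrow> Cod C f = b \<Longrightarrow> e \<in> Arr C \<Longrightarrow> Cod C e = T (Dom C f) \<Longrightarrow>
    p b \<cdot> (Ta f \<cdot> e) = f \<cdot> (p (Dom C f) \<cdot> e)"
  "f \<in> Arr C \<Longrightarrow> Cod C f = b \<Longrightarrow> e \<in> Arr C \<Longrightarrow> Cod C e = T (Dom C f) \<Longrightarrow>
    v b \<cdot> (Ta f \<cdot> e) = Ta f \<cdot> (v (Dom C f) \<cdot> e)"
  "f \<in> Arr C \<Longrightarrow> Cod C f = b \<Longrightarrow> e \<in> Arr C \<Longrightarrow> Cod C e = T (T (Dom C f)) \<Longrightarrow>
    \<Gamma> b \<cdot> (Ta (Ta f) \<cdot> e) = Ta f \<cdot> (\<Gamma> (Dom C f) \<cdot> e)"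
  "f \<in> Arr C \<Longrightarrow> Cod C f = b \<Longrightarrow> e \<in> Arr C \<Longrightarrow> Cod C e = T (P (Dom C f)) \<Longrightarrow>
    ev b \<cdot> (Ta (Pa f) \<cdot> e) = f \<cdot> (ev (Dom C f) \<cdot> e)"
  "a \<in> Ob C \<Longrightarrow> e \<in> Arr C \<Longrightarrow> Cod C e = T a \<Longrightarrow> ev a \<cdot> (Ta (cocyl_c Q a) \<cdot> e) = p a \<cdot> e"
  "a \<in> Ob C \<Longrightarrow> e \<in> Arr C \<Longrightarrow> Cod C e = a \<Longrightarrow> p a \<cdot> (i\<^sub>0 a \<cdot> e) = e"
  "a \<in> Ob C \<Longrightarrow> e \<in> Arr C \<Longrightarrow> Cod C e = a \<Longrightarrow> p a \<cdot> (i\<^sub>1 a \<cdot> e) = e"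
  "a \<in> Ob C \<Longrightarrow> e \<in> Arr C \<Longrightarrow> Cod C e = a \<Longrightarrow> v a \<cdot> (i\<^sub>0 a \<cdot> e) = i\<^sub>1 a \<cdot> e"
  "a \<in> Ob C \<Longrightarrow> e \<in> Arr C \<Longrightarrow> Cod C e = a \<Longrightarrow> v a \<cdot> (i\<^sub>1 a \<cdot> e) = i\<^sub>0 a \<cdot> e"
  "a \<in> Ob C \<Longrightarrow> e \<in> Arr C \<Longrightarrow> Cod C e = T a \<Longrightarrow> p a \<cdot> (v a \<cdot> e) = p a \<cdot> e"
  "a \<in> Ob C \<Longrightarrow> e \<in> Arr C \<Longrightarrow> Cod C e = T a \<Longrightarrow> \<Gamma> a \<cdot> (Ta (i\<^sub>0 a) \<cdot> e) = i\<^sub>0 a \<cdot> (p a \<cdot> e)"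
  "a \<in> Ob C \<Longrightarrow> e \<in> Arr C \<Longrightarrow> Cod C e = T a \<Longrightarrow> \<Gamma> a \<cdot> (Ta (i\<^sub>1 a) \<cdot> e) = e"
  "a \<in> Ob C \<Longrightarrow> e \<in> Arr C \<Longrightarrow> Cod C e = T a \<Longrightarrow> \<Gamma> a \<cdot> (i\<^sub>0 (T a) \<cdot> e) = i\<^sub>0 a \<cdot> (p a \<cdot> e)"
  "a \<in> Ob C \<Longrightarrow> e \<in> Arr C \<Longrightarrow> Cod C e = T a \<Longrightarrow> \<Gamma> a \<cdot> (i\<^sub>1 (T a) \<cdot> e) = e"
  "a \<in> Ob C \<Longrightarrow> e \<in> Arr C \<Longrightarrow> Cod C e = T (T a) \<Longrightarrow> p a \<cdot> (\<Gamma> a \<cdot> e) = p a \<cdot> (p (T a) \<cdot> e)"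
  by (use structure_simps[THEN reassoc] in auto)

lemma pasteD:
  assumes "b \<in> Ob C" "g \<in> hom C (T b) y" "h \<in> hom C (T b) y" "g \<cdot> i\<^sub>1 b = h \<cdot> i\<^sub>0 b"
  shows "paste b g h \<in> hom C (T b) y" "paste b g h \<cdot> i\<^sub>0 b = g \<cdot> i\<^sub>0 b" "paste b g h \<cdot> i\<^sub>1 b = h \<cdot> i\<^sub>1 b"
  using paste_in_hom[OF assms] by auto

section \<open>Transposition and cleavages\<close>

text \<open>The object \<open>a\<close> is an argument because \<open>T\<close> need not be injective on objects, so that the
  domain \<open>T a\<close> of \<open>h\<close> does not determine it.\<close>

definition cur :: "'o \<Rightarrow> 'm \<Rightarrow> 'm" where
  "cur a h = (THE g. g \<in> hom C a (P (Cod C h)) \<and> ev (Cod C h) \<cdot> Ta g = h)"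

lemma transpose_ex1:
  "a \<in> Ob C \<Longrightarrow> h \<in> hom C (T a) y \<Longrightarrow> \<exists>!g. g \<in> hom C a (P y) \<and> ev y \<cdot> Ta g = h"
  using adjoint homD(5)[of h] unfolding right_adjoint_def by blast

lemma cur:
  assumes "a \<in> Ob C" "h \<in> hom C (T a) y"
  shows "cur a h \<in> hom C a (P y)" "ev y \<cdot> Ta (cur a h) = h"
  using theI'[OF transpose_ex1[OF assms]] homD(3)[OF assms(2)] by (auto simp: cur_def)

lemma transpose_eqI:
  assumes "g \<in> hom C a (P y)" "g' \<in> hom C a (P y)" "ev y \<cdot> Ta g = ev y \<cdot> Ta g'" "y \<in> Ob C"
  shows "g = g'"
proof -
  have "ev y \<cdot> Ta g \<in> hom C (T a) y" using homD[OF assms(1)] assms(4) by (simp add: hom_def)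
  then show ?thesis using transpose_ex1[of a "ev y \<cdot> Ta g" y] assms homD(4)[OF assms(1)] by metis
qed

text \<open>The chosen lifts of a normally cloven fibration, transposed. Homotopies of both kinds then are
  arrows out of a cylinder, and lifting and extension arguments can be combined.\<close>

definition cleavage :: "'o \<Rightarrow> 'o \<Rightarrow> 'm \<Rightarrow> ('o \<Rightarrow> 'm \<Rightarrow> 'm \<Rightarrow> 'm) \<Rightarrow> bool" where
  "cleavage x y f k \<longleftrightarrow> f \<in> hom C x y \<and>
     (\<forall>a g h. g \<in> hom C a x \<longrightarrow> h \<in> hom C (T a) y \<longrightarrow> h \<cdot> i\<^sub>0 a = f \<cdot> g \<longrightarrow>
        k a g h \<in> hom C (T a) x \<and> f \<cdot> k a g h = h \<and> k a g h \<cdot> i\<^sub>0 a = g) \<and>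
     (\<forall>a g. g \<in> hom C a x \<longrightarrow> k a g (f \<cdot> (g \<cdot> p a)) = g \<cdot> p a) \<and>
     (\<forall>a b g h u. g \<in> hom C a x \<longrightarrow> h \<in> hom C (T a) y \<longrightarrow> u \<in> hom C b a \<longrightarrow>
        h \<cdot> i\<^sub>0 a = f \<cdot> g \<longrightarrow> k b (g \<cdot> u) (h \<cdot> Ta u) = k a g h \<cdot> Ta u)"

lemma cleavage_lift:
  assumes "cleavage x y f k" "g \<in> hom C a x" "h \<in> hom C (T a) y" "h \<cdot> i\<^sub>0 a = f \<cdot> g"
  shows "k a g h \<in> hom C (T a) x" "f \<cdot> k a g h = h" "k a g h \<cdot> i\<^sub>0 a = g"
  using assms unfolding cleavage_def by metis+

lemma cleavage_normal:
  "cleavage x y f k \<Longrightarrow> g \<in> hom C a x \<Longrightarrow> k a g (f \<cdot> (g \<cdot> p a)) = g \<cdot> p a"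
  unfolding cleavage_def by metis

lemma cleavage_natural:
  "cleavage x y f k \<Longrightarrow> g \<in> hom C a x \<Longrightarrow> h \<in> hom C (T a) y \<Longrightarrow> h \<cdot> i\<^sub>0 a = f \<cdot> g \<Longrightarrow> u \<in> hom C b a
    \<Longrightarrow> k b (g \<cdot> u) (h \<cdot> Ta u) = k a g h \<cdot> Ta u"
  unfolding cleavage_def by metis

lemma e0_comp:
  assumes "y \<in> Ob C" "h \<in> hom C a (P y)"
  shows "cocyl_e0 Q y \<cdot> h = ev y \<cdot> (Ta h \<cdot> i\<^sub>0 a)" "cocyl_e1 Q y \<cdot> h = ev y \<cdot> (Ta h \<cdot> i\<^sub>1 a)"
  using assms homD[OF assms(2)] by (simp_all add: e0_eq e1_eq)

lemma cur_comp:
  assumes "h \<in> hom C (T a) y" "u \<in> hom C b a"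
  shows "cur a h \<cdot> u = cur b (h \<cdot> Ta u)"
proof -
  note [simp] = homD[OF assms(1)] homD[OF assms(2)]
  have h: "h \<cdot> Ta u \<in> hom C (T b) y" by (simp add: hom_def)
  note c = cur[OF _ assms(1)] and c' = cur[OF _ h]
  note [simp] = homD[OF c(1)] homD[OF c'(1)] c(2) c'(2)
  show ?thesis
    by (rule transpose_eqI[of _ b y]) (simp_all add: hom_def reassoc[OF c(2)])
qed

lemma cleavage_if_fibration:
  assumes "fibration f"
  shows "\<exists>x y k. cleavage x y f k"
proof -
  obtain x y k where f: "f \<in> hom C x y"
    and k: "\<And>a g h. g \<in> hom C a x \<Longrightarrow> h \<in> hom C a (P y) \<Longrightarrow> cocyl_e0 Q y \<cdot> h = f \<cdot> g \<Longrightarrow>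
      k a g h \<in> hom C a (P x) \<and> Pa f \<cdot> k a g h = h \<and> cocyl_e0 Q x \<cdot> k a g h = g"
    and kn: "\<And>a g. g \<in> hom C a x \<Longrightarrow> k a g (cocyl_c Q y \<cdot> f \<cdot> g) = cocyl_c Q x \<cdot> g"
    and ku: "\<And>a b g h u. g \<in> hom C a x \<Longrightarrow> h \<in> hom C a (P y) \<Longrightarrow> u \<in> hom C b a \<Longrightarrow>
      cocyl_e0 Q y \<cdot> h = f \<cdot> g \<Longrightarrow> k b (g \<cdot> u) (h \<cdot> u) = k a g h \<cdot> u"
    using assms unfolding normally_cloven_fibration_def by (elim exE conjE) blast
  note [simp] = homD[OF f]
  let ?k = "\<lambda>a g h. ev x \<cdot> Ta (k a g (cur a h))"
  have pre: "cur a h \<in> hom C a (P y) \<and> cocyl_e0 Q y \<cdot> cur a h = f \<cdot> g"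
    if g: "g \<in> hom C a x" and h: "h \<in> hom C (T a) y" and e: "h \<cdot> i\<^sub>0 a = f \<cdot> g" for a g h
  proof -
    note [simp] = homD[OF g] homD[OF h]
    have c: "cur a h \<in> hom C a (P y)" "ev y \<cdot> Ta (cur a h) = h" using cur[OF _ h] by simp_all
    note [simp] = homD[OF c(1)]
    have "cocyl_e0 Q y \<cdot> cur a h = (ev y \<cdot> Ta (cur a h)) \<cdot> i\<^sub>0 a"
      using e0_comp[OF _ c(1)] by simp
    then show ?thesis using c e by simp
  qed
  have "cleavage x y f ?k"
    unfolding cleavage_def
  proof (intro conjI allI impI)
    show "f \<in> hom C x y" by (fact f)
  next
    fix a g h assume g: "g \<in> hom C a x" and h: "h \<in> hom C (T a) y" and e: "h \<cdot> i\<^sub>0 a = f \<cdot> g"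
    note [simp] = homD[OF g] homD[OF h] homD[OF conjunct1[OF pre[OF g h e]]]
    have K: "k a g (cur a h) \<in> hom C a (P x)" "Pa f \<cdot> k a g (cur a h) = cur a h"
      "cocyl_e0 Q x \<cdot> k a g (cur a h) = g"
      using k[OF g, of "cur a h"] pre[OF g h e] by auto
    note [simp] = homD[OF K(1)]
    show "ev x \<cdot> Ta (k a g (cur a h)) \<in> hom C (T a) x" by (simp add: hom_def)
    have "f \<cdot> (ev x \<cdot> Ta (k a g (cur a h))) = ev y \<cdot> Ta (Pa f \<cdot> k a g (cur a h))" by simp
    then show "f \<cdot> (ev x \<cdot> Ta (k a g (cur a h))) = h" using K(2) cur(2)[OF _ h] by simp
    show "ev x \<cdot> Ta (k a g (cur a h)) \<cdot> i\<^sub>0 a = g" using K(3) e0_comp[OF _ K(1)] by simp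
  next
    fix a g assume g: "g \<in> hom C a x"
    note [simp] = homD[OF g]
    have h: "f \<cdot> (g \<cdot> p a) \<in> hom C (T a) y" by (simp add: hom_def)
    note c = cur[OF _ h]
    note [simp] = homD[OF c(1)]
    have "cur a (f \<cdot> (g \<cdot> p a)) = cocyl_c Q y \<cdot> f \<cdot> g"
      by (rule transpose_eqI[of _ a y]) (use c in \<open>simp_all add: hom_def\<close>)
    then show "ev x \<cdot> Ta (k a g (cur a (f \<cdot> (g \<cdot> p a)))) = g \<cdot> p a"
      using kn[OF g] by simp
  next
    fix a b g h u assume g: "g \<in> hom C a x" and h: "h \<in> hom C (T a) y" and u: "u \<in> hom C b a"
      and e: "h \<cdot> i\<^sub>0 a = f \<cdot> g"
    note [simp] = homD[OF g] homD[OF h] homD[OF u]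
    have K: "k a g (cur a h) \<in> hom C a (P x)"
      using k[OF g, of "cur a h"] pre[OF g h e] by auto
    note [simp] = homD[OF K(1)]
    show "ev x \<cdot> Ta (k b (g \<cdot> u) (cur b (h \<cdot> Ta u))) = ev x \<cdot> Ta (k a g (cur a h)) \<cdot> Ta u"
      using ku[OF g _ u, of "cur a h"] pre[OF g h e] cur_comp[OF h u] by simp
  qed
  then show ?thesis by blast
qed

lemma fibration_if_cleavage:
  assumes k: "cleavage x y f k"
  shows "fibration f"
proof -
  have f: "f \<in> hom C x y" using k by (simp add: cleavage_def)
  note [simp] = homD[OF f]
  let ?k = "\<lambda>a g h. cur a (k a g (ev y \<cdot> Ta h))"
  have pre: "ev y \<cdot> Ta h \<in> hom C (T a) y" "(ev y \<cdot> Ta h) \<cdot> i\<^sub>0 a = f \<cdot> g"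
    if g: "g \<in> hom C a x" and h: "h \<in> hom C a (P y)" and e: "cocyl_e0 Q y \<cdot> h = f \<cdot> g" for a g h
    using homD[OF g] homD[OF h] e e0_comp[OF _ h] by (simp_all add: hom_def)
  show ?thesis
    unfolding normally_cloven_fibration_def
  proof (rule exI[of _ x], rule exI[of _ y], rule conjI[OF f], rule exI[of _ ?k], intro conjI allI ballI impI)
    fix a g h assume g: "g \<in> hom C a x" and h: "h \<in> hom C a (P y)" and e: "cocyl_e0 Q y \<cdot> h = f \<cdot> g"
    note [simp] = homD[OF g] homD[OF h]
    note K = cleavage_lift[OF k g pre[OF g h e]]
    note c = cur[OF _ K(1)]
    note [simp] = homD[OF K(1)] homD[OF c(1)]
    show "?k a g h \<in> hom C a (P x)" using c by simp
    show "Pa f \<cdot> ?k a g h = h"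
      by (rule transpose_eqI[of _ a y]) (use h c(2) K(2) in \<open>simp_all add: hom_def\<close>)
    show "cocyl_e0 Q x \<cdot> ?k a g h = g"
      using e0_comp(1)[OF _ c(1)] K(3) reassoc[OF c(2), of "i\<^sub>0 a"] by simp
  next
    fix a g assume g: "g \<in> hom C a x"
    note [simp] = homD[OF g]
    have "g \<cdot> p a \<in> hom C (T a) x" by (simp add: hom_def)
    note c = cur[OF _ this]
    note [simp] = homD[OF c(1)]
    have "?k a g (cocyl_c Q y \<cdot> f \<cdot> g) = cur a (g \<cdot> p a)"
      using cleavage_normal[OF k g] by simp
    also have "\<dots> = cocyl_c Q x \<cdot> g"
      by (rule transpose_eqI[of _ a x]) (use c in \<open>simp_all add: hom_def\<close>)
    finally show "?k a g (cocyl_c Q y \<cdot> f \<cdot> g) = cocyl_c Q x \<cdot> g" .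
  next
    fix a b g h u assume g: "g \<in> hom C a x" and h: "h \<in> hom C a (P y)" and u: "u \<in> hom C b a"
      and e: "cocyl_e0 Q y \<cdot> h = f \<cdot> g"
    note [simp] = homD[OF g] homD[OF h] homD[OF u]
    show "?k b (g \<cdot> u) (h \<cdot> u) = ?k a g h \<cdot> u"
      using cleavage_natural[OF k g pre[OF g h e] u] cur_comp[OF cleavage_lift(1)[OF k g pre[OF g h e]] u]
      by simp
  qed
qed


section \<open>Homotopy equivalences\<close>

lemma homotopicI:
  assumes "a \<in> Ob C" "h \<in> hom C (T a) y"
  shows "homotopic (h \<cdot> i\<^sub>0 a) (h \<cdot> i\<^sub>1 a)"
  unfolding cyl_homotopic_def
  by (rule exI[of _ a], rule exI[of _ y], rule exI[of _ h])
    (use assms homD[OF assms(2)] in \<open>simp add: hom_def\<close>)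

lemma homotopicE:
  assumes "homotopic f g"
  obtains a y h where "f \<in> hom C a y" "g \<in> hom C a y" "h \<in> hom C (T a) y"
    "h \<cdot> i\<^sub>0 a = f" "h \<cdot> i\<^sub>1 a = g"
  using assms unfolding cyl_homotopic_def by blast

lemma homotopic_typed:
  assumes "homotopic f g" "g \<in> hom C a y"
  obtains h where "h \<in> hom C (T a) y" "h \<cdot> i\<^sub>0 a = f" "h \<cdot> i\<^sub>1 a = g"
  using assms by (elim homotopicE) (auto simp: hom_def)

lemma homotopic_refl:
  assumes "f \<in> Arr C" shows "homotopic f f"
  using homotopicI[of "Dom C f" "f \<cdot> p (Dom C f)" "Cod C f"] assms by (simp add: hom_def)

lemma homotopic_sym:
  assumes "homotopic f g" shows "homotopic g f"
proof -
  obtain a y h where h: "h \<in> hom C (T a) y" "h \<cdot> i\<^sub>0 a = f" "h \<cdot> i\<^sub>1 a = g" and f: "f \<in> hom C a y"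
    using assms by (rule homotopicE)
  note [simp] = homD[OF h(1)] homD[OF f]
  show ?thesis using homotopicI[of a "h \<cdot> v a" y] h by (simp add: hom_def)
qed

lemma homotopic_trans [trans]:
  assumes "homotopic f g" "homotopic g l" shows "homotopic f l"
proof -
  obtain a y h where h: "h \<in> hom C (T a) y" "h \<cdot> i\<^sub>0 a = f" "h \<cdot> i\<^sub>1 a = g" and g: "g \<in> hom C a y"
    using assms(1) by (rule homotopicE)
  obtain a' y' k where k: "k \<in> hom C (T a') y'" "k \<cdot> i\<^sub>0 a' = g" "k \<cdot> i\<^sub>1 a' = l" "g \<in> hom C a' y'"
    using assms(2) by (rule homotopicE)
  have [simp]: "a' = a" "y' = y" using k(4) g by (auto simp: hom_def)
  have k': "k \<in> hom C (T a) y" "h \<cdot> i\<^sub>1 a = k \<cdot> i\<^sub>0 a" using k h by auto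
  have a: "a \<in> Ob C" by (rule homD(4)[OF g])
  show ?thesis
    using homotopicI[OF a, of "paste a h k" y] pasteD[OF a h(1) k'] k(3) h(2) by simp
qed

lemma homotopic_comp:
  assumes "homotopic f g" "m \<in> hom C b (Dom C f)" "n \<in> hom C (Cod C f) z"
  shows "homotopic (n \<cdot> (f \<cdot> m)) (n \<cdot> (g \<cdot> m))"
proof -
  obtain a y h where h: "h \<in> hom C (T a) y" "h \<cdot> i\<^sub>0 a = f" "h \<cdot> i\<^sub>1 a = g" and f: "f \<in> hom C a y"
    using assms(1) by (rule homotopicE)
  note [simp] = homD[OF h(1)] homD[OF f] homD[OF assms(2)] homD[OF assms(3)]
    reassoc[OF h(2)] reassoc[OF h(3)]
  show ?thesis using homotopicI[of b "n \<cdot> (h \<cdot> Ta m)" z] by (simp add: hom_def)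
qed

lemma homotopic_post:
  assumes "homotopic f g" "n \<in> hom C (Cod C f) z" shows "homotopic (n \<cdot> f) (n \<cdot> g)"
proof -
  obtain a y where fg: "f \<in> hom C a y" "g \<in> hom C a y" using assms(1) by (rule homotopicE)
  note [simp] = homD[OF fg(1)] homD[OF fg(2)]
  show ?thesis using homotopic_comp[OF assms(1) _ assms(2), of "\<i>\<d> a" a] by (simp add: hom_def)
qed

lemma homotopic_pre:
  assumes "homotopic f g" "m \<in> hom C b (Dom C f)" shows "homotopic (f \<cdot> m) (g \<cdot> m)"
proof -
  obtain a y where fg: "f \<in> hom C a y" "g \<in> hom C a y" using assms(1) by (rule homotopicE)
  note [simp] = homD[OF fg(1)] homD[OF fg(2)] homD[OF assms(2)]
  show ?thesis using homotopic_comp[OF assms, of "\<i>\<d> y" y] by (simp add: hom_def)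
qed

lemma equivalenceE:
  assumes "equivalence f" "f \<in> hom C a y"
  obtains g where "g \<in> hom C y a" "homotopic (g \<cdot> f) (\<i>\<d> a)" "homotopic (f \<cdot> g) (\<i>\<d> y)"
  using assms by (auto simp: homotopy_equivalence_def hom_def)

lemma equivalenceI:
  assumes "f \<in> hom C a y" "g \<in> hom C y a" "homotopic (g \<cdot> f) (\<i>\<d> a)" "homotopic (f \<cdot> g) (\<i>\<d> y)"
  shows "equivalence f"
  using assms by (auto simp: homotopy_equivalence_def)

lemma two_out_of_three_equivalence: "two_out_of_three C {f. equivalence f}"
  unfolding two_out_of_three_def
proof (intro allI ballI conjI impI; elim conjE; unfold mem_Collect_eq)
  fix x y z f g assume f: "f \<in> hom C x y" and g: "g \<in> hom C y z"
  note [simp] = homD[OF f] homD[OF g]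
  have gf: "g \<cdot> f \<in> hom C x z" by (simp add: hom_def)
  {
    assume F: "equivalence f" and G: "equivalence g"
    obtain f' where f': "f' \<in> hom C y x" "homotopic (f' \<cdot> f) (\<i>\<d> x)" "homotopic (f \<cdot> f') (\<i>\<d> y)"
      using F f by (rule equivalenceE)
    obtain g' where g': "g' \<in> hom C z y" "homotopic (g' \<cdot> g) (\<i>\<d> y)" "homotopic (g \<cdot> g') (\<i>\<d> z)"
      using G g by (rule equivalenceE)
    note [simp] = homD[OF f'(1)] homD[OF g'(1)]
    have "homotopic (f' \<cdot> ((g' \<cdot> g) \<cdot> f)) (f' \<cdot> (\<i>\<d> y \<cdot> f))"
      by (rule homotopic_comp[OF g'(2)]) (use f f' in simp_all)
    also have "homotopic (f' \<cdot> (\<i>\<d> y \<cdot> f)) (\<i>\<d> x)" using f'(2) by simp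
    finally have 1: "homotopic ((f' \<cdot> g') \<cdot> (g \<cdot> f)) (\<i>\<d> x)" by simp
    have "homotopic (g \<cdot> ((f \<cdot> f') \<cdot> g')) (g \<cdot> (\<i>\<d> y \<cdot> g'))"
      by (rule homotopic_comp[OF f'(3)]) (use g g' in simp_all)
    also have "homotopic (g \<cdot> (\<i>\<d> y \<cdot> g')) (\<i>\<d> z)" using g'(3) by simp
    finally have 2: "homotopic ((g \<cdot> f) \<cdot> (f' \<cdot> g')) (\<i>\<d> z)" by simp
    show "equivalence (g \<cdot> f)"
      by (rule equivalenceI[OF gf _ 1 2]) (simp add: hom_def)
  next
    assume F: "equivalence f" and GF: "equivalence (g \<cdot> f)"
    obtain f' where f': "f' \<in> hom C y x" "homotopic (f' \<cdot> f) (\<i>\<d> x)" "homotopic (f \<cdot> f') (\<i>\<d> y)"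
      using F f by (rule equivalenceE)
    obtain k where k: "k \<in> hom C z x" "homotopic (k \<cdot> (g \<cdot> f)) (\<i>\<d> x)" "homotopic ((g \<cdot> f) \<cdot> k) (\<i>\<d> z)"
      using GF gf by (rule equivalenceE)
    note [simp] = homD[OF f'(1)] homD[OF k(1)]
    have 1: "homotopic (g \<cdot> (f \<cdot> k)) (\<i>\<d> z)" using k(3) by simp
    have "homotopic ((f \<cdot> (k \<cdot> g)) \<cdot> (\<i>\<d> y)) ((f \<cdot> (k \<cdot> g)) \<cdot> (f \<cdot> f'))"
      by (rule homotopic_post[OF homotopic_sym[OF f'(3)]]) (simp add: hom_def)
    also have "homotopic ((f \<cdot> (k \<cdot> g)) \<cdot> (f \<cdot> f')) (f \<cdot> (\<i>\<d> x \<cdot> f'))"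
      using homotopic_comp[OF k(2), of f' y f y] by (simp add: hom_def)
    also have "homotopic (f \<cdot> (\<i>\<d> x \<cdot> f')) (\<i>\<d> y)" using f'(3) by simp
    finally have 2: "homotopic ((f \<cdot> k) \<cdot> g) (\<i>\<d> y)" by simp
    show "equivalence g"
      by (rule equivalenceI[OF g _ 2 1]) (simp add: hom_def)
  next
    assume G: "equivalence g" and GF: "equivalence (g \<cdot> f)"
    obtain g' where g': "g' \<in> hom C z y" "homotopic (g' \<cdot> g) (\<i>\<d> y)" "homotopic (g \<cdot> g') (\<i>\<d> z)"
      using G g by (rule equivalenceE)
    obtain k where k: "k \<in> hom C z x" "homotopic (k \<cdot> (g \<cdot> f)) (\<i>\<d> x)" "homotopic ((g \<cdot> f) \<cdot> k) (\<i>\<d> z)"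
      using GF gf by (rule equivalenceE)
    note [simp] = homD[OF g'(1)] homD[OF k(1)]
    have 1: "homotopic ((k \<cdot> g) \<cdot> f) (\<i>\<d> x)" using k(2) by simp
    have "homotopic ((\<i>\<d> y) \<cdot> (f \<cdot> (k \<cdot> g))) ((g' \<cdot> g) \<cdot> (f \<cdot> (k \<cdot> g)))"
      by (rule homotopic_pre[OF homotopic_sym[OF g'(2)]]) (simp add: hom_def)
    also have "homotopic ((g' \<cdot> g) \<cdot> (f \<cdot> (k \<cdot> g))) (g' \<cdot> (\<i>\<d> z \<cdot> g))"
      using homotopic_comp[OF k(3), of g y g' y] by (simp add: hom_def)
    also have "homotopic (g' \<cdot> (\<i>\<d> z \<cdot> g)) (\<i>\<d> y)" using g'(2) by simp
    finally have 2: "homotopic (f \<cdot> (k \<cdot> g)) (\<i>\<d> y)" by simp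
    show "equivalence f"
      by (rule equivalenceI[OF f _ 1 2]) (simp add: hom_def)
  }
qed

lemma cocyl_homotopic_iff: "cocyl_homotopic C Q f g \<longleftrightarrow> homotopic f g"
proof
  assume "cocyl_homotopic C Q f g"
  then obtain a y h where f: "f \<in> hom C a y" and h: "h \<in> hom C a (P y)"
    "cocyl_e0 Q y \<cdot> h = f" "cocyl_e1 Q y \<cdot> h = g"
    unfolding cocyl_homotopic_def by blast
  note [simp] = homD[OF f] homD[OF h(1)]
  show "homotopic f g"
    using homotopicI[of a "ev y \<cdot> Ta h" y] e0_comp[OF _ h(1)] h(2,3) by (simp add: hom_def)
next
  assume "homotopic f g"
  then obtain a y h where f: "f \<in> hom C a y" "g \<in> hom C a y" and h: "h \<in> hom C (T a) y"
    "h \<cdot> i\<^sub>0 a = f" "h \<cdot> i\<^sub>1 a = g"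
    by (rule homotopicE)
  note [simp] = homD[OF f(1)] homD[OF h(1)]
  note c = cur[OF _ h(1)]
  note [simp] = homD[OF c(1)]
  have "ev y \<cdot> (Ta (cur a h) \<cdot> e) = h \<cdot> e" if "e \<in> hom C a (T a)" for e
    using homD[OF that] by (intro reassoc c(2)) simp_all
  from this[of "i\<^sub>0 a"] this[of "i\<^sub>1 a"]
  have "cocyl_e0 Q y \<cdot> cur a h = f" "cocyl_e1 Q y \<cdot> cur a h = g"
    using e0_comp[OF _ c(1)] h by (simp_all add: hom_def)
  then show "cocyl_homotopic C Q f g"
    unfolding cocyl_homotopic_def using f c(1) by auto
qed

section \<open>Trivial cofibrations and trivial fibrations\<close>

text \<open>In both definitions the homotopy runs from the idempotent to the identity. It starts at the end
  from which fibrations lift paths and cofibrations extend homotopies.\<close>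

definition strong_deformation_retract :: "'o \<Rightarrow> 'o \<Rightarrow> 'm \<Rightarrow> 'm \<Rightarrow> 'm \<Rightarrow> bool" where
  "strong_deformation_retract a b j r H \<longleftrightarrow> j \<in> hom C a b \<and> r \<in> hom C b a \<and> H \<in> hom C (T b) b \<and>
     r \<cdot> j = \<i>\<d> a \<and> H \<cdot> i\<^sub>0 b = j \<cdot> r \<and> H \<cdot> i\<^sub>1 b = \<i>\<d> b \<and> H \<cdot> Ta j = j \<cdot> p a"

definition shrinking :: "'o \<Rightarrow> 'o \<Rightarrow> 'm \<Rightarrow> 'm \<Rightarrow> 'm \<Rightarrow> bool" where
  "shrinking x y f s H \<longleftrightarrow> f \<in> hom C x y \<and> s \<in> hom C y x \<and> H \<in> hom C (T x) x \<and>
     f \<cdot> s = \<i>\<d> y \<and> H \<cdot> i\<^sub>0 x = s \<cdot> f \<and> H \<cdot> i\<^sub>1 x = \<i>\<d> x \<and> f \<cdot> H = f \<cdot> p x"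

lemma cofibration_extend:
  assumes "cofib j" "j \<in> hom C a b" "f \<in> hom C b y" "h \<in> hom C (T a) y" "h \<cdot> i\<^sub>0 a = f \<cdot> j"
  obtains k where "k \<in> hom C (T b) y" "k \<cdot> Ta j = h" "k \<cdot> i\<^sub>0 b = f"
  using assms unfolding cofibration_def by (auto simp: hom_def)

lemma strong_deformation_retract_equivalence:
  assumes "strong_deformation_retract a b j r H"
  shows "equivalence j"
proof -
  have j: "j \<in> hom C a b" and r: "r \<in> hom C b a" and H: "H \<in> hom C (T b) b"
    and e: "r \<cdot> j = \<i>\<d> a" "H \<cdot> i\<^sub>0 b = j \<cdot> r" "H \<cdot> i\<^sub>1 b = \<i>\<d> b"
    using assms by (auto simp: strong_deformation_retract_def)
  note [simp] = homD[OF j]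
  show ?thesis
    using equivalenceI[OF j r] homotopic_refl[of "\<i>\<d> a"] homotopicI[OF _ H] e by simp
qed

text \<open>Dold's theorem. The extension property turns a homotopy inverse into a strict retraction \<open>r\<close>, with
  a homotopy \<open>H\<^sub>0\<close> from \<open>j \<cdot> r\<close> to the identity that may move \<open>j\<close>. Running first through the
  reverse of \<open>H\<^sub>0 \<cdot> Ta (j \<cdot> r)\<close>, a homotopy from \<open>j \<cdot> r\<close> to itself, and then through \<open>H\<^sub>0\<close>
  leaves the endpoints unchanged. On \<open>j\<close> both parts are the same homotopy, once reversed, so the
  pasting is constant there by the strict inverse law.\<close>

lemma trivial_cofibration_retract:
  assumes cof: "cofib j" and weq: "equivalence j" and j: "j \<in> hom C a b"
  shows "\<exists>r H. strong_deformation_retract a b j r H"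
proof -
  note [simp] = homD[OF j]
  obtain g where g: "g \<in> hom C b a" "homotopic (g \<cdot> j) (\<i>\<d> a)" "homotopic (j \<cdot> g) (\<i>\<d> b)"
    using weq j by (rule equivalenceE)
  note [simp] = homD[OF g(1)]
  obtain h where h: "h \<in> hom C (T a) a" "h \<cdot> i\<^sub>0 a = g \<cdot> j" "h \<cdot> i\<^sub>1 a = \<i>\<d> a"
    by (rule homotopic_typed[OF g(2)]) (auto simp: hom_def)
  obtain k where k: "k \<in> hom C (T b) a" "k \<cdot> Ta j = h" "k \<cdot> i\<^sub>0 b = g"
    by (rule cofibration_extend[OF cof j g(1) h(1,2)])
  note [simp] = homD[OF k(1)]
  define r where "r = k \<cdot> i\<^sub>1 b"
  have r: "r \<in> hom C b a" unfolding r_def by (simp add: hom_def)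
  note [simp] = homD[OF r]
  have rj: "r \<cdot> j = \<i>\<d> a"
  proof -
    have "r \<cdot> j = (k \<cdot> Ta j) \<cdot> i\<^sub>1 a" unfolding r_def by simp
    then show ?thesis using k(2) h(3) by simp
  qed
  have "homotopic g r"
    using homotopicI[OF _ k(1)] by (simp add: k(3) r_def)
  then have "homotopic (j \<cdot> r) (j \<cdot> g)"
    by (rule homotopic_sym[OF homotopic_post]) (use j in simp_all)
  from homotopic_trans[OF this g(3)]
  obtain H\<^sub>0 where H\<^sub>0: "H\<^sub>0 \<in> hom C (T b) b" "H\<^sub>0 \<cdot> i\<^sub>0 b = j \<cdot> r" "H\<^sub>0 \<cdot> i\<^sub>1 b = \<i>\<d> b"
    by (rule homotopic_typed[where a = b and y = b]) (simp_all add: ide_in_hom)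
  note [simp] = homD[OF H\<^sub>0(1)] reassoc[OF H\<^sub>0(2)] reassoc[OF H\<^sub>0(3)] H\<^sub>0(2,3) rj reassoc[OF rj]
  let ?G = "H\<^sub>0 \<cdot> (Ta j \<cdot> (Ta r \<cdot> v b))"
  have G: "?G \<in> hom C (T b) b" by (simp add: hom_def)
  have glue: "?G \<cdot> i\<^sub>1 b = H\<^sub>0 \<cdot> i\<^sub>0 b" by simp
  note P = pasteD[OF _ G H\<^sub>0(1) glue]
  have "paste b ?G H\<^sub>0 \<cdot> Ta j = paste a (?G \<cdot> Ta j) (H\<^sub>0 \<cdot> Ta j)"
    by (rule paste_comp_cyl[OF j G H\<^sub>0(1) glue])
  also have "?G \<cdot> Ta j = (H\<^sub>0 \<cdot> Ta j) \<cdot> v a"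
  proof -
    have "Ta r \<cdot> Ta j = Ta (r \<cdot> j)" by (rule T_comp[symmetric]) simp_all
    also have "\<dots> = \<i>\<d> (T a)" unfolding rj by simp
    finally have "Ta r \<cdot> Ta j = \<i>\<d> (T a)" .
    from reassoc[OF this, of "v a"] have "Ta r \<cdot> (Ta j \<cdot> v a) = v a" by simp
    then show ?thesis by simp
  qed
  also have "paste a ((H\<^sub>0 \<cdot> Ta j) \<cdot> v a) (H\<^sub>0 \<cdot> Ta j) = (H\<^sub>0 \<cdot> Ta j) \<cdot> (i\<^sub>1 a \<cdot> p a)"
    by (rule paste_inverse[of a _ b]) (simp_all add: hom_def)
  also have "\<dots> = j \<cdot> p a" by simp
  finally have "strong_deformation_retract a b j r (paste b ?G H\<^sub>0)"
    unfolding strong_deformation_retract_def using P j r rj by simp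
  then show ?thesis by blast
qed

text \<open>The dual of the preceding lemma: the homotopy from \<open>s \<cdot> f\<close> to the identity is preceded by the
  reverse of its image under \<open>s \<cdot> f\<close>, after which \<open>f\<close> maps it to a constant homotopy.\<close>

lemma trivial_fibration_shrinking:
  assumes fib: "cleavage x y f k" and weq: "equivalence f"
  shows "\<exists>s H. shrinking x y f s H"
proof -
  have f: "f \<in> hom C x y" using fib by (simp add: cleavage_def)
  note [simp] = homD[OF f]
  obtain g where g: "g \<in> hom C y x" "homotopic (g \<cdot> f) (\<i>\<d> x)" "homotopic (f \<cdot> g) (\<i>\<d> y)"
    using weq f by (rule equivalenceE)
  note [simp] = homD[OF g(1)]
  obtain h where h: "h \<in> hom C (T y) y" "h \<cdot> i\<^sub>0 y = f \<cdot> g" "h \<cdot> i\<^sub>1 y = \<i>\<d> y"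
    by (rule homotopic_typed[OF g(3)]) (auto simp: hom_def)
  note L = cleavage_lift[OF fib g(1) h(1,2)]
  note [simp] = homD[OF L(1)] reassoc[OF L(2)]
  define s where "s = k y g h \<cdot> i\<^sub>1 y"
  have s: "s \<in> hom C y x" unfolding s_def by (simp add: hom_def)
  note [simp] = homD[OF s]
  have fs: "f \<cdot> s = \<i>\<d> y" unfolding s_def using h(3) by simp
  have "homotopic g s"
    using homotopicI[OF _ L(1)] L(3) by (simp add: s_def)
  then have "homotopic (s \<cdot> f) (g \<cdot> f)"
    by (rule homotopic_sym[OF homotopic_pre]) (use f in simp_all)
  from homotopic_trans[OF this g(2)]
  obtain H\<^sub>0 where H\<^sub>0: "H\<^sub>0 \<in> hom C (T x) x" "H\<^sub>0 \<cdot> i\<^sub>0 x = s \<cdot> f" "H\<^sub>0 \<cdot> i\<^sub>1 x = \<i>\<d> x"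
    by (rule homotopic_typed[where a = x and y = x]) (simp_all add: ide_in_hom)
  note [simp] = homD[OF H\<^sub>0(1)] reassoc[OF H\<^sub>0(2)] reassoc[OF H\<^sub>0(3)] H\<^sub>0(2,3) fs reassoc[OF fs]
  let ?G = "s \<cdot> (f \<cdot> (H\<^sub>0 \<cdot> v x))"
  have G: "?G \<in> hom C (T x) x" by (simp add: hom_def)
  have glue: "?G \<cdot> i\<^sub>1 x = H\<^sub>0 \<cdot> i\<^sub>0 x" by simp
  note P = pasteD[OF _ G H\<^sub>0(1) glue]
  have "f \<cdot> paste x ?G H\<^sub>0 = paste x (f \<cdot> ?G) (f \<cdot> H\<^sub>0)"
    by (rule comp_paste[OF f _ G H\<^sub>0(1) glue]) simp
  also have "f \<cdot> ?G = (f \<cdot> H\<^sub>0) \<cdot> v x" by simp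
  also have "paste x ((f \<cdot> H\<^sub>0) \<cdot> v x) (f \<cdot> H\<^sub>0) = (f \<cdot> H\<^sub>0) \<cdot> (i\<^sub>1 x \<cdot> p x)"
    by (rule paste_inverse[of x _ y]) (simp_all add: hom_def)
  also have "\<dots> = f \<cdot> p x" by simp
  finally have "shrinking x y f s (paste x ?G H\<^sub>0)"
    unfolding shrinking_def using P f s fs by simp
  then show ?thesis by blast
qed

section \<open>Lifting\<close>

text \<open>Lifting the homotopy \<open>h \<cdot> H\<close> from \<open>g \<cdot> r\<close> and taking the end of the lift gives the lower
  triangle for any path lifting. The upper triangle is where clovenness counts: by naturality, the
  restriction of the chosen lift along \<open>j\<close> is the chosen lift of a constant homotopy, and by
  normality that is constant at \<open>g\<close>.\<close>

lemma retract_lifts_fibration: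
  assumes S: "strong_deformation_retract a b j r H" and fib: "cleavage x y f k"
  shows "lifts C j f"
proof -
  have j: "j \<in> hom C a b" and r: "r \<in> hom C b a" and H: "H \<in> hom C (T b) b"
    and e: "r \<cdot> j = \<i>\<d> a" "H \<cdot> i\<^sub>0 b = j \<cdot> r" "H \<cdot> i\<^sub>1 b = \<i>\<d> b" "H \<cdot> Ta j = j \<cdot> p a"
    using S by (auto simp: strong_deformation_retract_def)
  have f: "f \<in> hom C x y" using fib by (simp add: cleavage_def)
  note [simp] = homD[OF j] homD[OF r] homD[OF H] homD[OF f] e e[THEN reassoc]
  have "\<exists>l \<in> hom C b x. l \<cdot> j = g \<and> f \<cdot> l = h"
    if g: "g \<in> hom C a x" and h: "h \<in> hom C b y" and sq: "f \<cdot> g = h \<cdot> j" for g h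
  proof
    note [simp] = homD[OF g] homD[OF h] sq reassoc[OF sq]
    have gr: "g \<cdot> r \<in> hom C b x" and hH: "h \<cdot> H \<in> hom C (T b) y"
      and start: "(h \<cdot> H) \<cdot> i\<^sub>0 b = f \<cdot> (g \<cdot> r)"
      by (simp_all add: hom_def)
    note L = cleavage_lift[OF fib gr hH start]
    note [simp] = homD[OF L(1)]
    let ?l = "k b (g \<cdot> r) (h \<cdot> H) \<cdot> i\<^sub>1 b"
    show "?l \<in> hom C b x" by (simp add: hom_def)
    have "k b (g \<cdot> r) (h \<cdot> H) \<cdot> Ta j = k a ((g \<cdot> r) \<cdot> j) ((h \<cdot> H) \<cdot> Ta j)"
      by (rule cleavage_natural[OF fib gr hH start j, symmetric])
    also have "\<dots> = k a g (f \<cdot> (g \<cdot> p a))" by simp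
    also have "\<dots> = g \<cdot> p a" by (rule cleavage_normal[OF fib g])
    finally have N: "k b (g \<cdot> r) (h \<cdot> H) \<cdot> Ta j = g \<cdot> p a" .
    have "?l \<cdot> j = (k b (g \<cdot> r) (h \<cdot> H) \<cdot> Ta j) \<cdot> i\<^sub>1 a" by simp
    also have "\<dots> = g" unfolding N by simp
    finally show "?l \<cdot> j = g \<and> f \<cdot> ?l = h" using reassoc[OF L(2), of "i\<^sub>1 b"] by simp
  qed
  then show ?thesis by (simp add: lifts_def)
qed

text \<open>The arrow \<open>s \<cdot> h\<close> satisfies the lower triangle, but the upper one only up to the homotopy
  \<open>H \<cdot> Ta g\<close> over \<open>y\<close>. Extending this homotopy to \<open>L\<close> repairs the upper triangle at the far
  end of \<open>L\<close> and spoils the lower one by the homotopy \<open>f \<cdot> L\<close>. Its reverse is lifted in turn;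
  as \<open>f \<cdot> L\<close> is constant along \<open>j\<close>, a natural and normal choice of lifts does not disturb the
  upper triangle again.\<close>

lemma cofibration_lifts_shrinking:
  assumes cof: "cofib j" and j: "j \<in> hom C a b" and fib: "cleavage x y f k"
    and S: "shrinking x y f s H"
  shows "lifts C j f"
proof -
  have f: "f \<in> hom C x y" and s: "s \<in> hom C y x" and H: "H \<in> hom C (T x) x"
    and e: "f \<cdot> s = \<i>\<d> y" "H \<cdot> i\<^sub>0 x = s \<cdot> f" "H \<cdot> i\<^sub>1 x = \<i>\<d> x" "f \<cdot> H = f \<cdot> p x"
    using S by (auto simp: shrinking_def)
  note [simp] = homD[OF j] homD[OF s] homD[OF H] homD[OF f] e e[THEN reassoc]
  have "\<exists>l \<in> hom C b x. l \<cdot> j = g \<and> f \<cdot> l = h"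
    if g: "g \<in> hom C a x" and h: "h \<in> hom C b y" and sq: "f \<cdot> g = h \<cdot> j" for g h
  proof -
    note [simp] = homD[OF g] homD[OF h] sq reassoc[OF sq]
    have "s \<cdot> h \<in> hom C b x" "H \<cdot> Ta g \<in> hom C (T a) x" "(H \<cdot> Ta g) \<cdot> i\<^sub>0 a = (s \<cdot> h) \<cdot> j"
      by (simp_all add: hom_def)
    then obtain L where L: "L \<in> hom C (T b) x" "L \<cdot> Ta j = H \<cdot> Ta g" "L \<cdot> i\<^sub>0 b = s \<cdot> h"
      by (rule cofibration_extend[OF cof j])
    note [simp] = homD[OF L(1)] L(2,3) L(2,3)[THEN reassoc]
    have g': "L \<cdot> i\<^sub>1 b \<in> hom C b x" and h': "f \<cdot> (L \<cdot> v b) \<in> hom C (T b) y"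
      and start: "(f \<cdot> (L \<cdot> v b)) \<cdot> i\<^sub>0 b = f \<cdot> (L \<cdot> i\<^sub>1 b)"
      by (simp_all add: hom_def)
    note M = cleavage_lift[OF fib g' h' start]
    let ?M = "k b (L \<cdot> i\<^sub>1 b) (f \<cdot> (L \<cdot> v b))"
    note [simp] = homD[OF M(1)]
    have Lj: "L \<cdot> (i\<^sub>1 b \<cdot> j) = g"
    proof -
      have "L \<cdot> (i\<^sub>1 b \<cdot> j) = (L \<cdot> Ta j) \<cdot> i\<^sub>1 a" by (simp del: L(2) L(2)[THEN reassoc])
      also have "\<dots> = g" unfolding L(2) by simp
      finally show ?thesis .
    qed
    have "?M \<cdot> Ta j = k a ((L \<cdot> i\<^sub>1 b) \<cdot> j) ((f \<cdot> (L \<cdot> v b)) \<cdot> Ta j)"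
      by (rule cleavage_natural[OF fib g' h' start j, symmetric])
    also have "\<dots> = k a g (f \<cdot> (g \<cdot> p a))" by (simp add: Lj)
    also have "\<dots> = g \<cdot> p a" by (rule cleavage_normal[OF fib g])
    finally have N: "?M \<cdot> Ta j = g \<cdot> p a" .
    have "(?M \<cdot> i\<^sub>1 b) \<cdot> j = (?M \<cdot> Ta j) \<cdot> i\<^sub>1 a" by simp
    also have "\<dots> = g" unfolding N by simp
    finally have "(?M \<cdot> i\<^sub>1 b) \<cdot> j = g" .
    moreover have "f \<cdot> (?M \<cdot> i\<^sub>1 b) = h" using reassoc[OF M(2), of "i\<^sub>1 b"] by simp
    moreover have "?M \<cdot> i\<^sub>1 b \<in> hom C b x" by (simp add: hom_def)
    ultimately show ?thesis by blast
  qed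
  then show ?thesis by (simp add: lifts_def)
qed


section \<open>Evaluation of paths and the cofibrations\<close>

lemma T_eq:
  assumes "g \<cdot> f = h" "f \<in> Arr C" "g \<in> Arr C" "Dom C g = Cod C f"
  shows "Ta g \<cdot> Ta f = Ta h"
  using assms T_comp by metis

lemma T_structure_simps [simp]:
  "a \<in> Ob C \<Longrightarrow> Ta (p a) \<cdot> Ta (i\<^sub>0 a) = \<i>\<d> (T a)"
  "f \<in> Arr C \<Longrightarrow> Cod C f = b \<Longrightarrow> Ta (p b) \<cdot> Ta (Ta f) = Ta f \<cdot> Ta (p (Dom C f))"
  using T_eq[OF p_i0] T_eq[OF structure_natural(3)] by auto

lemma ev_cur:
  assumes "a \<in> Ob C" "h \<in> hom C (T a) y" "e \<in> hom C b (T a)"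
  shows "ev y \<cdot> (Ta (cur a h) \<cdot> e) = h \<cdot> e"
  using assms homD[OF assms(2)] homD[OF assms(3)] homD[OF cur(1)[OF assms(1,2)]]
  by (intro reassoc cur(2)) simp_all

lemma e_cur:
  assumes "a \<in> Ob C" "h \<in> hom C (T a) y"
  shows "ev y \<cdot> (i\<^sub>0 (P y) \<cdot> cur a h) = h \<cdot> i\<^sub>0 a" "ev y \<cdot> (i\<^sub>1 (P y) \<cdot> cur a h) = h \<cdot> i\<^sub>1 a"
  using ev_cur[OF assms, of "i\<^sub>0 a" a] ev_cur[OF assms, of "i\<^sub>1 a" a]
    assms homD[OF assms(2)] homD[OF cur(1)[OF assms]]
  by (simp_all add: hom_def)

lemma e_c [simp]:
  assumes "y \<in> Ob C"
  shows "ev y \<cdot> (i\<^sub>0 (P y) \<cdot> cocyl_c Q y) = \<i>\<d> y" "ev y \<cdot> (i\<^sub>1 (P y) \<cdot> cocyl_c Q y) = \<i>\<d> y"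
  using reassoc[OF ev_c, of y "i\<^sub>0 y"] reassoc[OF ev_c, of y "i\<^sub>1 y"] assms by simp_all

lemma e_c' [simp]:
  assumes "y \<in> Ob C" "e \<in> Arr C" "Cod C e = y"
  shows "ev y \<cdot> (i\<^sub>0 (P y) \<cdot> (cocyl_c Q y \<cdot> e)) = e" "ev y \<cdot> (i\<^sub>1 (P y) \<cdot> (cocyl_c Q y \<cdot> e)) = e"
  using reassoc[OF e_c(1), of y e] reassoc[OF e_c(2), of y e] assms by simp_all

text \<open>A path \<open>g\<close> whose starting point moves along \<open>h\<close> is carried to the path which at time \<open>t\<close>
  runs back along \<open>h\<close> from \<open>h t\<close> to \<open>h 0\<close> and then along \<open>g\<close>. The way back is the reversed
  connection \<open>h \<cdot> (\<Gamma> a \<cdot> v (T a))\<close>. At \<open>t = 0\<close>, and for all \<open>t\<close> when \<open>h\<close> is constant, it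
  is a constant path, and the strict identity law returns \<open>g\<close> itself.\<close>

lemma e0_cleavage:
  assumes y: "y \<in> Ob C"
  shows "\<exists>k. cleavage (P y) y (cocyl_e0 Q y) k"
proof -
  note [simp] = y e0_eq[OF y]
  let ?w = "\<lambda>a g h. paste (T a) (h \<cdot> (\<Gamma> a \<cdot> v (T a))) (ev y \<cdot> (Ta g \<cdot> Ta (p a)))"
  have W: "h \<cdot> (\<Gamma> a \<cdot> v (T a)) \<in> hom C (T (T a)) y"
      "ev y \<cdot> (Ta g \<cdot> Ta (p a)) \<in> hom C (T (T a)) y"
      "(h \<cdot> (\<Gamma> a \<cdot> v (T a))) \<cdot> i\<^sub>1 (T a) = (ev y \<cdot> (Ta g \<cdot> Ta (p a))) \<cdot> i\<^sub>0 (T a)"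
    if g: "g \<in> hom C a (P y)" and h: "h \<in> hom C (T a) y" and e: "h \<cdot> i\<^sub>0 a = cocyl_e0 Q y \<cdot> g"
    for a g h
  proof -
    note [simp] = homD[OF g] homD[OF h] reassoc[OF e]
    show "h \<cdot> (\<Gamma> a \<cdot> v (T a)) \<in> hom C (T (T a)) y" "ev y \<cdot> (Ta g \<cdot> Ta (p a)) \<in> hom C (T (T a)) y"
      by (simp_all add: hom_def)
    show "(h \<cdot> (\<Gamma> a \<cdot> v (T a))) \<cdot> i\<^sub>1 (T a) = (ev y \<cdot> (Ta g \<cdot> Ta (p a))) \<cdot> i\<^sub>0 (T a)"
      by simp
  qed
  have "cleavage (P y) y (cocyl_e0 Q y) (\<lambda>a g h. cur (T a) (?w a g h))"
    unfolding cleavage_def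
  proof (intro conjI allI impI)
    show "cocyl_e0 Q y \<in> hom C (P y) y" by (simp add: hom_def)
  next
    fix a g h
    assume g: "g \<in> hom C a (P y)" and h: "h \<in> hom C (T a) y" and e: "h \<cdot> i\<^sub>0 a = cocyl_e0 Q y \<cdot> g"
    note [simp] = homD[OF g] homD[OF h] reassoc[OF e]
    note w = pasteD[OF _ W[OF g h e]]
    note [simp] = homD[OF w(1)]
    note c = cur[OF _ w(1)]
    note [simp] = homD[OF c(1)]
    show "cur (T a) (?w a g h) \<in> hom C (T a) (P y)" using c(1) by simp
    show "cocyl_e0 Q y \<cdot> cur (T a) (?w a g h) = h"
      using w(2) e_cur(1)[OF _ w(1)] by simp
    have i: "i\<^sub>0 a \<in> hom C a (T a)" by (simp add: hom_def)
    have "?w a g h \<cdot> Ta (i\<^sub>0 a) = paste a ((h \<cdot> (\<Gamma> a \<cdot> v (T a))) \<cdot> Ta (i\<^sub>0 a)) ((ev y \<cdot> (Ta g \<cdot> Ta (p a))) \<cdot> Ta (i\<^sub>0 a))"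
      by (rule paste_comp_cyl[OF i W[OF g h e]])
    also have "\<dots> = paste a ((ev y \<cdot> Ta g) \<cdot> (i\<^sub>0 a \<cdot> p a)) (ev y \<cdot> Ta g)"
      by simp
    also have "\<dots> = ev y \<cdot> Ta g"
      by (rule const_paste[of _ _ y]) (simp_all add: hom_def)
    finally have "?w a g h \<cdot> Ta (i\<^sub>0 a) = ev y \<cdot> Ta g" .
    then show "cur (T a) (?w a g h) \<cdot> i\<^sub>0 a = g"
      using ev_cur[OF _ w(1), of "Ta (i\<^sub>0 a)" "T a"]
      by - (rule transpose_eqI[of _ a y], simp_all add: hom_def)
  next
    fix a g assume g: "g \<in> hom C a (P y)"
    note [simp] = homD[OF g]
    let ?h = "cocyl_e0 Q y \<cdot> (g \<cdot> p a)" let ?g = "ev y \<cdot> (Ta g \<cdot> Ta (p a))"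
    have G: "?g \<in> hom C (T (T a)) y" by (simp add: hom_def)
    have "?w a g ?h = paste (T a) (?g \<cdot> (i\<^sub>0 (T a) \<cdot> p (T a))) ?g"
      by simp
    also have "\<dots> = ?g"
      by (rule const_paste[OF _ G]) simp
    finally have "?w a g ?h = ?g" .
    then show "cur (T a) (?w a g ?h) = g \<cdot> p a"
      using cur[OF _ G] by - (rule transpose_eqI[of _ "T a" y], simp_all add: hom_def)
  next
    fix a b g h u
    assume g: "g \<in> hom C a (P y)" and h: "h \<in> hom C (T a) y" and u: "u \<in> hom C b a"
      and e: "h \<cdot> i\<^sub>0 a = cocyl_e0 Q y \<cdot> g"
    note [simp] = homD[OF g] homD[OF h] homD[OF u]
    note w = pasteD[OF _ W[OF g h e]]
    have Tu: "Ta u \<in> hom C (T b) (T a)" by (simp add: hom_def)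
    have "?w a g h \<cdot> Ta (Ta u) = ?w b (g \<cdot> u) (h \<cdot> Ta u)"
      by (subst paste_comp_cyl[OF Tu W[OF g h e]]) simp
    then show "cur (T b) (?w b (g \<cdot> u) (h \<cdot> Ta u)) = cur (T a) (?w a g h) \<cdot> Ta u"
      using cur_comp[OF w(1) Tu] by simp
  qed
  then show ?thesis by blast
qed

text \<open>A path contracts to its starting point through its initial segments, that is, through the
  connection.\<close>

lemma e0_equivalence:
  assumes y: "y \<in> Ob C"
  shows "equivalence (cocyl_e0 Q y)"
proof -
  note [simp] = y e0_eq[OF y]
  have h: "ev y \<cdot> \<Gamma> (P y) \<in> hom C (T (T (P y))) y" by (simp add: hom_def)
  note c = cur[OF _ h]
  note [simp] = homD[OF c(1)]
  let ?H = "cur (T (P y)) (ev y \<cdot> \<Gamma> (P y))"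
  have "?H \<cdot> i\<^sub>0 (P y) = cocyl_c Q y \<cdot> cocyl_e0 Q y"
    using ev_cur[OF _ h, of "Ta (i\<^sub>0 (P y))" "T (P y)"]
    by - (rule transpose_eqI[of _ "P y" y], simp_all add: hom_def)
  moreover have "?H \<cdot> i\<^sub>1 (P y) = \<i>\<d> (P y)"
    using ev_cur[OF _ h, of "Ta (i\<^sub>1 (P y))" "T (P y)"]
    by - (rule transpose_eqI[of _ "P y" y], simp_all add: hom_def)
  ultimately have 1: "homotopic (cocyl_c Q y \<cdot> cocyl_e0 Q y) (\<i>\<d> (P y))"
    using homotopicI[OF _ c(1)] by simp
  show ?thesis
    by (rule equivalenceI[OF _ c_in_hom[OF y] 1])
      (use homotopic_refl[of "\<i>\<d> y"] in \<open>simp_all add: hom_def\<close>)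
qed

text \<open>An extension problem for \<open>j\<close> is, transposed, a lifting problem against an evaluation. Thus
  cofibrations are characterised by lifting against certain fibrations which are equivalences.\<close>

lemma cofibration_iff_lifts:
  assumes j: "j \<in> hom C a b"
  shows "cofib j \<longleftrightarrow> (\<forall>y \<in> Ob C. lifts C j (cocyl_e0 Q y))"
proof
  assume cof: "cofib j"
  show "\<forall>y \<in> Ob C. lifts C j (cocyl_e0 Q y)"
  proof
    fix y assume y: "y \<in> Ob C"
    obtain k where k: "cleavage (P y) y (cocyl_e0 Q y) k" using e0_cleavage[OF y] by blast
    obtain s H where "shrinking (P y) y (cocyl_e0 Q y) s H"
      using trivial_fibration_shrinking[OF k e0_equivalence[OF y]] by blast
    then show "lifts C j (cocyl_e0 Q y)" by (rule cofibration_lifts_shrinking[OF cof j k])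
  qed
next
  assume L: "\<forall>y \<in> Ob C. lifts C j (cocyl_e0 Q y)"
  note [simp] = homD[OF j]
  have "\<exists>k \<in> hom C (T b) y. k \<cdot> Ta j = h \<and> k \<cdot> i\<^sub>0 b = f"
    if f: "f \<in> hom C b y" and h: "h \<in> hom C (T a) y" and e: "h \<cdot> i\<^sub>0 a = f \<cdot> j" for y f h
  proof -
    note [simp] = homD[OF f] homD[OF h]
    have y: "y \<in> Ob C" by simp
    note [simp] = e0_eq[OF y]
    note c = cur[OF _ h]
    note [simp] = homD[OF c(1)]
    obtain l where l: "l \<in> hom C b (P y)" "l \<cdot> j = cur a h" "cocyl_e0 Q y \<cdot> l = f"
    proof (rule liftsE)
      show "lifts C j (cocyl_e0 Q y)" using L y by blast
      show "cocyl_e0 Q y \<cdot> cur a h = f \<cdot> j" using e_cur(1)[OF _ h] e by simp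
      show "cocyl_e0 Q y \<in> hom C (P y) y" by (simp add: hom_def)
    qed (use c(1) f j in auto)
    note [simp] = homD[OF l(1)]
    have "ev y \<cdot> Ta l \<in> hom C (T b) y" by (simp add: hom_def)
    moreover have "(ev y \<cdot> Ta l) \<cdot> Ta j = h" using T_eq[OF l(2)] c(2) by simp
    moreover have "(ev y \<cdot> Ta l) \<cdot> i\<^sub>0 b = f" using l(3) by simp
    ultimately show ?thesis by blast
  qed
  then show "cofib j" unfolding cofibration_def using j by blast
qed

section \<open>The factorisation through the mapping path object\<close>

text \<open>\<open>N\<close> is the object of pairs of a point \<open>g\<close> of \<open>x\<close> and a path \<open>\<gamma>\<close> in \<open>y\<close> that starts at
  \<open>f \<cdot> g\<close>; the universal path is given by its transpose \<open>m\<close>.\<close>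

definition mapping_path :: "'o \<Rightarrow> 'o \<Rightarrow> 'm \<Rightarrow> 'o \<Rightarrow> 'm \<Rightarrow> 'm \<Rightarrow> bool" where
  "mapping_path x y f N r m \<longleftrightarrow> f \<in> hom C x y \<and> r \<in> hom C N x \<and> m \<in> hom C (T N) y \<and>
     m \<cdot> i\<^sub>0 N = f \<cdot> r \<and>
     (\<forall>a g \<gamma>. g \<in> hom C a x \<longrightarrow> \<gamma> \<in> hom C (T a) y \<longrightarrow> \<gamma> \<cdot> i\<^sub>0 a = f \<cdot> g \<longrightarrow>
       (\<exists>!w. w \<in> hom C a N \<and> r \<cdot> w = g \<and> m \<cdot> Ta w = \<gamma>))"

lemma mapping_path_exists:
  assumes f: "f \<in> hom C x y" and pb: "pullback C f (cocyl_e0 Q y) r \<pi>"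
  shows "mapping_path x y f (Dom C r) r (ev y \<cdot> Ta \<pi>)"
proof -
  note [simp] = homD[OF f]
  have y: "y \<in> Ob C" by simp
  note [simp] = e0_eq[OF y]
  have r: "r \<in> hom C (Dom C r) x" and \<pi>: "\<pi> \<in> hom C (Dom C r) (P y)"
    and sq: "f \<cdot> r = cocyl_e0 Q y \<cdot> \<pi>"
    and U: "\<And>z g g'. g \<in> hom C z x \<Longrightarrow> g' \<in> hom C z (P y) \<Longrightarrow> f \<cdot> g = cocyl_e0 Q y \<cdot> g' \<Longrightarrow>
      \<exists>!h. h \<in> hom C z (Dom C r) \<and> r \<cdot> h = g \<and> \<pi> \<cdot> h = g'"
    using pb by (auto simp: pullback_def)
  note [simp] = homD(1,4)[OF r] homD(3)[OF r] homD[OF \<pi>]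
  have "\<exists>!w. w \<in> hom C a (Dom C r) \<and> r \<cdot> w = g \<and> (ev y \<cdot> Ta \<pi>) \<cdot> Ta w = \<gamma>"
    if g: "g \<in> hom C a x" and \<gamma>: "\<gamma> \<in> hom C (T a) y" and e: "\<gamma> \<cdot> i\<^sub>0 a = f \<cdot> g" for a g \<gamma>
  proof -
    note [simp] = homD[OF g] homD[OF \<gamma>]
    note c = cur[OF _ \<gamma>]
    note [simp] = homD[OF c(1)]
    have "\<exists>!w. w \<in> hom C a (Dom C r) \<and> r \<cdot> w = g \<and> \<pi> \<cdot> w = cur a \<gamma>"
      by (rule U[OF g]) (use c(1) e_cur(1)[OF _ \<gamma>] e in simp_all)
    moreover have "\<pi> \<cdot> w = cur a \<gamma> \<longleftrightarrow> (ev y \<cdot> Ta \<pi>) \<cdot> Ta w = \<gamma>" if w: "w \<in> hom C a (Dom C r)" for w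
    proof -
      note [simp] = homD[OF w]
      have wt: "\<pi> \<cdot> w \<in> hom C a (P y)" by (simp add: hom_def)
      have "(ev y \<cdot> Ta \<pi>) \<cdot> Ta w = ev y \<cdot> Ta (\<pi> \<cdot> w)" by simp
      then show ?thesis using transpose_eqI[OF wt c(1) _ y] c(2) homD(4)[OF g] by metis
    qed
    ultimately show ?thesis by (simp cong: conj_cong)
  qed
  then show ?thesis
    using f r sq unfolding mapping_path_def by (auto simp: hom_def)
qed

context
  fixes x y f N r m
  assumes N: "mapping_path x y f N r m"
begin

definition pair :: "'o \<Rightarrow> 'm \<Rightarrow> 'm \<Rightarrow> 'm" where
  "pair a g \<gamma> = (THE w. w \<in> hom C a N \<and> r \<cdot> w = g \<and> m \<cdot> Ta w = \<gamma>)"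

lemma mapping_path_hom: "f \<in> hom C x y" "r \<in> hom C N x" "m \<in> hom C (T N) y" "m \<cdot> i\<^sub>0 N = f \<cdot> r"
  using N by (auto simp: mapping_path_def)

lemma mapping_path_arr [simp]:
  "f \<in> Arr C" "Dom C f = x" "Cod C f = y" "r \<in> Arr C" "Dom C r = N" "Cod C r = x"
  "m \<in> Arr C" "Dom C m = T N" "Cod C m = y" "N \<in> Ob C" "x \<in> Ob C" "y \<in> Ob C"
  using homD[OF mapping_path_hom(1)] homD[OF mapping_path_hom(2)] homD[OF mapping_path_hom(3)]
  by auto

lemma pair:
  assumes "g \<in> hom C a x" "\<gamma> \<in> hom C (T a) y" "\<gamma> \<cdot> i\<^sub>0 a = f \<cdot> g"
  shows "pair a g \<gamma> \<in> hom C a N" "r \<cdot> pair a g \<gamma> = g" "m \<cdot> Ta (pair a g \<gamma>) = \<gamma>"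
proof -
  have "\<exists>!w. w \<in> hom C a N \<and> r \<cdot> w = g \<and> m \<cdot> Ta w = \<gamma>"
    using N assms unfolding mapping_path_def by blast
  from theI'[OF this] show "pair a g \<gamma> \<in> hom C a N" "r \<cdot> pair a g \<gamma> = g" "m \<cdot> Ta (pair a g \<gamma>) = \<gamma>"
    by (simp_all add: pair_def)
qed

lemma mapping_path_eqI:
  assumes w: "w \<in> hom C a N" "w' \<in> hom C a N" "r \<cdot> w = r \<cdot> w'" "m \<cdot> Ta w = m \<cdot> Ta w'"
  shows "w = w'"
proof -
  note [simp] = homD[OF w(1)] homD[OF w(2)]
  have "(m \<cdot> Ta w') \<cdot> i\<^sub>0 a = f \<cdot> (r \<cdot> w')" using reassoc[OF mapping_path_hom(4), of w'] by simp
  moreover have "r \<cdot> w' \<in> hom C a x" "m \<cdot> Ta w' \<in> hom C (T a) y" by (simp_all add: hom_def)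
  ultimately have "\<exists>!u. u \<in> hom C a N \<and> r \<cdot> u = r \<cdot> w' \<and> m \<cdot> Ta u = m \<cdot> Ta w'"
    using N unfolding mapping_path_def by blast
  then show ?thesis using w by blast
qed

text \<open>The end of a path is lifted along \<open>h\<close> by prolonging the path, at time \<open>t\<close>, by the segment of
  \<open>h\<close> up to \<open>t\<close>. If \<open>h\<close> is constant, so is that segment, because \<open>p \<cdot> \<Gamma>\<close> contracts both
  factors, and prolonging by it changes nothing; this is normality.\<close>

lemma mapping_path_cleavage: "\<exists>k. cleavage N y (m \<cdot> i\<^sub>1 N) k"
proof -
  note start [simp] = mapping_path_hom(4) reassoc[OF mapping_path_hom(4)]
  let ?w = "\<lambda>a g h. paste (T a) (m \<cdot> (Ta g \<cdot> Ta (p a))) (h \<cdot> \<Gamma> a)"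
  let ?k = "\<lambda>a g h. pair (T a) (r \<cdot> (g \<cdot> p a)) (?w a g h)"
  have W: "m \<cdot> (Ta g \<cdot> Ta (p a)) \<in> hom C (T (T a)) y" "h \<cdot> \<Gamma> a \<in> hom C (T (T a)) y"
      "(m \<cdot> (Ta g \<cdot> Ta (p a))) \<cdot> i\<^sub>1 (T a) = (h \<cdot> \<Gamma> a) \<cdot> i\<^sub>0 (T a)"
    if g: "g \<in> hom C a N" and h: "h \<in> hom C (T a) y" and e: "h \<cdot> i\<^sub>0 a = (m \<cdot> i\<^sub>1 N) \<cdot> g" for a g h
  proof -
    note [simp] = homD[OF g] homD[OF h] reassoc[OF e]
    show "m \<cdot> (Ta g \<cdot> Ta (p a)) \<in> hom C (T (T a)) y" "h \<cdot> \<Gamma> a \<in> hom C (T (T a)) y"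
      by (simp_all add: hom_def)
    show "(m \<cdot> (Ta g \<cdot> Ta (p a))) \<cdot> i\<^sub>1 (T a) = (h \<cdot> \<Gamma> a) \<cdot> i\<^sub>0 (T a)"
      by simp
  qed
  have K: "?w a g h \<in> hom C (T (T a)) y" "?w a g h \<cdot> i\<^sub>1 (T a) = h"
      "?k a g h \<in> hom C (T a) N" "r \<cdot> ?k a g h = r \<cdot> (g \<cdot> p a)" "m \<cdot> Ta (?k a g h) = ?w a g h"
    if g: "g \<in> hom C a N" and h: "h \<in> hom C (T a) y" and e: "h \<cdot> i\<^sub>0 a = (m \<cdot> i\<^sub>1 N) \<cdot> g" for a g h
  proof -
    note [simp] = homD[OF g] homD[OF h]
    note w = pasteD[OF _ W[OF g h e]]
    show "?w a g h \<in> hom C (T (T a)) y" using w(1) by simp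
    show "?w a g h \<cdot> i\<^sub>1 (T a) = h" using w(3) by simp
    have "r \<cdot> (g \<cdot> p a) \<in> hom C (T a) x" by (simp add: hom_def)
    moreover have "?w a g h \<cdot> i\<^sub>0 (T a) = f \<cdot> (r \<cdot> (g \<cdot> p a))" using w(2) by simp
    ultimately show "?k a g h \<in> hom C (T a) N" "r \<cdot> ?k a g h = r \<cdot> (g \<cdot> p a)"
      "m \<cdot> Ta (?k a g h) = ?w a g h"
      using pair[of "r \<cdot> (g \<cdot> p a)" "T a" "?w a g h"] w(1) by simp_all
  qed
  have "cleavage N y (m \<cdot> i\<^sub>1 N) ?k"
    unfolding cleavage_def
  proof (intro conjI allI impI)
    show "m \<cdot> i\<^sub>1 N \<in> hom C N y" by (simp add: hom_def)
  next
    fix a g h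
    assume g: "g \<in> hom C a N" and h: "h \<in> hom C (T a) y" and e: "h \<cdot> i\<^sub>0 a = (m \<cdot> i\<^sub>1 N) \<cdot> g"
    note k = K[OF g h e]
    note [simp] = homD[OF g] homD[OF h] homD[OF k(1)] homD[OF k(3)] reassoc[OF e]
    show "?k a g h \<in> hom C (T a) N" by (rule k(3))
    show "(m \<cdot> i\<^sub>1 N) \<cdot> ?k a g h = h" using reassoc[OF k(5), of "i\<^sub>1 (T a)"] k(2) by simp
    have i: "i\<^sub>0 a \<in> hom C a (T a)" by (simp add: hom_def)
    have "?w a g h \<cdot> Ta (i\<^sub>0 a) =
        paste a ((m \<cdot> (Ta g \<cdot> Ta (p a))) \<cdot> Ta (i\<^sub>0 a)) ((h \<cdot> \<Gamma> a) \<cdot> Ta (i\<^sub>0 a))"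
      by (rule paste_comp_cyl[OF i W[OF g h e]])
    also have "\<dots> = paste a (m \<cdot> Ta g) ((m \<cdot> Ta g) \<cdot> (i\<^sub>1 a \<cdot> p a))" by simp
    also have "\<dots> = m \<cdot> Ta g" by (rule paste_const[of _ _ y]) (simp_all add: hom_def)
    finally have "?w a g h \<cdot> Ta (i\<^sub>0 a) = m \<cdot> Ta g" .
    then show "?k a g h \<cdot> i\<^sub>0 a = g"
      using reassoc[OF k(4), of "i\<^sub>0 a"] reassoc[OF k(5), of "Ta (i\<^sub>0 a)"]
      by - (rule mapping_path_eqI[of _ a], simp_all add: hom_def)
  next
    fix a g assume g: "g \<in> hom C a N"
    note [simp] = homD[OF g]
    let ?h = "(m \<cdot> i\<^sub>1 N) \<cdot> (g \<cdot> p a)" let ?g = "m \<cdot> (Ta g \<cdot> Ta (p a))"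
    have h: "?h \<in> hom C (T a) y" and e: "?h \<cdot> i\<^sub>0 a = (m \<cdot> i\<^sub>1 N) \<cdot> g" by (simp_all add: hom_def)
    note k = K[OF g h e]
    have "?w a g ?h = paste (T a) ?g (?g \<cdot> (i\<^sub>1 (T a) \<cdot> p (T a)))" by simp
    also have "\<dots> = ?g" by (rule paste_const[of _ _ y]) (simp_all add: hom_def)
    finally have "?w a g ?h = ?g" .
    then show "?k a g ?h = g \<cdot> p a"
      using k by - (rule mapping_path_eqI[of _ "T a"], simp_all add: hom_def)
  next
    fix a b g h u
    assume g: "g \<in> hom C a N" and h: "h \<in> hom C (T a) y" and u: "u \<in> hom C b a"
      and e: "h \<cdot> i\<^sub>0 a = (m \<cdot> i\<^sub>1 N) \<cdot> g"
    note k = K[OF g h e]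
    note [simp] = homD[OF g] homD[OF h] homD[OF u] homD[OF k(3)]
    have g': "g \<cdot> u \<in> hom C b N" and h': "h \<cdot> Ta u \<in> hom C (T b) y"
      and e': "(h \<cdot> Ta u) \<cdot> i\<^sub>0 b = (m \<cdot> i\<^sub>1 N) \<cdot> (g \<cdot> u)"
      using reassoc[OF e, of u] by (simp_all add: hom_def)
    note k' = K[OF g' h' e']
    note [simp] = homD[OF k'(3)]
    have Tu: "Ta u \<in> hom C (T b) (T a)" by (simp add: hom_def)
    have "?w a g h \<cdot> Ta (Ta u) = ?w b (g \<cdot> u) (h \<cdot> Ta u)"
      by (subst paste_comp_cyl[OF Tu W[OF g h e]]) simp
    then have "m \<cdot> Ta (?k a g h \<cdot> Ta u) = ?w b (g \<cdot> u) (h \<cdot> Ta u)"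
      using reassoc[OF k(5), of "Ta (Ta u)"] by simp
    moreover have "r \<cdot> (?k a g h \<cdot> Ta u) = r \<cdot> ((g \<cdot> u) \<cdot> p b)"
      using reassoc[OF k(4), of "Ta u"] by simp
    ultimately show "?k b (g \<cdot> u) (h \<cdot> Ta u) = ?k a g h \<cdot> Ta u"
      by (intro mapping_path_eqI[OF k'(3) comp_in_hom[OF Tu k(3)]]) (simp_all only: k'(4,5))
  qed
  then show ?thesis by blast
qed

text \<open>Points of \<open>x\<close> become constant paths, and a path is contracted to its starting point through its
  initial segments.\<close>

lemma mapping_path_retract:
  "\<exists>j H. strong_deformation_retract x N j r H \<and> (m \<cdot> i\<^sub>1 N) \<cdot> j = f"
proof -
  note [simp] = mapping_path_hom(4) reassoc[OF mapping_path_hom(4)]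
  define j where "j = pair x (\<i>\<d> x) (f \<cdot> p x)"
  have j: "j \<in> hom C x N" "r \<cdot> j = \<i>\<d> x" "m \<cdot> Ta j = f \<cdot> p x"
    unfolding j_def by (rule pair; simp add: hom_def)+
  note [simp] = homD[OF j(1)] j(2,3) j(2,3)[THEN reassoc]
  \<comment> \<open>The connection restricts the path \<open>m\<close> to its initial segments; the starting point \<open>r\<close> stays put.\<close>
  define H where "H = pair (T N) (r \<cdot> p N) (m \<cdot> \<Gamma> N)"
  have H: "H \<in> hom C (T N) N" "r \<cdot> H = r \<cdot> p N" "m \<cdot> Ta H = m \<cdot> \<Gamma> N"
    unfolding H_def by (rule pair; simp add: hom_def)+
  note [simp] = homD[OF H(1)] H(2,3) H(2,3)[THEN reassoc]
  have "H \<cdot> i\<^sub>0 N = j \<cdot> r" "H \<cdot> i\<^sub>1 N = \<i>\<d> N"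
    by (rule mapping_path_eqI[of _ N]; simp add: hom_def)+
  moreover have "H \<cdot> Ta j = j \<cdot> p x"
    by (rule mapping_path_eqI[of _ "T x"]) (simp_all add: hom_def)
  moreover have "(m \<cdot> i\<^sub>1 N) \<cdot> j = f"
    using reassoc[OF j(3), of "i\<^sub>1 x"] by simp
  ultimately show ?thesis
    using j H mapping_path_hom(2) unfolding strong_deformation_retract_def by blast
qed

end

text \<open>A lift for \<open>f\<close> is the image under \<open>r\<close> of a chosen lift for \<open>q\<close>, so naturality and normality
  are inherited.\<close>

lemma fibration_retract:
  assumes q: "cleavage e y q k" and f: "f \<in> hom C x y" and s: "s \<in> hom C x e" and r: "r \<in> hom C e x"
    and rs: "r \<cdot> s = \<i>\<d> x" and qs: "q \<cdot> s = f" and fr: "f \<cdot> r = q"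
  shows "cleavage x y f (\<lambda>a g h. r \<cdot> k a (s \<cdot> g) h)"
proof -
  have Q: "q \<in> hom C e y" using q by (simp add: cleavage_def)
  note [simp] = homD[OF Q] homD[OF f] homD[OF s] homD[OF r] rs fr reassoc[OF rs] reassoc[OF fr]
    reassoc[OF qs]
  show ?thesis
    unfolding cleavage_def
  proof (intro conjI allI impI)
    show "f \<in> hom C x y" by (rule f)
  next
    fix a g h assume g: "g \<in> hom C a x" and h: "h \<in> hom C (T a) y" and e: "h \<cdot> i\<^sub>0 a = f \<cdot> g"
    note [simp] = homD[OF g]
    have g': "s \<cdot> g \<in> hom C a e" "h \<cdot> i\<^sub>0 a = q \<cdot> (s \<cdot> g)" using e by (simp_all add: hom_def)
    note L = cleavage_lift[OF q g'(1) h g'(2)]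
    note [simp] = homD[OF L(1)]
    show "r \<cdot> k a (s \<cdot> g) h \<in> hom C (T a) x" by (simp add: hom_def)
    show "f \<cdot> (r \<cdot> k a (s \<cdot> g) h) = h" using L(2) by simp
    show "(r \<cdot> k a (s \<cdot> g) h) \<cdot> i\<^sub>0 a = g" using L(3) by simp
  next
    fix a g assume g: "g \<in> hom C a x"
    note [simp] = homD[OF g]
    have "s \<cdot> g \<in> hom C a e" by (simp add: hom_def)
    from cleavage_normal[OF q this]
    show "r \<cdot> k a (s \<cdot> g) (f \<cdot> (g \<cdot> p a)) = g \<cdot> p a" by simp
  next
    fix a b g h u assume g: "g \<in> hom C a x" and h: "h \<in> hom C (T a) y" and u: "u \<in> hom C b a"
      and e: "h \<cdot> i\<^sub>0 a = f \<cdot> g"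
    note [simp] = homD[OF g] homD[OF u]
    have g': "s \<cdot> g \<in> hom C a e" "h \<cdot> i\<^sub>0 a = q \<cdot> (s \<cdot> g)" using e by (simp_all add: hom_def)
    note L = cleavage_lift[OF q g'(1) h g'(2)]
    note [simp] = homD[OF L(1)]
    show "r \<cdot> k b (s \<cdot> (g \<cdot> u)) (h \<cdot> Ta u) = r \<cdot> k a (s \<cdot> g) h \<cdot> Ta u"
      using cleavage_natural[OF q g'(1) h g'(2) u] by simp
  qed
qed


section \<open>The factorisation through the mapping cylinder\<close>

text \<open>To extend a homotopy \<open>h\<close> from the free end of the mapping cylinder, keep the glued end fixed and
  prolong each segment of the cylinder, at time \<open>t\<close>, by the part of \<open>h\<close> up to \<open>t\<close>. The pasting
  is along the cylinder and not along the homotopy, so it is carried out after transposing the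
  homotopy direction: the extension is constructed as an arrow \<open>K\<close> from the pushout to a path
  object.\<close>

lemma mapping_cylinder_factorisation:
  assumes f: "f \<in> hom C x y" and po: "pushout C (i\<^sub>0 x) f u w"
  shows "\<exists>M j q. j \<in> hom C x M \<and> q \<in> hom C M y \<and> q \<cdot> j = f \<and> cofib j \<and> equivalence q"
proof -
  note [simp] = homD[OF f]
  define M where "M = Cod C u"
  have u: "u \<in> hom C (T x) M" and w: "w \<in> hom C y M" and sq: "u \<cdot> i\<^sub>0 x = w \<cdot> f"
    and U: "\<And>z a b. a \<in> hom C (T x) z \<Longrightarrow> b \<in> hom C y z \<Longrightarrow> a \<cdot> i\<^sub>0 x = b \<cdot> f \<Longrightarrow>
      \<exists>!h. h \<in> hom C M z \<and> h \<cdot> u = a \<and> h \<cdot> w = b"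
    using po unfolding pushout_def M_def by auto
  note [simp] = homD[OF u] homD[OF w] sq reassoc[OF sq]
  have eqI: "h = h'" if h: "h \<in> hom C M z" "h' \<in> hom C M z" "h \<cdot> u = h' \<cdot> u" "h \<cdot> w = h' \<cdot> w" for h h' z
  proof -
    note [simp] = homD[OF h(2)]
    have "\<exists>!l. l \<in> hom C M z \<and> l \<cdot> u = h' \<cdot> u \<and> l \<cdot> w = h' \<cdot> w"
      by (rule U) (simp_all add: hom_def)
    then show ?thesis using h by blast
  qed
  have "f \<cdot> p x \<in> hom C (T x) y" "\<i>\<d> y \<in> hom C y y" "(f \<cdot> p x) \<cdot> i\<^sub>0 x = \<i>\<d> y \<cdot> f"
    by (simp_all add: hom_def)
  from U[OF this] obtain q where q: "q \<in> hom C M y" "q \<cdot> u = f \<cdot> p x" "q \<cdot> w = \<i>\<d> y"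
    by blast
  note [simp] = homD[OF q(1)] q(2,3) q(2,3)[THEN reassoc]
  have j: "u \<cdot> i\<^sub>1 x \<in> hom C x M" by (simp add: hom_def)
  have "\<exists>k \<in> hom C (T M) z. k \<cdot> Ta (u \<cdot> i\<^sub>1 x) = h \<and> k \<cdot> i\<^sub>0 M = n"
    if n: "n \<in> hom C M z" and h: "h \<in> hom C (T x) z" and e: "h \<cdot> i\<^sub>0 x = n \<cdot> (u \<cdot> i\<^sub>1 x)" for z n h
  proof -
    note [simp] = homD[OF n] homD[OF h] e reassoc[OF e]
    have z: "z \<in> Ob C" by simp
    have hG: "h \<cdot> \<Gamma> x \<in> hom C (T (T x)) z" by (simp add: hom_def)
    note c = cur[OF _ hG]
    note [simp] = homD[OF c(1)]
    let ?a = "cocyl_c Q z \<cdot> (n \<cdot> u)" let ?b = "cur (T x) (h \<cdot> \<Gamma> x)"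
    have b0: "?b \<cdot> i\<^sub>0 x = cocyl_c Q z \<cdot> (n \<cdot> (u \<cdot> i\<^sub>1 x))"
      using ev_cur[OF _ hG, of "Ta (i\<^sub>0 x)" "T x"]
      by - (rule transpose_eqI[of _ x z], simp_all add: hom_def)
    have a: "?a \<in> hom C (T x) (P z)" and b: "?b \<in> hom C (T x) (P z)" and ab: "?a \<cdot> i\<^sub>1 x = ?b \<cdot> i\<^sub>0 x"
      using b0 c(1) by (simp_all add: hom_def)
    note G = pasteD[OF _ a b ab]
    note [simp] = homD[OF G(1)]
    have "cocyl_c Q z \<cdot> (n \<cdot> w) \<in> hom C y (P z)"
      "paste x ?a ?b \<cdot> i\<^sub>0 x = (cocyl_c Q z \<cdot> (n \<cdot> w)) \<cdot> f"
      using G(2) by (simp_all add: hom_def)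
    from U[OF _ this] G(1) obtain K where K: "K \<in> hom C M (P z)" "K \<cdot> u = paste x ?a ?b"
      "K \<cdot> w = cocyl_c Q z \<cdot> (n \<cdot> w)"
      by auto
    note [simp] = homD[OF K(1)]
    have "K \<cdot> (u \<cdot> i\<^sub>1 x) = ?b \<cdot> i\<^sub>1 x" using reassoc[OF K(2), of "i\<^sub>1 x"] G(3) by simp
    then have "ev z \<cdot> Ta (K \<cdot> (u \<cdot> i\<^sub>1 x)) = ev z \<cdot> (Ta ?b \<cdot> Ta (i\<^sub>1 x))"
      using T_comp[of "i\<^sub>1 x" ?b] by simp
    also have "\<dots> = h"
      using ev_cur[OF _ hG, of "Ta (i\<^sub>1 x)" "T x"] by (simp add: hom_def)
    finally have k1: "(ev z \<cdot> Ta K) \<cdot> Ta (u \<cdot> i\<^sub>1 x) = h" by simp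
    have e0: "ev z \<cdot> i\<^sub>0 (P z) \<in> hom C (P z) z" by (simp add: hom_def)
    have "(ev z \<cdot> i\<^sub>0 (P z)) \<cdot> paste x ?a ?b =
        paste x ((ev z \<cdot> i\<^sub>0 (P z)) \<cdot> ?a) ((ev z \<cdot> i\<^sub>0 (P z)) \<cdot> ?b)"
      by (rule comp_paste[OF e0 _ a b ab]) simp
    also have "\<dots> = paste x (n \<cdot> u) ((n \<cdot> u) \<cdot> (i\<^sub>1 x \<cdot> p x))"
      using e_cur(1)[OF _ hG] by simp
    also have "\<dots> = n \<cdot> u"
      by (rule paste_const[of _ _ z]) (simp_all add: hom_def)
    finally have "(ev z \<cdot> i\<^sub>0 (P z)) \<cdot> (K \<cdot> u) = n \<cdot> u" using K(2) by simp
    then have k0: "(ev z \<cdot> Ta K) \<cdot> i\<^sub>0 M = n"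
      by - (rule eqI[OF _ n], use K(3) in \<open>simp_all add: hom_def\<close>)
    have "ev z \<cdot> Ta K \<in> hom C (T M) z" by (simp add: hom_def)
    then show ?thesis using k1 k0 by blast
  qed
  then have "cofib (u \<cdot> i\<^sub>1 x)" unfolding cofibration_def using j by blast
  moreover have "equivalence q"
  proof -
    have hG: "u \<cdot> \<Gamma> x \<in> hom C (T (T x)) M" by (simp add: hom_def)
    note c = cur[OF _ hG]
    note [simp] = homD[OF c(1)]
    let ?b = "cur (T x) (u \<cdot> \<Gamma> x)"
    have b0: "?b \<cdot> i\<^sub>0 x = (cocyl_c Q M \<cdot> w) \<cdot> f"
      using ev_cur[OF _ hG, of "Ta (i\<^sub>0 x)" "T x"]
      by - (rule transpose_eqI[of _ x M], simp_all add: hom_def)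
    have "?b \<in> hom C (T x) (P M)" "cocyl_c Q M \<cdot> w \<in> hom C y (P M)" using c(1) by (simp_all add: hom_def)
    \<comment> \<open>The homotopy from \<open>w \<cdot> q\<close> to the identity, as an arrow to a path object: constant on \<open>y\<close> and the connection on \<open>T x\<close>.\<close>
    from U[OF this b0] obtain K where K: "K \<in> hom C M (P M)" "K \<cdot> u = ?b" "K \<cdot> w = cocyl_c Q M \<cdot> w"
      by blast
    note [simp] = homD[OF K(1)] K(2,3)
    have "(ev M \<cdot> Ta K) \<cdot> i\<^sub>0 M = w \<cdot> q" "(ev M \<cdot> Ta K) \<cdot> i\<^sub>1 M = \<i>\<d> M"
      by (rule eqI[of _ M]; use e_cur[OF _ hG] in \<open>simp add: hom_def\<close>)+
    then have 1: "homotopic (w \<cdot> q) (\<i>\<d> M)"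
      using homotopicI[of M "ev M \<cdot> Ta K" M] by (simp add: hom_def)
    show ?thesis
      by (rule equivalenceI[OF q(1) w 1]) (use homotopic_refl[of "\<i>\<d> y"] in simp)
  qed
  moreover have "q \<cdot> (u \<cdot> i\<^sub>1 x) = f" by simp
  ultimately show ?thesis using j q(1) by blast
qed

section \<open>The weak factorisation systems\<close>

abbreviation "Weq \<equiv> {f. equivalence f}"
abbreviation "Fib \<equiv> {f. fibration f}"
abbreviation "Cof \<equiv> {f. cofib f}"

lemma equivalence_retract:
  assumes q: "equivalence q" "q \<in> hom C e y" and s: "s \<in> hom C x e" and r: "r \<in> hom C e x"
    and f: "f \<in> hom C x y" and rs: "r \<cdot> s = \<i>\<d> x" and qs: "q \<cdot> s = f" and fr: "f \<cdot> r = q"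
  shows "equivalence f"
proof -
  obtain g where g: "g \<in> hom C y e" "homotopic (g \<cdot> q) (\<i>\<d> e)" "homotopic (q \<cdot> g) (\<i>\<d> y)"
    using q by (rule equivalenceE)
  note [simp] = homD[OF q(2)] homD[OF s] homD[OF r] homD[OF f] homD[OF g(1)] rs
  have "homotopic (r \<cdot> ((g \<cdot> q) \<cdot> s)) (r \<cdot> (\<i>\<d> e \<cdot> s))"
    by (rule homotopic_comp[OF g(2)]) (use s r in simp_all)
  then have 1: "homotopic ((r \<cdot> g) \<cdot> f) (\<i>\<d> x)" using qs by simp
  have 2: "homotopic (f \<cdot> (r \<cdot> g)) (\<i>\<d> y)" using g(3) reassoc[OF fr, of g] by simp
  show ?thesis by (rule equivalenceI[OF f _ 1 2]) (simp add: hom_def)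
qed

lemma equivalence_coretract:
  assumes i: "equivalence i" "i \<in> hom C x e" and l: "l \<in> hom C y e" and q: "q \<in> hom C e y"
    and j: "j \<in> hom C x y" and ql: "q \<cdot> l = \<i>\<d> y" and qi: "q \<cdot> i = j" and lj: "l \<cdot> j = i"
  shows "equivalence j"
proof -
  obtain g where g: "g \<in> hom C e x" "homotopic (g \<cdot> i) (\<i>\<d> x)" "homotopic (i \<cdot> g) (\<i>\<d> e)"
    using i by (rule equivalenceE)
  note [simp] = homD[OF i(2)] homD[OF l] homD[OF q] homD[OF j] homD[OF g(1)] ql
  have "homotopic (q \<cdot> ((i \<cdot> g) \<cdot> l)) (q \<cdot> (\<i>\<d> e \<cdot> l))"
    by (rule homotopic_comp[OF g(3)]) (use q l in simp_all)
  then have 1: "homotopic (j \<cdot> (g \<cdot> l)) (\<i>\<d> y)" using reassoc[OF qi, of "g \<cdot> l"] by simp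
  have 2: "homotopic ((g \<cdot> l) \<cdot> j) (\<i>\<d> x)" using g(2) lj by simp
  show ?thesis by (rule equivalenceI[OF j _ 2 1]) (simp add: hom_def)
qed

lemma fibration_arr: "fibration f \<Longrightarrow> f \<in> Arr C"
  unfolding normally_cloven_fibration_def hom_def by auto

lemma cofib_arr: "cofib f \<Longrightarrow> f \<in> Arr C"
  unfolding cofibration_def hom_def by auto

lemma equivalence_arr: "equivalence f \<Longrightarrow> f \<in> Arr C"
  unfolding homotopy_equivalence_def hom_def by auto

lemma retract_in_llp:
  assumes "strong_deformation_retract a b j r H"
  shows "j \<in> llp C Fib"
  using assms retract_lifts_fibration cleavage_if_fibration
  by (fastforce simp: llp_def strong_deformation_retract_def hom_def)

text \<open>The first factor is a strong deformation retract. That it is a cofibration follows later, from its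
  lifting property and the evaluations being fibrations.\<close>

lemma llp_fibration_factorisation:
  assumes pullbacks: "\<And>f g a b c. f \<in> hom C a c \<Longrightarrow> g \<in> hom C b c \<Longrightarrow> \<exists>u v. pullback C f g u v"
    and f: "f \<in> hom C x y"
  shows "\<exists>e i q k. i \<in> llp C Fib \<and> equivalence i \<and> i \<in> hom C x e \<and> cleavage e y q k \<and> q \<cdot> i = f"
proof -
  have "y \<in> Ob C" using homD[OF f] by simp
  then have "cocyl_e0 Q y \<in> hom C (P y) y" by (simp add: hom_def e0_eq)
  from pullbacks[OF f this] obtain r \<pi> where "pullback C f (cocyl_e0 Q y) r \<pi>" by blast
  note N = mapping_path_exists[OF f this]
  obtain k where k: "cleavage (Dom C r) y ((ev y \<cdot> Ta \<pi>) \<cdot> i\<^sub>1 (Dom C r)) k"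
    using mapping_path_cleavage[OF N] by blast
  obtain j H where j: "strong_deformation_retract x (Dom C r) j r H"
    "((ev y \<cdot> Ta \<pi>) \<cdot> i\<^sub>1 (Dom C r)) \<cdot> j = f"
    using mapping_path_retract[OF N] by blast
  show ?thesis
    using retract_in_llp[OF j(1)] strong_deformation_retract_equivalence[OF j(1)] k j
    unfolding strong_deformation_retract_def by blast
qed

text \<open>The lifting lemmas and the two factorisations give two weak factorisation systems by the retract
  argument. The factorisation through the mapping cylinder ends in an equivalence that need not be a
  fibration; it is factored once more.\<close>

theorem cylinder_model_structure:
  assumes pullbacks: "\<And>f g a b c. f \<in> hom C a c \<Longrightarrow> g \<in> hom C b c \<Longrightarrow> \<exists>u v. pullback C f g u v"
    and pushouts: "\<And>f g a b c. f \<in> hom C c a \<Longrightarrow> g \<in> hom C c b \<Longrightarrow> \<exists>u v. pushout C f g u v"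
  shows "model_structure C Weq Fib Cof"
proof -
  have factor: "\<exists>e i q k. i \<in> llp C Fib \<and> equivalence i \<and> i \<in> hom C x e \<and> cleavage e y q k \<and> q \<cdot> i = f"
    if "f \<in> hom C x y" for f x y
    by (rule llp_fibration_factorisation[OF _ that]) (rule pullbacks)
  have cof_lift: "lifts C j f" if j: "j \<in> Cof" and f: "f \<in> Fib \<inter> Weq" for j f
  proof -
    obtain x y k where k: "cleavage x y f k" using f cleavage_if_fibration by blast
    obtain s H where S: "shrinking x y f s H" using trivial_fibration_shrinking[OF k] f by blast
    show ?thesis
      using cofibration_lifts_shrinking[OF _ _ k S] j cofib_arr[of j] arr_hom by blast
  qed
  have triv_cof_lift: "lifts C j f" if j: "j \<in> Cof \<inter> Weq" and f: "f \<in> Fib" for j f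
  proof -
    obtain x y k where k: "cleavage x y f k" using f cleavage_if_fibration by blast
    obtain r H where "strong_deformation_retract (Dom C j) (Cod C j) j r H"
      using trivial_cofibration_retract j cofib_arr[of j] arr_hom by blast
    then show ?thesis using retract_lifts_fibration k by blast
  qed
  have e0: "cocyl_e0 Q y \<in> Fib \<inter> Weq" if "y \<in> Ob C" for y
    using e0_cleavage[OF that] e0_equivalence[OF that] fibration_if_cleavage by blast
  have cof_if: "j \<in> Cof" if "j \<in> Arr C" "\<And>f. f \<in> Fib \<inter> Weq \<Longrightarrow> lifts C j f" for j
    using that cofibration_iff_lifts[OF arr_hom[of j]] e0 by blast
  have triv_cof: "Cof \<inter> Weq = llp C Fib"
  proof
    show "Cof \<inter> Weq \<subseteq> llp C Fib"
      using triv_cof_lift cofib_arr by (auto simp: llp_def)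
    show "llp C Fib \<subseteq> Cof \<inter> Weq"
    proof
      fix j assume j: "j \<in> llp C Fib"
      then have jA: "j \<in> hom C (Dom C j) (Cod C j)" by (simp add: llp_def arr_hom)
      obtain e i q k where i: "equivalence i" "i \<in> hom C (Dom C j) e"
        and k: "cleavage e (Cod C j) q k" and qi: "q \<cdot> i = j"
        using factor[OF jA] by blast
      have q: "q \<in> hom C e (Cod C j)" using k by (simp add: cleavage_def)
      have "lifts C j q" using j fibration_if_cleavage[OF k] llpD(1) by blast
      moreover have "q \<cdot> i = \<i>\<d> (Cod C j) \<cdot> j" using qi homD[OF jA] by simp
      ultimately obtain l where l: "l \<in> hom C (Cod C j) e" "l \<cdot> j = i" "q \<cdot> l = \<i>\<d> (Cod C j)"
        using jA q i(2) by (rule liftsE) (use homD[OF jA] in \<open>auto simp: ide_in_hom\<close>)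
      have "equivalence j"
        by (rule equivalence_coretract[OF i l(1) q jA l(3) qi l(2)])
      moreover have "j \<in> Cof" using cof_if j llpD by blast
      ultimately show "j \<in> Cof \<inter> Weq" by simp
    qed
  qed
  have fib: "Fib = rlp C (Cof \<inter> Weq)"
  proof
    show "Fib \<subseteq> rlp C (Cof \<inter> Weq)"
      using triv_cof_lift fibration_arr by (auto simp: rlp_def)
    show "rlp C (Cof \<inter> Weq) \<subseteq> Fib"
    proof
      fix f assume f: "f \<in> rlp C (Cof \<inter> Weq)"
      then have fA: "f \<in> hom C (Dom C f) (Cod C f)" by (simp add: rlp_def arr_hom)
      obtain e i q k where i: "i \<in> llp C Fib" "i \<in> hom C (Dom C f) e"
        and k: "cleavage e (Cod C f) q k" and qi: "q \<cdot> i = f"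
        using factor[OF fA] by blast
      have q: "q \<in> hom C e (Cod C f)" using k by (simp add: cleavage_def)
      have "lifts C i f" using f i triv_cof llpD(3) by blast
      moreover have "f \<cdot> \<i>\<d> (Dom C f) = q \<cdot> i" using qi homD[OF fA] by simp
      ultimately obtain r where r: "r \<in> hom C e (Dom C f)" "r \<cdot> i = \<i>\<d> (Dom C f)" "f \<cdot> r = q"
        using i(2) fA by (rule liftsE) (use homD[OF fA] q in \<open>auto simp: ide_in_hom\<close>)
      show "f \<in> Fib"
        using fibration_if_cleavage[OF fibration_retract[OF k fA i(2) r(1,2) qi r(3)]] by simp
    qed
  qed
  have cof_factor: "\<exists>e j q. j \<in> Cof \<and> q \<in> Fib \<inter> Weq \<and> j \<in> hom C x e \<and> q \<in> hom C e y \<and> q \<cdot> j = f"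
    if f: "f \<in> hom C x y" for f x y
  proof -
    have "i\<^sub>0 x \<in> hom C x (T x)" using homD[OF f] by (simp add: hom_def)
    from pushouts[OF this f] obtain u w where "pushout C (i\<^sub>0 x) f u w" by blast
    from mapping_cylinder_factorisation[OF f this]
    obtain M j q where j: "j \<in> hom C x M" "j \<in> Cof" and q: "q \<in> hom C M y" "q \<in> Weq" and qj: "q \<cdot> j = f"
      by blast
    obtain e i q' k where i: "i \<in> llp C Fib" "i \<in> hom C M e" and k: "cleavage e y q' k" and qi: "q' \<cdot> i = q"
      using factor[OF q(1)] by blast
    have q': "q' \<in> hom C e y" using k by (simp add: cleavage_def)
    note [simp] = homD[OF j(1)] homD[OF i(2)] homD[OF q']
    have "i \<in> Weq" "i \<in> Cof" using i(1) triv_cof by auto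
    then have "q' \<in> Weq"
      using two_out_of_three_equivalence i(2) q' qi q(2) unfolding two_out_of_three_def by blast
    moreover have "i \<cdot> j \<in> Cof"
    proof (rule cof_if)
      show "i \<cdot> j \<in> Arr C" by simp
      fix g assume g: "g \<in> Fib \<inter> Weq"
      then have gA: "g \<in> hom C (Dom C g) (Cod C g)" using fibration_arr by (simp add: arr_hom)
      note [simp] = homD(1)[OF gA]
      show "lifts C (i \<cdot> j) g"
        unfolding lifts_def
      proof (intro ballI impI)
        fix a b assume "a \<in> hom C (Dom C (i \<cdot> j)) (Dom C g)" "b \<in> hom C (Cod C (i \<cdot> j)) (Cod C g)"
          and sq: "g \<cdot> a = b \<cdot> (i \<cdot> j)"
        then have a: "a \<in> hom C x (Dom C g)" and b: "b \<in> hom C e (Cod C g)" by simp_all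
        note [simp] = homD[OF a] homD[OF b]
        have bi: "b \<cdot> i \<in> hom C M (Cod C g)" by (simp add: hom_def)
        have "g \<cdot> a = (b \<cdot> i) \<cdot> j" using sq by simp
        with cof_lift[OF j(2) g] obtain l where l: "l \<in> hom C M (Dom C g)" "l \<cdot> j = a" "g \<cdot> l = b \<cdot> i"
          using j(1) gA a bi by (rule liftsE)
        obtain l' where l': "l' \<in> hom C e (Dom C g)" "l' \<cdot> i = l" "g \<cdot> l' = b"
          using cof_lift[OF \<open>i \<in> Cof\<close> g] l(3) i(2) gA l(1) b by (rule liftsE)
        note [simp] = homD[OF l'(1)]
        have "l' \<cdot> (i \<cdot> j) = a" using reassoc[OF l'(2), of j] l(2) by simp
        then show "\<exists>l \<in> hom C (Cod C (i \<cdot> j)) (Dom C g). l \<cdot> (i \<cdot> j) = a \<and> g \<cdot> l = b"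
          using l' by auto
      qed
    qed
    moreover have "q' \<cdot> (i \<cdot> j) = f" using reassoc[OF qi, of j] qj by simp
    moreover have "i \<cdot> j \<in> hom C x e" by (simp add: hom_def)
    ultimately show ?thesis using q' fibration_if_cleavage[OF k] by blast
  qed
  have triv_fib: "Fib \<inter> Weq = rlp C Cof"
  proof
    show "Fib \<inter> Weq \<subseteq> rlp C Cof"
      using cof_lift fibration_arr by (auto simp: rlp_def)
    show "rlp C Cof \<subseteq> Fib \<inter> Weq"
    proof
      fix f assume f: "f \<in> rlp C Cof"
      then have fA: "f \<in> hom C (Dom C f) (Cod C f)" by (simp add: rlp_def arr_hom)
      obtain e j q where j: "j \<in> Cof" "j \<in> hom C (Dom C f) e"
        and q: "q \<in> Weq" "q \<in> hom C e (Cod C f)" and qj: "q \<cdot> j = f"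
        using cof_factor[OF fA] by blast
      have "lifts C j f" using f j llpD(3) by blast
      moreover have "f \<cdot> \<i>\<d> (Dom C f) = q \<cdot> j" using qj homD[OF fA] by simp
      ultimately obtain r where r: "r \<in> hom C e (Dom C f)" "r \<cdot> j = \<i>\<d> (Dom C f)" "f \<cdot> r = q"
        using j(2) fA by (rule liftsE) (use homD[OF fA] q in \<open>auto simp: ide_in_hom\<close>)
      have "equivalence f"
        using equivalence_retract[OF _ q(2) j(2) r(1) fA r(2) qj r(3)] q(1) by simp
      moreover have "f \<in> Fib" using f fib rlp_mono[of "Cof \<inter> Weq" Cof] by blast
      ultimately show "f \<in> Fib \<inter> Weq" by simp
    qed
  qed
  show ?thesis
  proof
    show "Weq \<subseteq> Arr C" "Fib \<subseteq> Arr C" "Cof \<subseteq> Arr C"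
      using equivalence_arr fibration_arr cofib_arr by auto
    show "two_out_of_three C Weq" by (rule two_out_of_three_equivalence)
    show "Fib = rlp C (Cof \<inter> Weq)" "Fib \<inter> Weq = rlp C Cof" "Cof \<inter> Weq = llp C Fib"
      by (fact fib triv_fib triv_cof)+
    show "Cof = llp C (Fib \<inter> Weq)"
      using cof_lift cof_if cofib_arr by (auto simp: llp_def)
    show "factorises C Cof (Fib \<inter> Weq)"
      unfolding factorises_def using cof_factor[OF arr_hom] homD by metis
    show "factorises C (Cof \<inter> Weq) Fib"
      unfolding factorises_def
    proof
      fix f assume "f \<in> Arr C"
      then obtain e i q k where i: "i \<in> llp C Fib" "i \<in> hom C (Dom C f) e"
        and k: "cleavage e (Cod C f) q k" and qi: "q \<cdot> i = f"
        using factor[OF arr_hom] by blast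
      moreover have "Cod C i = Dom C q" using k homD(3)[OF i(2)] homD(2) by (auto simp: cleavage_def)
      ultimately show "\<exists>j \<in> Cof \<inter> Weq. \<exists>q \<in> Fib. Cod C j = Dom C q \<and> f = q \<cdot> j"
        using triv_cof fibration_if_cleavage[OF k] by blast
    qed
  qed
qed

end

section \<open>Coherence of unitors and associator\<close>

context monoidal_category
begin

lemma unit_ob [simp]: "\<one> \<in> Ob A"
  by (rule unit_in_Ob)

lemma tens_ob [simp]: "a \<in> Ob A \<Longrightarrow> b \<in> Ob A \<Longrightarrow> a \<otimes> b \<in> Ob A"
  by (rule tens_in_Ob)

lemma tens_arr [simp]:
  assumes "f \<in> Arr A" "g \<in> Arr A"
  shows "f \<boxtimes> g \<in> Arr A" "Dom A (f \<boxtimes> g) = Dom A f \<otimes> Dom A g" "Cod A (f \<boxtimes> g) = Cod A f \<otimes> Cod A g"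
  using tens_in_hom[OF arr_hom[OF assms(1)] arr_hom[OF assms(2)]] by (auto simp: hom_def)

lemma tens_ide_ide [simp]: "a \<in> Ob A \<Longrightarrow> b \<in> Ob A \<Longrightarrow> \<i>\<d> a \<boxtimes> \<i>\<d> b = \<i>\<d> (a \<otimes> b)"
  by (rule tens_ide)

lemma comp_tens [simp]:
  assumes "f \<in> Arr A" "f' \<in> Arr A" "g \<in> Arr A" "g' \<in> Arr A" "Dom A f' = Cod A f" "Dom A g' = Cod A g"
  shows "(f' \<boxtimes> g') \<cdot> (f \<boxtimes> g) = (f' \<cdot> f) \<boxtimes> (g' \<cdot> g)"
    and "e \<in> Arr A \<Longrightarrow> Cod A e = Dom A f \<otimes> Dom A g \<Longrightarrow>
      (f' \<boxtimes> g') \<cdot> ((f \<boxtimes> g) \<cdot> e) = ((f' \<cdot> f) \<boxtimes> (g' \<cdot> g)) \<cdot> e"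
proof -
  show *: "(f' \<boxtimes> g') \<cdot> (f \<boxtimes> g) = (f' \<cdot> f) \<boxtimes> (g' \<cdot> g)"
    using tens_comp[of f _ _ f' _ g _ _ g'] assms by (auto simp: hom_def)
  show "(f' \<boxtimes> g') \<cdot> ((f \<boxtimes> g) \<cdot> e) = ((f' \<cdot> f) \<boxtimes> (g' \<cdot> g)) \<cdot> e"
    if "e \<in> Arr A" "Cod A e = Dom A f \<otimes> Dom A g"
    using reassoc[OF *, of e] that assms by simp
qed

lemma coherence_arr [simp]:
  "a \<in> Ob A \<Longrightarrow> \<r> a \<in> Arr A" "a \<in> Ob A \<Longrightarrow> Dom A (\<r> a) = a \<otimes> \<one>" "a \<in> Ob A \<Longrightarrow> Cod A (\<r> a) = a"
  "a \<in> Ob A \<Longrightarrow> \<l> a \<in> Arr A" "a \<in> Ob A \<Longrightarrow> Dom A (\<l> a) = \<one> \<otimes> a" "a \<in> Ob A \<Longrightarrow> Cod A (\<l> a) = a"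
  "a \<in> Ob A \<Longrightarrow> b \<in> Ob A \<Longrightarrow> c \<in> Ob A \<Longrightarrow> \<alpha> a b c \<in> Arr A"
  "a \<in> Ob A \<Longrightarrow> b \<in> Ob A \<Longrightarrow> c \<in> Ob A \<Longrightarrow> Dom A (\<alpha> a b c) = (a \<otimes> b) \<otimes> c"
  "a \<in> Ob A \<Longrightarrow> b \<in> Ob A \<Longrightarrow> c \<in> Ob A \<Longrightarrow> Cod A (\<alpha> a b c) = a \<otimes> (b \<otimes> c)"
  using runit_in_hom lunit_in_hom assoc_in_hom by (auto simp: hom_def)

abbreviation "rinv a \<equiv> inv_arr A (\<r> a)"
abbreviation "linv a \<equiv> inv_arr A (\<l> a)"

lemma unitor_inverse [simp]:
  assumes "a \<in> Ob A"
  shows "rinv a \<in> Arr A" "Dom A (rinv a) = a" "Cod A (rinv a) = a \<otimes> \<one>"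
    "rinv a \<cdot> \<r> a = \<i>\<d> (a \<otimes> \<one>)" "\<r> a \<cdot> rinv a = \<i>\<d> a"
    "linv a \<in> Arr A" "Dom A (linv a) = a" "Cod A (linv a) = \<one> \<otimes> a"
    "linv a \<cdot> \<l> a = \<i>\<d> (\<one> \<otimes> a)" "\<l> a \<cdot> linv a = \<i>\<d> a"
  using inv_arr[OF runit_iso[OF assms]] inv_arr[OF lunit_iso[OF assms]] assms by (auto simp: hom_def)

lemma unitor_inverse' [simp]:
  assumes "a \<in> Ob A" "e \<in> Arr A"
  shows "Cod A e = a \<otimes> \<one> \<Longrightarrow> rinv a \<cdot> (\<r> a \<cdot> e) = e" "Cod A e = a \<Longrightarrow> \<r> a \<cdot> (rinv a \<cdot> e) = e"
    "Cod A e = \<one> \<otimes> a \<Longrightarrow> linv a \<cdot> (\<l> a \<cdot> e) = e" "Cod A e = a \<Longrightarrow> \<l> a \<cdot> (linv a \<cdot> e) = e"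
  using assms by (simp_all add: reassoc[OF unitor_inverse(4)] reassoc[OF unitor_inverse(5)]
    reassoc[OF unitor_inverse(9)] reassoc[OF unitor_inverse(10)])

lemma unitor_natural:
  assumes "f \<in> hom A a b"
  shows "\<r> b \<cdot> (f \<boxtimes> \<i>\<d> \<one>) = f \<cdot> \<r> a" "\<l> b \<cdot> (\<i>\<d> \<one> \<boxtimes> f) = f \<cdot> \<l> a"
    "rinv b \<cdot> f = (f \<boxtimes> \<i>\<d> \<one>) \<cdot> rinv a" "linv b \<cdot> f = (\<i>\<d> \<one> \<boxtimes> f) \<cdot> linv a"
proof -
  note [simp] = homD[OF assms]
  show r: "\<r> b \<cdot> (f \<boxtimes> \<i>\<d> \<one>) = f \<cdot> \<r> a" and l: "\<l> b \<cdot> (\<i>\<d> \<one> \<boxtimes> f) = f \<cdot> \<l> a"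
    using assms by (rule runit_natural, rule lunit_natural)
  have "rinv b \<cdot> f = rinv b \<cdot> ((f \<cdot> \<r> a) \<cdot> rinv a)" by simp
  also have "\<dots> = (f \<boxtimes> \<i>\<d> \<one>) \<cdot> rinv a" unfolding r[symmetric] by simp
  finally show "rinv b \<cdot> f = (f \<boxtimes> \<i>\<d> \<one>) \<cdot> rinv a" .
  have "linv b \<cdot> f = linv b \<cdot> ((f \<cdot> \<l> a) \<cdot> linv a)" by simp
  also have "\<dots> = (\<i>\<d> \<one> \<boxtimes> f) \<cdot> linv a" unfolding l[symmetric] by simp
  finally show "linv b \<cdot> f = (\<i>\<d> \<one> \<boxtimes> f) \<cdot> linv a" .
qed

lemma tens_unit_faithful:
  assumes f: "f \<in> hom A a b" "g \<in> hom A a b"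
  shows "f \<boxtimes> \<i>\<d> \<one> = g \<boxtimes> \<i>\<d> \<one> \<Longrightarrow> f = g" "\<i>\<d> \<one> \<boxtimes> f = \<i>\<d> \<one> \<boxtimes> g \<Longrightarrow> f = g"
proof -
  note [simp] = homD[OF f(1)] homD[OF f(2)]
  show "f = g" if "f \<boxtimes> \<i>\<d> \<one> = g \<boxtimes> \<i>\<d> \<one>"
  proof -
    have "(f \<cdot> \<r> a) \<cdot> rinv a = (g \<cdot> \<r> a) \<cdot> rinv a"
      using unitor_natural(1)[OF f(1)] unitor_natural(1)[OF f(2)] that by metis
    then show ?thesis by simp
  qed
  show "f = g" if "\<i>\<d> \<one> \<boxtimes> f = \<i>\<d> \<one> \<boxtimes> g"
  proof -
    have "(f \<cdot> \<l> a) \<cdot> linv a = (g \<cdot> \<l> a) \<cdot> linv a"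
      using unitor_natural(2)[OF f(1)] unitor_natural(2)[OF f(2)] that by metis
    then show ?thesis by simp
  qed
qed

lemma assoc_cancel:
  assumes "a \<in> Ob A" "b \<in> Ob A" "c \<in> Ob A" "f \<in> hom A d ((a \<otimes> b) \<otimes> c)" "g \<in> hom A d ((a \<otimes> b) \<otimes> c)"
    "\<alpha> a b c \<cdot> f = \<alpha> a b c \<cdot> g"
  shows "f = g"
proof -
  note i = inv_arr[OF assoc_iso[OF assms(1-3)]]
  note [simp] = assms(1-3) homD[OF i(1)] homD[OF assms(4)] homD[OF assms(5)]
  have "inv_arr A (\<alpha> a b c) \<cdot> (\<alpha> a b c \<cdot> f) = inv_arr A (\<alpha> a b c) \<cdot> (\<alpha> a b c \<cdot> g)"
    using assms(6) by simp
  then show ?thesis using reassoc[OF i(2), of f] reassoc[OF i(2), of g] by simp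
qed

lemma assoc_natural':
  assumes "f \<in> hom A a a'" "g \<in> hom A b b'" "h \<in> hom A c c'" "e \<in> hom A d ((a \<otimes> b) \<otimes> c)"
  shows "\<alpha> a' b' c' \<cdot> (((f \<boxtimes> g) \<boxtimes> h) \<cdot> e) = (f \<boxtimes> (g \<boxtimes> h)) \<cdot> (\<alpha> a b c \<cdot> e)"
proof -
  note [simp] = homD[OF assms(1)] homD[OF assms(2)] homD[OF assms(3)] homD[OF assms(4)]
  show ?thesis using reassoc[OF assoc_natural[OF assms(1-3)], of e] by simp
qed

text \<open>Kelly's coherence lemma. Both sides are compared after tensoring with the unit on the right, where
  the pentagon and the triangle axioms apply; this loses nothing because the right unitor is natural
  and invertible.\<close>

lemma runit_tens:
  assumes a [simp]: "a \<in> Ob A" and b [simp]: "b \<in> Ob A"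
  shows "\<r> (a \<otimes> b) = (\<i>\<d> a \<boxtimes> \<r> b) \<cdot> \<alpha> a b \<one>"
proof -
  let ?d = "\<i>\<d> a \<boxtimes> (\<i>\<d> b \<boxtimes> \<l> \<one>)"
  have l: "\<l> \<one> \<in> hom A (\<one> \<otimes> \<one>) \<one>" and r: "\<r> b \<in> hom A (b \<otimes> \<one>) b" by (simp_all add: hom_def)
  have ia: "\<i>\<d> a \<in> hom A a a" and ib: "\<i>\<d> b \<in> hom A b b" and i1: "\<i>\<d> \<one> \<in> hom A \<one> \<one>"
    by (simp_all add: hom_def)
  have "?d \<cdot> (\<alpha> a b (\<one> \<otimes> \<one>) \<cdot> \<alpha> (a \<otimes> b) \<one> \<one>) =
      \<alpha> a b \<one> \<cdot> (((\<i>\<d> a \<boxtimes> \<i>\<d> b) \<boxtimes> \<l> \<one>) \<cdot> \<alpha> (a \<otimes> b) \<one> \<one>)"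
    by (rule assoc_natural'[OF ia ib l, symmetric]) (simp add: hom_def)
  also have "((\<i>\<d> a \<boxtimes> \<i>\<d> b) \<boxtimes> \<l> \<one>) \<cdot> \<alpha> (a \<otimes> b) \<one> \<one> = \<r> (a \<otimes> b) \<boxtimes> \<i>\<d> \<one>"
    using triangle[of "a \<otimes> b" \<one>] by simp
  finally have 1: "?d \<cdot> (\<alpha> a b (\<one> \<otimes> \<one>) \<cdot> \<alpha> (a \<otimes> b) \<one> \<one>) = \<alpha> a b \<one> \<cdot> (\<r> (a \<otimes> b) \<boxtimes> \<i>\<d> \<one>)" .
  have "?d \<cdot> (\<alpha> a b (\<one> \<otimes> \<one>) \<cdot> \<alpha> (a \<otimes> b) \<one> \<one>) =
      ?d \<cdot> ((\<i>\<d> a \<boxtimes> \<alpha> b \<one> \<one>) \<cdot> (\<alpha> a (b \<otimes> \<one>) \<one> \<cdot> (\<alpha> a b \<one> \<boxtimes> \<i>\<d> \<one>)))"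
    using pentagon[of a b \<one> \<one>] by simp
  also have "\<dots> = (\<i>\<d> a \<boxtimes> ((\<i>\<d> b \<boxtimes> \<l> \<one>) \<cdot> \<alpha> b \<one> \<one>)) \<cdot> (\<alpha> a (b \<otimes> \<one>) \<one> \<cdot> (\<alpha> a b \<one> \<boxtimes> \<i>\<d> \<one>))"
    by simp
  also have "\<dots> = (\<i>\<d> a \<boxtimes> (\<r> b \<boxtimes> \<i>\<d> \<one>)) \<cdot> (\<alpha> a (b \<otimes> \<one>) \<one> \<cdot> (\<alpha> a b \<one> \<boxtimes> \<i>\<d> \<one>))"
    using triangle[of b \<one>] by simp
  also have "\<dots> = \<alpha> a b \<one> \<cdot> (((\<i>\<d> a \<boxtimes> \<r> b) \<boxtimes> \<i>\<d> \<one>) \<cdot> (\<alpha> a b \<one> \<boxtimes> \<i>\<d> \<one>))"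
    by (rule assoc_natural'[OF ia r i1, symmetric]) (simp add: hom_def)
  also have "\<dots> = \<alpha> a b \<one> \<cdot> (((\<i>\<d> a \<boxtimes> \<r> b) \<cdot> \<alpha> a b \<one>) \<boxtimes> \<i>\<d> \<one>)" by simp
  finally have "\<alpha> a b \<one> \<cdot> (\<r> (a \<otimes> b) \<boxtimes> \<i>\<d> \<one>) = \<alpha> a b \<one> \<cdot> (((\<i>\<d> a \<boxtimes> \<r> b) \<cdot> \<alpha> a b \<one>) \<boxtimes> \<i>\<d> \<one>)"
    using 1 by simp
  then have "\<r> (a \<otimes> b) \<boxtimes> \<i>\<d> \<one> = ((\<i>\<d> a \<boxtimes> \<r> b) \<cdot> \<alpha> a b \<one>) \<boxtimes> \<i>\<d> \<one>"
    by (rule assoc_cancel[rotated -1]) (simp_all add: hom_def)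
  then show ?thesis
    by (rule tens_unit_faithful(1)[rotated -1]) (simp_all add: hom_def)
qed

lemma lunit_unit: "\<l> \<one> = \<r> \<one>"
proof -
  have r: "\<r> \<one> \<in> hom A (\<one> \<otimes> \<one>) \<one>" and l: "\<l> \<one> \<in> hom A (\<one> \<otimes> \<one>) \<one>" by (simp_all add: hom_def)
  have "rinv \<one> \<cdot> (\<r> \<one> \<cdot> (\<r> \<one> \<boxtimes> \<i>\<d> \<one>)) = rinv \<one> \<cdot> (\<r> \<one> \<cdot> \<r> (\<one> \<otimes> \<one>))"
    using unitor_natural(1)[OF r] by simp
  then have "(\<i>\<d> \<one> \<boxtimes> \<r> \<one>) \<cdot> \<alpha> \<one> \<one> \<one> = (\<i>\<d> \<one> \<boxtimes> \<l> \<one>) \<cdot> \<alpha> \<one> \<one> \<one>"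
    using runit_tens[of \<one> \<one>] triangle[of \<one> \<one>] by simp
  then have "((\<i>\<d> \<one> \<boxtimes> \<r> \<one>) \<cdot> \<alpha> \<one> \<one> \<one>) \<cdot> inv_arr A (\<alpha> \<one> \<one> \<one>) =
      ((\<i>\<d> \<one> \<boxtimes> \<l> \<one>) \<cdot> \<alpha> \<one> \<one> \<one>) \<cdot> inv_arr A (\<alpha> \<one> \<one> \<one>)"
    by simp
  moreover note i = inv_arr[OF assoc_iso[OF unit_ob unit_ob unit_ob]]
  ultimately have "\<i>\<d> \<one> \<boxtimes> \<l> \<one> = \<i>\<d> \<one> \<boxtimes> \<r> \<one>"
    using homD[OF i(1)] i(3) by simp
  then show ?thesis by (rule tens_unit_faithful(2)[OF l r])
qed

lemma assoc_rinv:
  assumes [simp]: "a \<in> Ob A" "b \<in> Ob A"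
  shows "\<alpha> a \<one> b \<cdot> (rinv a \<boxtimes> \<i>\<d> b) = \<i>\<d> a \<boxtimes> linv b" "\<alpha> a b \<one> \<cdot> rinv (a \<otimes> b) = \<i>\<d> a \<boxtimes> rinv b"
proof -
  have "(\<i>\<d> a \<boxtimes> linv b) \<cdot> (((\<i>\<d> a \<boxtimes> \<l> b) \<cdot> \<alpha> a \<one> b) \<cdot> (rinv a \<boxtimes> \<i>\<d> b)) = \<alpha> a \<one> b \<cdot> (rinv a \<boxtimes> \<i>\<d> b)"
    by simp
  then show "\<alpha> a \<one> b \<cdot> (rinv a \<boxtimes> \<i>\<d> b) = \<i>\<d> a \<boxtimes> linv b"
    unfolding triangle[OF assms] by simp
  have "(\<i>\<d> a \<boxtimes> rinv b) \<cdot> (((\<i>\<d> a \<boxtimes> \<r> b) \<cdot> \<alpha> a b \<one>) \<cdot> rinv (a \<otimes> b)) = \<alpha> a b \<one> \<cdot> rinv (a \<otimes> b)"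
    by simp
  then show "\<alpha> a b \<one> \<cdot> rinv (a \<otimes> b) = \<i>\<d> a \<boxtimes> rinv b"
    unfolding runit_tens[OF assms, symmetric] by simp
qed

end

section \<open>The cylinder and co-cylinder of an interval\<close>

locale structured_interval = monoidal_category A
  for A :: "('o, 'm, 'z) moncat_scheme" (structure) +
  fixes I S :: 'o and i\<^sub>0 i\<^sub>1 p v r\<^sub>0 r\<^sub>1 s \<Gamma>\<^sub>l\<^sub>r \<Gamma>\<^sub>u\<^sub>r :: 'm
    and E :: "('o, 'm, 'o, 'm) ftr" and ev :: "'o \<Rightarrow> 'm"
  assumes int: "interval A I i\<^sub>0 i\<^sub>1"
    and contr: "contraction A I i\<^sub>0 i\<^sub>1 p"
    and inv: "involution A I i\<^sub>0 i\<^sub>1 v"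
    and inv_p: "involution_compatible A p v"
    and subdiv: "subdivision A I i\<^sub>0 i\<^sub>1 S r\<^sub>0 r\<^sub>1 s"
    and lr: "connection_lr A I i\<^sub>0 i\<^sub>1 p \<Gamma>\<^sub>l\<^sub>r"
    and lr_p: "connection_lr_compatible A I p \<Gamma>\<^sub>l\<^sub>r"
    and ur: "connection_ur A I i\<^sub>0 i\<^sub>1 p v \<Gamma>\<^sub>u\<^sub>r"
    and compat: "connections_subdivision_compatible A I p r\<^sub>0 r\<^sub>1 s \<Gamma>\<^sub>l\<^sub>r \<Gamma>\<^sub>u\<^sub>r"
    and exp: "exponential A I E ev"
    and tens_pushout: "\<And>a. a \<in> Ob A \<Longrightarrow>
      pushout A (\<i>\<d> a \<boxtimes> i\<^sub>0) (\<i>\<d> a \<boxtimes> i\<^sub>1) (\<i>\<d> a \<boxtimes> r\<^sub>0) (\<i>\<d> a \<boxtimes> r\<^sub>1)"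
    and strict: "strictness_of_identities A I i\<^sub>0 i\<^sub>1 p r\<^sub>0 r\<^sub>1 s"
begin

abbreviation "K \<equiv> interval_cylinder A I i\<^sub>0 i\<^sub>1 p"
abbreviation "Q \<equiv> interval_cocylinder A i\<^sub>0 i\<^sub>1 p E ev"

lemma interval_arr [simp]:
  "I \<in> Ob A" "S \<in> Ob A" "i\<^sub>0 \<in> Arr A" "Dom A i\<^sub>0 = \<one>" "Cod A i\<^sub>0 = I" "i\<^sub>1 \<in> Arr A" "Dom A i\<^sub>1 = \<one>" "Cod A i\<^sub>1 = I"
  "p \<in> Arr A" "Dom A p = I" "Cod A p = \<one>" "v \<in> Arr A" "Dom A v = I" "Cod A v = I"
  "r\<^sub>0 \<in> Arr A" "Dom A r\<^sub>0 = I" "Cod A r\<^sub>0 = S" "r\<^sub>1 \<in> Arr A" "Dom A r\<^sub>1 = I" "Cod A r\<^sub>1 = S"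
  "s \<in> Arr A" "Dom A s = I" "Cod A s = S" "\<Gamma>\<^sub>l\<^sub>r \<in> Arr A" "Dom A \<Gamma>\<^sub>l\<^sub>r = I \<otimes> I" "Cod A \<Gamma>\<^sub>l\<^sub>r = I"
  "\<Gamma>\<^sub>u\<^sub>r \<in> Arr A" "Dom A \<Gamma>\<^sub>u\<^sub>r = I \<otimes> I" "Cod A \<Gamma>\<^sub>u\<^sub>r = I"
  using int contr inv subdiv lr ur
  by (auto simp: interval_def contraction_def involution_def subdivision_def connection_lr_def
    connection_ur_def hom_def)

lemma interval_eqs [simp]:
  "p \<cdot> i\<^sub>0 = \<i>\<d> \<one>" "p \<cdot> i\<^sub>1 = \<i>\<d> \<one>" "v \<cdot> i\<^sub>0 = i\<^sub>1" "v \<cdot> i\<^sub>1 = i\<^sub>0" "p \<cdot> v = p"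
  "s \<cdot> i\<^sub>0 = r\<^sub>1 \<cdot> i\<^sub>0" "s \<cdot> i\<^sub>1 = r\<^sub>0 \<cdot> i\<^sub>1"
  using contr inv inv_p subdiv
  by (auto simp: contraction_def involution_def subdivision_def involution_compatible_def)

text \<open>The relation \<open>r\<^sub>0 \<cdot> i\<^sub>0 = r\<^sub>1 \<cdot> i\<^sub>1\<close> places the copy \<open>r\<^sub>1\<close> of the interval before the copy
  \<open>r\<^sub>0\<close>, so the homotopy performed second is copaired first.\<close>

definition paste :: "'o \<Rightarrow> 'm \<Rightarrow> 'm \<Rightarrow> 'm" where
  "paste b g h = copair A (\<i>\<d> b \<boxtimes> r\<^sub>0) (\<i>\<d> b \<boxtimes> r\<^sub>1) h g \<cdot> (\<i>\<d> b \<boxtimes> s)"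

lemma pushout_r: "pushout A i\<^sub>0 i\<^sub>1 r\<^sub>0 r\<^sub>1"
  using subdiv by (simp add: subdivision_def)

lemma K_simps [simp]:
  "OnOb (Cyl K) a = a \<otimes> I" "OnArr (Cyl K) f = f \<boxtimes> \<i>\<d> I"
  "cyl_i0 K a = (\<i>\<d> a \<boxtimes> i\<^sub>0) \<cdot> rinv a" "cyl_i1 K a = (\<i>\<d> a \<boxtimes> i\<^sub>1) \<cdot> rinv a"
  "cyl_p K a = \<r> a \<cdot> (\<i>\<d> a \<boxtimes> p)"
  by (simp_all add: interval_cylinder_def tensor_right_def)

lemma copair_pair:
  assumes b: "b \<in> Ob A" and g: "g \<in> hom A (b \<otimes> I) y" and h: "h \<in> hom A (b \<otimes> I) y"
    and e: "g \<cdot> cyl_i1 K b = h \<cdot> cyl_i0 K b"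
  shows "copair A (\<i>\<d> b \<boxtimes> r\<^sub>0) (\<i>\<d> b \<boxtimes> r\<^sub>1) h g \<in> hom A (b \<otimes> S) y"
    "copair A (\<i>\<d> b \<boxtimes> r\<^sub>0) (\<i>\<d> b \<boxtimes> r\<^sub>1) h g \<cdot> (\<i>\<d> b \<boxtimes> r\<^sub>0) = h"
    "copair A (\<i>\<d> b \<boxtimes> r\<^sub>0) (\<i>\<d> b \<boxtimes> r\<^sub>1) h g \<cdot> (\<i>\<d> b \<boxtimes> r\<^sub>1) = g"
    and "k \<in> hom A (b \<otimes> S) y \<Longrightarrow> k \<cdot> (\<i>\<d> b \<boxtimes> r\<^sub>0) = h \<Longrightarrow> k \<cdot> (\<i>\<d> b \<boxtimes> r\<^sub>1) = g
      \<Longrightarrow> paste b g h = k \<cdot> (\<i>\<d> b \<boxtimes> s)"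
proof -
  note [simp] = b homD[OF g] homD[OF h]
  have "(h \<cdot> cyl_i0 K b) \<cdot> \<r> b = (g \<cdot> cyl_i1 K b) \<cdot> \<r> b" using e by simp
  then have e': "h \<cdot> (\<i>\<d> b \<boxtimes> i\<^sub>0) = g \<cdot> (\<i>\<d> b \<boxtimes> i\<^sub>1)" by simp
  have h': "h \<in> hom A (Cod A (\<i>\<d> b \<boxtimes> i\<^sub>0)) y" and g': "g \<in> hom A (Cod A (\<i>\<d> b \<boxtimes> i\<^sub>1)) y"
    using g h by simp_all
  note c = copair[OF tens_pushout[OF b] h' g' e']
  show "copair A (\<i>\<d> b \<boxtimes> r\<^sub>0) (\<i>\<d> b \<boxtimes> r\<^sub>1) h g \<in> hom A (b \<otimes> S) y"
    "copair A (\<i>\<d> b \<boxtimes> r\<^sub>0) (\<i>\<d> b \<boxtimes> r\<^sub>1) h g \<cdot> (\<i>\<d> b \<boxtimes> r\<^sub>0) = h"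
    "copair A (\<i>\<d> b \<boxtimes> r\<^sub>0) (\<i>\<d> b \<boxtimes> r\<^sub>1) h g \<cdot> (\<i>\<d> b \<boxtimes> r\<^sub>1) = g"
    using c(1-3) by simp_all
  show "paste b g h = k \<cdot> (\<i>\<d> b \<boxtimes> s)"
    if "k \<in> hom A (b \<otimes> S) y" "k \<cdot> (\<i>\<d> b \<boxtimes> r\<^sub>0) = h" "k \<cdot> (\<i>\<d> b \<boxtimes> r\<^sub>1) = g"
    using c(4)[of k] that by (simp add: paste_def)
qed

text \<open>When both homotopies are reparametrisations of one homotopy \<open>g\<close> by the restrictions of an arrow
  \<open>q : S \<rightarrow> I\<close>, their pasting is the reparametrisation of \<open>g\<close> by \<open>q \<cdot> s\<close>. The strict laws
  of pasting thus come from the three arrows \<open>S \<rightarrow> I\<close> below.\<close>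

lemma paste_factor:
  assumes b: "b \<in> Ob A" and g: "g \<in> hom A (b \<otimes> I) y" and q: "q \<in> hom A S I"
  shows "paste b (g \<cdot> (\<i>\<d> b \<boxtimes> (q \<cdot> r\<^sub>1))) (g \<cdot> (\<i>\<d> b \<boxtimes> (q \<cdot> r\<^sub>0))) = g \<cdot> (\<i>\<d> b \<boxtimes> (q \<cdot> s))"
proof -
  note [simp] = b homD[OF g] homD[OF q]
  have "r\<^sub>0 \<cdot> i\<^sub>0 = r\<^sub>1 \<cdot> i\<^sub>1" using pushout_r by (simp add: pushout_def)
  then have "(g \<cdot> (\<i>\<d> b \<boxtimes> (q \<cdot> r\<^sub>1))) \<cdot> cyl_i1 K b = (g \<cdot> (\<i>\<d> b \<boxtimes> (q \<cdot> r\<^sub>0))) \<cdot> cyl_i0 K b"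
    by simp
  then have "paste b (g \<cdot> (\<i>\<d> b \<boxtimes> (q \<cdot> r\<^sub>1))) (g \<cdot> (\<i>\<d> b \<boxtimes> (q \<cdot> r\<^sub>0))) = (g \<cdot> (\<i>\<d> b \<boxtimes> q)) \<cdot> (\<i>\<d> b \<boxtimes> s)"
    by (rule copair_pair(4)[OF b _ _, of _ y, rotated 2]) (simp_all add: hom_def)
  then show ?thesis by simp
qed

lemma fold_left: "\<exists>q \<in> hom A S I. q \<cdot> r\<^sub>0 = \<i>\<d> I \<and> q \<cdot> r\<^sub>1 = i\<^sub>0 \<cdot> p \<and> q \<cdot> s = \<i>\<d> I"
proof
  show "copair A r\<^sub>0 r\<^sub>1 (\<i>\<d> I) (i\<^sub>0 \<cdot> p) \<in> hom A S I"
    using copair(1)[OF pushout_r, of "\<i>\<d> I" I "i\<^sub>0 \<cdot> p"] by (simp add: hom_def)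
  show "copair A r\<^sub>0 r\<^sub>1 (\<i>\<d> I) (i\<^sub>0 \<cdot> p) \<cdot> r\<^sub>0 = \<i>\<d> I \<and> copair A r\<^sub>0 r\<^sub>1 (\<i>\<d> I) (i\<^sub>0 \<cdot> p) \<cdot> r\<^sub>1 = i\<^sub>0 \<cdot> p \<and>
      copair A r\<^sub>0 r\<^sub>1 (\<i>\<d> I) (i\<^sub>0 \<cdot> p) \<cdot> s = \<i>\<d> I"
    using copair(2,3)[OF pushout_r, of "\<i>\<d> I" I "i\<^sub>0 \<cdot> p"] strict
    by (simp add: strictness_of_identities_def hom_def)
qed

lemma fold_right: "\<exists>q \<in> hom A S I. q \<cdot> r\<^sub>0 = i\<^sub>1 \<cdot> p \<and> q \<cdot> r\<^sub>1 = \<i>\<d> I \<and> q \<cdot> s = \<i>\<d> I"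
proof
  show "copair A r\<^sub>0 r\<^sub>1 (i\<^sub>1 \<cdot> p) (\<i>\<d> I) \<in> hom A S I"
    using copair(1)[OF pushout_r, of "i\<^sub>1 \<cdot> p" I "\<i>\<d> I"] by (simp add: hom_def)
  show "copair A r\<^sub>0 r\<^sub>1 (i\<^sub>1 \<cdot> p) (\<i>\<d> I) \<cdot> r\<^sub>0 = i\<^sub>1 \<cdot> p \<and> copair A r\<^sub>0 r\<^sub>1 (i\<^sub>1 \<cdot> p) (\<i>\<d> I) \<cdot> r\<^sub>1 = \<i>\<d> I \<and>
      copair A r\<^sub>0 r\<^sub>1 (i\<^sub>1 \<cdot> p) (\<i>\<d> I) \<cdot> s = \<i>\<d> I"
    using copair(2,3)[OF pushout_r, of "i\<^sub>1 \<cdot> p" I "\<i>\<d> I"] strict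
    by (simp add: strictness_of_identities_def hom_def)
qed

text \<open>The compatibility of the connections with the subdivision says that a square of pasted connections is
  degenerate. On the face \<open>i\<^sub>1\<close> of the first factor, where \<open>\<Gamma>\<^sub>l\<^sub>r\<close> is the identity and
  \<open>\<Gamma>\<^sub>u\<^sub>r\<close> is \<open>v\<close>, it becomes the strict inverse law.\<close>

lemma fold_inverse: "\<exists>q \<in> hom A S I. q \<cdot> r\<^sub>0 = \<i>\<d> I \<and> q \<cdot> r\<^sub>1 = v \<and> q \<cdot> s = i\<^sub>1 \<cdot> p"
proof -
  define x where "x = copair A (\<i>\<d> I \<boxtimes> r\<^sub>0) (\<i>\<d> I \<boxtimes> r\<^sub>1) \<Gamma>\<^sub>l\<^sub>r \<Gamma>\<^sub>u\<^sub>r"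
  have glue: "\<Gamma>\<^sub>l\<^sub>r \<cdot> (\<i>\<d> I \<boxtimes> i\<^sub>0) = \<Gamma>\<^sub>u\<^sub>r \<cdot> (\<i>\<d> I \<boxtimes> i\<^sub>1)"
    using lr ur by (simp add: connection_lr_def connection_ur_def)
  have I: "I \<in> Ob A" by simp
  have x: "x \<in> hom A (I \<otimes> S) I" "x \<cdot> (\<i>\<d> I \<boxtimes> r\<^sub>0) = \<Gamma>\<^sub>l\<^sub>r" "x \<cdot> (\<i>\<d> I \<boxtimes> r\<^sub>1) = \<Gamma>\<^sub>u\<^sub>r"
    using copair(1-3)[OF tens_pushout[OF I] _ _ glue, of I] by (simp_all add: hom_def x_def)
  have xs: "x \<cdot> (\<i>\<d> I \<boxtimes> s) = \<r> I \<cdot> (\<i>\<d> I \<boxtimes> p)"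
    using compat by (simp add: connections_subdivision_compatible_def x_def)
  note [simp] = homD[OF x(1)]
  \<comment> \<open>The face \<open>i\<^sub>1\<close> of the first factor.\<close>
  define q where "q = x \<cdot> ((i\<^sub>1 \<boxtimes> \<i>\<d> S) \<cdot> linv S)"
  have q: "q \<in> hom A S I" by (simp add: q_def hom_def)
  have step: "q \<cdot> t = (x \<cdot> (\<i>\<d> I \<boxtimes> t)) \<cdot> ((i\<^sub>1 \<boxtimes> \<i>\<d> I) \<cdot> linv I)" if t: "t \<in> hom A I S" for t
    using unitor_natural(4)[OF t] homD[OF t] by (simp add: q_def)
  have "q \<cdot> r\<^sub>0 = (\<Gamma>\<^sub>l\<^sub>r \<cdot> (i\<^sub>1 \<boxtimes> \<i>\<d> I)) \<cdot> linv I"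
    using step[of r\<^sub>0] x(2) by (simp add: hom_def)
  also have "\<dots> = \<i>\<d> I" using lr by (simp add: connection_lr_def)
  finally have q0: "q \<cdot> r\<^sub>0 = \<i>\<d> I" .
  have "q \<cdot> r\<^sub>1 = (\<Gamma>\<^sub>u\<^sub>r \<cdot> (i\<^sub>1 \<boxtimes> \<i>\<d> I)) \<cdot> linv I"
    using step[of r\<^sub>1] x(3) by (simp add: hom_def)
  also have "\<dots> = (v \<cdot> \<l> I) \<cdot> linv I" using ur unfolding connection_ur_def by metis
  finally have q1: "q \<cdot> r\<^sub>1 = v" by simp
  have i: "i\<^sub>1 \<in> hom A \<one> I" and pp: "p \<in> hom A I \<one>" by (simp_all add: hom_def)
  have "q \<cdot> s = (\<r> I \<cdot> (i\<^sub>1 \<boxtimes> \<i>\<d> \<one>)) \<cdot> ((\<i>\<d> \<one> \<boxtimes> p) \<cdot> linv I)"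
    using step[of s] xs by (simp add: hom_def)
  also have "\<dots> = (i\<^sub>1 \<cdot> \<r> \<one>) \<cdot> (linv \<one> \<cdot> p)"
    unfolding unitor_natural(1)[OF i] unitor_natural(4)[OF pp] ..
  also have "\<dots> = i\<^sub>1 \<cdot> p" by (simp add: lunit_unit[symmetric])
  finally show ?thesis using q q0 q1 by blast
qed

lemma connection_faces:
  assumes a [simp]: "a \<in> Ob A" and i: "i \<in> hom A \<one> I" and k: "k \<in> hom A I I"
  shows "\<Gamma>\<^sub>l\<^sub>r \<cdot> (i \<boxtimes> \<i>\<d> I) = k \<cdot> \<l> I \<Longrightarrow>
      ((\<i>\<d> a \<boxtimes> \<Gamma>\<^sub>l\<^sub>r) \<cdot> \<alpha> a I I) \<cdot> (((\<i>\<d> a \<boxtimes> i) \<cdot> rinv a) \<boxtimes> \<i>\<d> I) = \<i>\<d> a \<boxtimes> k"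
    and "\<Gamma>\<^sub>l\<^sub>r \<cdot> (\<i>\<d> I \<boxtimes> i) = k \<cdot> \<r> I \<Longrightarrow>
      ((\<i>\<d> a \<boxtimes> \<Gamma>\<^sub>l\<^sub>r) \<cdot> \<alpha> a I I) \<cdot> ((\<i>\<d> (a \<otimes> I) \<boxtimes> i) \<cdot> rinv (a \<otimes> I)) = \<i>\<d> a \<boxtimes> k"
proof -
  note [simp] = homD[OF i] homD[OF k]
  have ia: "\<i>\<d> a \<in> hom A a a" and iI: "\<i>\<d> I \<in> hom A I I" by (simp_all add: hom_def)
  show "((\<i>\<d> a \<boxtimes> \<Gamma>\<^sub>l\<^sub>r) \<cdot> \<alpha> a I I) \<cdot> (((\<i>\<d> a \<boxtimes> i) \<cdot> rinv a) \<boxtimes> \<i>\<d> I) = \<i>\<d> a \<boxtimes> k"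
    if e: "\<Gamma>\<^sub>l\<^sub>r \<cdot> (i \<boxtimes> \<i>\<d> I) = k \<cdot> \<l> I"
  proof -
    have "((\<i>\<d> a \<boxtimes> i) \<cdot> rinv a) \<boxtimes> \<i>\<d> I = ((\<i>\<d> a \<boxtimes> i) \<boxtimes> \<i>\<d> I) \<cdot> (rinv a \<boxtimes> \<i>\<d> I)" by simp
    then have "((\<i>\<d> a \<boxtimes> \<Gamma>\<^sub>l\<^sub>r) \<cdot> \<alpha> a I I) \<cdot> (((\<i>\<d> a \<boxtimes> i) \<cdot> rinv a) \<boxtimes> \<i>\<d> I) =
        (\<i>\<d> a \<boxtimes> \<Gamma>\<^sub>l\<^sub>r) \<cdot> (\<alpha> a I I \<cdot> (((\<i>\<d> a \<boxtimes> i) \<boxtimes> \<i>\<d> I) \<cdot> (rinv a \<boxtimes> \<i>\<d> I)))"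
      by (simp del: comp_tens)
    also have "\<alpha> a I I \<cdot> (((\<i>\<d> a \<boxtimes> i) \<boxtimes> \<i>\<d> I) \<cdot> (rinv a \<boxtimes> \<i>\<d> I)) =
        (\<i>\<d> a \<boxtimes> (i \<boxtimes> \<i>\<d> I)) \<cdot> (\<alpha> a \<one> I \<cdot> (rinv a \<boxtimes> \<i>\<d> I))"
      by (rule assoc_natural'[OF ia i iI, of _ "a \<otimes> I"]) (simp add: hom_def)
    also have "\<alpha> a \<one> I \<cdot> (rinv a \<boxtimes> \<i>\<d> I) = \<i>\<d> a \<boxtimes> linv I" by (simp add: assoc_rinv)
    also have "(\<i>\<d> a \<boxtimes> \<Gamma>\<^sub>l\<^sub>r) \<cdot> ((\<i>\<d> a \<boxtimes> (i \<boxtimes> \<i>\<d> I)) \<cdot> (\<i>\<d> a \<boxtimes> linv I)) =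
        \<i>\<d> a \<boxtimes> ((\<Gamma>\<^sub>l\<^sub>r \<cdot> (i \<boxtimes> \<i>\<d> I)) \<cdot> linv I)"
      by simp
    finally show ?thesis unfolding e by simp
  qed
  show "((\<i>\<d> a \<boxtimes> \<Gamma>\<^sub>l\<^sub>r) \<cdot> \<alpha> a I I) \<cdot> ((\<i>\<d> (a \<otimes> I) \<boxtimes> i) \<cdot> rinv (a \<otimes> I)) = \<i>\<d> a \<boxtimes> k"
    if e: "\<Gamma>\<^sub>l\<^sub>r \<cdot> (\<i>\<d> I \<boxtimes> i) = k \<cdot> \<r> I"
  proof -
    have "((\<i>\<d> a \<boxtimes> \<Gamma>\<^sub>l\<^sub>r) \<cdot> \<alpha> a I I) \<cdot> ((\<i>\<d> (a \<otimes> I) \<boxtimes> i) \<cdot> rinv (a \<otimes> I)) =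
        (\<i>\<d> a \<boxtimes> \<Gamma>\<^sub>l\<^sub>r) \<cdot> (\<alpha> a I I \<cdot> (((\<i>\<d> a \<boxtimes> \<i>\<d> I) \<boxtimes> i) \<cdot> rinv (a \<otimes> I)))"
      by simp
    also have "\<alpha> a I I \<cdot> (((\<i>\<d> a \<boxtimes> \<i>\<d> I) \<boxtimes> i) \<cdot> rinv (a \<otimes> I)) =
        (\<i>\<d> a \<boxtimes> (\<i>\<d> I \<boxtimes> i)) \<cdot> (\<alpha> a I \<one> \<cdot> rinv (a \<otimes> I))"
      by (rule assoc_natural'[OF ia iI i, of _ "a \<otimes> I"]) (simp add: hom_def)
    also have "\<alpha> a I \<one> \<cdot> rinv (a \<otimes> I) = \<i>\<d> a \<boxtimes> rinv I" by (simp add: assoc_rinv)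
    also have "(\<i>\<d> a \<boxtimes> \<Gamma>\<^sub>l\<^sub>r) \<cdot> ((\<i>\<d> a \<boxtimes> (\<i>\<d> I \<boxtimes> i)) \<cdot> (\<i>\<d> a \<boxtimes> rinv I)) =
        \<i>\<d> a \<boxtimes> ((\<Gamma>\<^sub>l\<^sub>r \<cdot> (\<i>\<d> I \<boxtimes> i)) \<cdot> rinv I)"
      by simp
    finally show ?thesis unfolding e by simp
  qed
qed

lemma connection_contraction:
  assumes a [simp]: "a \<in> Ob A"
  shows "cyl_p K a \<cdot> ((\<i>\<d> a \<boxtimes> \<Gamma>\<^sub>l\<^sub>r) \<cdot> \<alpha> a I I) = cyl_p K a \<cdot> cyl_p K (a \<otimes> I)"
proof -
  have ia: "\<i>\<d> a \<in> hom A a a" and iI: "\<i>\<d> I \<in> hom A I I" and p: "p \<in> hom A I \<one>"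
    by (simp_all add: hom_def)
  have e: "p \<cdot> \<Gamma>\<^sub>l\<^sub>r = p \<cdot> (\<r> I \<cdot> (\<i>\<d> I \<boxtimes> p))"
    using lr_p by (simp add: connection_lr_compatible_def)
  have "cyl_p K a \<cdot> ((\<i>\<d> a \<boxtimes> \<Gamma>\<^sub>l\<^sub>r) \<cdot> \<alpha> a I I) = \<r> a \<cdot> ((\<i>\<d> a \<boxtimes> (p \<cdot> \<Gamma>\<^sub>l\<^sub>r)) \<cdot> \<alpha> a I I)"
    by simp
  also have "\<dots> = cyl_p K a \<cdot> ((\<i>\<d> a \<boxtimes> \<r> I) \<cdot> ((\<i>\<d> a \<boxtimes> (\<i>\<d> I \<boxtimes> p)) \<cdot> \<alpha> a I I))"
    unfolding e by simp
  also have "(\<i>\<d> a \<boxtimes> (\<i>\<d> I \<boxtimes> p)) \<cdot> \<alpha> a I I = \<alpha> a I \<one> \<cdot> ((\<i>\<d> a \<boxtimes> \<i>\<d> I) \<boxtimes> p)"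
    by (rule assoc_natural[OF ia iI p, symmetric])
  also have "cyl_p K a \<cdot> ((\<i>\<d> a \<boxtimes> \<r> I) \<cdot> (\<alpha> a I \<one> \<cdot> ((\<i>\<d> a \<boxtimes> \<i>\<d> I) \<boxtimes> p))) = cyl_p K a \<cdot> cyl_p K (a \<otimes> I)"
    by (simp add: runit_tens)
  finally show ?thesis .
qed

lemma functor_T: "is_functor A A (Cyl K)" "is_functor A A E"
  and nat_ev: "nat_trans A A (comp_functor (Cyl K) E) id_functor ev"
  and adjoint_T: "right_adjoint A A (Cyl K) E ev"
  using exp by (auto simp: exponential_def right_adjoint_def interval_cylinder_def)

lemma functor_id: "is_functor A A id_functor"
  unfolding id_functor_def by unfold_locales auto

lemma functor_TT: "is_functor A A (comp_functor (Cyl K) (Cyl K))"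
proof -
  interpret T: is_functor A A "Cyl K" by (rule functor_T)
  show ?thesis
  proof
    fix f g x y z assume "f \<in> hom A x y" "g \<in> hom A y z"
    then show "OnArr (comp_functor (Cyl K) (Cyl K)) (g \<cdot> f) =
        OnArr (comp_functor (Cyl K) (Cyl K)) g \<cdot> OnArr (comp_functor (Cyl K) (Cyl K)) f"
      using T.on_comp[OF T.on_arr T.on_arr] T.on_comp by (simp add: comp_functor_def del: K_simps)
  qed (use T.on_ob T.on_arr T.on_ide in \<open>simp_all add: comp_functor_def del: K_simps\<close>)
qed

lemma exp_ob [simp]: "y \<in> Ob A \<Longrightarrow> OnOb E y \<in> Ob A"
  by (rule is_functor.on_ob[OF functor_T(2)])

lemma ev_arr [simp]:
  "y \<in> Ob A \<Longrightarrow> ev y \<in> Arr A" "y \<in> Ob A \<Longrightarrow> Dom A (ev y) = OnOb E y \<otimes> I" "y \<in> Ob A \<Longrightarrow> Cod A (ev y) = y"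
  using nat_ev by (auto simp: nat_trans_def comp_functor_def id_functor_def hom_def)

lemma exp_arr_endpoint:
  assumes y [simp]: "y \<in> Ob A" and i: "i \<in> hom A \<one> I"
  shows "exp_arr A id_functor (Runit A) E ev i y = ev y \<cdot> ((\<i>\<d> (OnOb E y) \<boxtimes> i) \<cdot> rinv (OnOb E y))"
    (is "_ = ?g")
  unfolding exp_arr_def
proof (rule the_equality)
  note [simp] = homD[OF i]
  have g: "?g \<in> hom A (OnOb E y) y" by (simp add: hom_def)
  have "\<r> y \<cdot> (?g \<boxtimes> \<i>\<d> \<one>) = ev y \<cdot> (\<i>\<d> (OnOb E y) \<boxtimes> i)"
    unfolding unitor_natural(1)[OF g] by simp
  then show "?g \<in> hom A (OnOb E y) (OnOb id_functor y) \<and>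
      \<r> y \<cdot> (?g \<boxtimes> \<i>\<d> (Dom A i)) = ev y \<cdot> (\<i>\<d> (OnOb E y) \<boxtimes> i)"
    using g by (simp add: id_functor_def)
  fix g assume "g \<in> hom A (OnOb E y) (OnOb id_functor y) \<and>
      \<r> y \<cdot> (g \<boxtimes> \<i>\<d> (Dom A i)) = ev y \<cdot> (\<i>\<d> (OnOb E y) \<boxtimes> i)"
  then have g: "g \<in> hom A (OnOb E y) y" and e: "\<r> y \<cdot> (g \<boxtimes> \<i>\<d> \<one>) = ev y \<cdot> (\<i>\<d> (OnOb E y) \<boxtimes> i)"
    by (simp_all add: id_functor_def)
  note [simp] = homD[OF g]
  have "(g \<cdot> \<r> (OnOb E y)) \<cdot> rinv (OnOb E y) = (ev y \<cdot> (\<i>\<d> (OnOb E y) \<boxtimes> i)) \<cdot> rinv (OnOb E y)"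
    using e unfolding unitor_natural(1)[OF g] by simp
  then show "g = ?g" by simp
qed

lemma exp_arr_contraction:
  assumes y [simp]: "y \<in> Ob A"
  shows "exp_arr A E ev id_functor (Runit A) p y \<in> hom A y (OnOb E y)"
    "ev y \<cdot> (exp_arr A E ev id_functor (Runit A) p y \<boxtimes> \<i>\<d> I) = \<r> y \<cdot> (\<i>\<d> y \<boxtimes> p)"
proof -
  have "\<r> y \<cdot> (\<i>\<d> y \<boxtimes> p) \<in> hom A (OnOb (Cyl K) y) y" by (simp add: hom_def)
  then have "\<exists>!g. g \<in> hom A y (OnOb E y) \<and> ev y \<cdot> (g \<boxtimes> \<i>\<d> I) = \<r> y \<cdot> (\<i>\<d> y \<boxtimes> p)"
    using adjoint_T y unfolding right_adjoint_def K_simps by blast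
  from theI'[OF this]
  show "exp_arr A E ev id_functor (Runit A) p y \<in> hom A y (OnOb E y)"
    "ev y \<cdot> (exp_arr A E ev id_functor (Runit A) p y \<boxtimes> \<i>\<d> I) = \<r> y \<cdot> (\<i>\<d> y \<boxtimes> p)"
    by (simp_all add: exp_arr_def id_functor_def)
qed

sublocale structured_cylinder A K Q ev "\<lambda>a. \<i>\<d> a \<boxtimes> v" "\<lambda>a. (\<i>\<d> a \<boxtimes> \<Gamma>\<^sub>l\<^sub>r) \<cdot> \<alpha> a I I" paste
proof
  have QE: "CoCyl Q = E" by (simp add: interval_cocylinder_def)
  show "right_adjoint A A (Cyl K) (CoCyl Q) ev" unfolding QE by (rule adjoint_T)
  have end_nat: "nat_trans A A id_functor (Cyl K) (\<lambda>a. (\<i>\<d> a \<boxtimes> i) \<cdot> rinv a)" if i: "i \<in> hom A \<one> I" for i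
  proof -
    have "((\<i>\<d> y \<boxtimes> i) \<cdot> rinv y) \<cdot> f = (f \<boxtimes> \<i>\<d> I) \<cdot> ((\<i>\<d> x \<boxtimes> i) \<cdot> rinv x)" if f: "f \<in> hom A x y" for f x y
      using homD[OF f] homD[OF i] unitor_natural(3)[OF f] by simp
    then show ?thesis
      using functor_T functor_id homD[OF i] by (auto simp: nat_trans_def id_functor_def hom_def)
  qed
  show "nat_trans A A id_functor (Cyl K) (cyl_i0 K)" "nat_trans A A id_functor (Cyl K) (cyl_i1 K)"
    using end_nat[of i\<^sub>0] end_nat[of i\<^sub>1] by (simp_all add: interval_cylinder_def hom_def)
  have "(\<r> y \<cdot> (\<i>\<d> y \<boxtimes> p)) \<cdot> (f \<boxtimes> \<i>\<d> I) = f \<cdot> (\<r> x \<cdot> (\<i>\<d> x \<boxtimes> p))" if f: "f \<in> hom A x y" for f x y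
    using homD[OF f] reassoc[OF unitor_natural(1)[OF f], of "\<i>\<d> x \<boxtimes> p"] by simp
  then show "nat_trans A A (Cyl K) id_functor (cyl_p K)"
    using functor_T functor_id by (auto simp: nat_trans_def id_functor_def hom_def)
  show "nat_trans A A (Cyl K) (Cyl K) (\<lambda>a. \<i>\<d> a \<boxtimes> v)"
    using functor_T by (auto simp: nat_trans_def hom_def)
  have "((\<i>\<d> y \<boxtimes> \<Gamma>\<^sub>l\<^sub>r) \<cdot> \<alpha> y I I) \<cdot> ((f \<boxtimes> \<i>\<d> I) \<boxtimes> \<i>\<d> I) = (f \<boxtimes> \<i>\<d> I) \<cdot> ((\<i>\<d> x \<boxtimes> \<Gamma>\<^sub>l\<^sub>r) \<cdot> \<alpha> x I I)"
    if f: "f \<in> hom A x y" for f x y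
    using assoc_natural[OF f ide_in_hom[of I] ide_in_hom[of I]] homD[OF f] by simp
  then show "nat_trans A A (comp_functor (Cyl K) (Cyl K)) (Cyl K) (\<lambda>a. (\<i>\<d> a \<boxtimes> \<Gamma>\<^sub>l\<^sub>r) \<cdot> \<alpha> a I I)"
    using functor_T functor_TT by (auto simp: nat_trans_def comp_functor_def hom_def)
next
  fix a assume a [simp]: "a \<in> Ob A"
  show "cyl_p K a \<cdot> cyl_i0 K a = \<i>\<d> a" "cyl_p K a \<cdot> cyl_i1 K a = \<i>\<d> a"
    "(\<i>\<d> a \<boxtimes> v) \<cdot> cyl_i0 K a = cyl_i1 K a" "(\<i>\<d> a \<boxtimes> v) \<cdot> cyl_i1 K a = cyl_i0 K a"
    "cyl_p K a \<cdot> (\<i>\<d> a \<boxtimes> v) = cyl_p K a"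
    by simp_all
  have i: "i\<^sub>0 \<in> hom A \<one> I" "i\<^sub>1 \<in> hom A \<one> I" "i\<^sub>0 \<cdot> p \<in> hom A I I" "\<i>\<d> I \<in> hom A I I" by (simp_all add: hom_def)
  show "((\<i>\<d> a \<boxtimes> \<Gamma>\<^sub>l\<^sub>r) \<cdot> \<alpha> a I I) \<cdot> OnArr (Cyl K) (cyl_i0 K a) = cyl_i0 K a \<cdot> cyl_p K a"
    using connection_faces(1)[OF a i(1,3)] lr by (simp add: connection_lr_def)
  show "((\<i>\<d> a \<boxtimes> \<Gamma>\<^sub>l\<^sub>r) \<cdot> \<alpha> a I I) \<cdot> OnArr (Cyl K) (cyl_i1 K a) = \<i>\<d> (OnOb (Cyl K) a)"
    using connection_faces(1)[OF a i(2,4)] lr by (simp add: connection_lr_def)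
  show "((\<i>\<d> a \<boxtimes> \<Gamma>\<^sub>l\<^sub>r) \<cdot> \<alpha> a I I) \<cdot> cyl_i0 K (OnOb (Cyl K) a) = cyl_i0 K a \<cdot> cyl_p K a"
    using connection_faces(2)[OF a i(1,3)] lr by (simp add: connection_lr_def)
  show "((\<i>\<d> a \<boxtimes> \<Gamma>\<^sub>l\<^sub>r) \<cdot> \<alpha> a I I) \<cdot> cyl_i1 K (OnOb (Cyl K) a) = \<i>\<d> (OnOb (Cyl K) a)"
    using connection_faces(2)[OF a i(2,4)] lr by (simp add: connection_lr_def)
  show "cyl_p K a \<cdot> ((\<i>\<d> a \<boxtimes> \<Gamma>\<^sub>l\<^sub>r) \<cdot> \<alpha> a I I) = cyl_p K a \<cdot> cyl_p K (OnOb (Cyl K) a)"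
    using connection_contraction[OF a] by simp
next
  fix b g h y
  assume b [simp]: "b \<in> Ob A" and "g \<in> hom A (OnOb (Cyl K) b) y" "h \<in> hom A (OnOb (Cyl K) b) y"
    and e: "g \<cdot> cyl_i1 K b = h \<cdot> cyl_i0 K b"
  then have g: "g \<in> hom A (b \<otimes> I) y" and h: "h \<in> hom A (b \<otimes> I) y" by simp_all
  note c = copair_pair(1-3)[OF b g h e]
  note [simp] = homD[OF c(1)] homD[OF g] homD[OF h]
  show "paste b g h \<in> hom A (OnOb (Cyl K) b) y \<and>
      paste b g h \<cdot> cyl_i0 K b = g \<cdot> cyl_i0 K b \<and> paste b g h \<cdot> cyl_i1 K b = h \<cdot> cyl_i1 K b"
    using reassoc[OF c(2), of "cyl_i1 K b"] reassoc[OF c(3), of "cyl_i0 K b"]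
    by (simp add: paste_def hom_def)
next
  fix m a b g h y
  assume m: "m \<in> hom A a b" and "g \<in> hom A (OnOb (Cyl K) b) y" "h \<in> hom A (OnOb (Cyl K) b) y"
    and e: "g \<cdot> cyl_i1 K b = h \<cdot> cyl_i0 K b"
  then have g: "g \<in> hom A (b \<otimes> I) y" and h: "h \<in> hom A (b \<otimes> I) y" by simp_all
  have a: "a \<in> Ob A" and b: "b \<in> Ob A" using homD[OF m] by simp_all
  note c = copair_pair(1-3)[OF b g h e]
  let ?c = "copair A (\<i>\<d> b \<boxtimes> r\<^sub>0) (\<i>\<d> b \<boxtimes> r\<^sub>1) h g"
  note [simp] = homD[OF c(1)] homD[OF g] homD[OF h] homD[OF m]
  have "(g \<cdot> (m \<boxtimes> \<i>\<d> I)) \<cdot> cyl_i1 K a = (g \<cdot> cyl_i1 K b) \<cdot> m"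
    "(h \<cdot> cyl_i0 K b) \<cdot> m = (h \<cdot> (m \<boxtimes> \<i>\<d> I)) \<cdot> cyl_i0 K a"
    using unitor_natural(3)[OF m] by simp_all
  then have e': "(g \<cdot> (m \<boxtimes> \<i>\<d> I)) \<cdot> cyl_i1 K a = (h \<cdot> (m \<boxtimes> \<i>\<d> I)) \<cdot> cyl_i0 K a"
    using e by metis
  have "paste a (g \<cdot> (m \<boxtimes> \<i>\<d> I)) (h \<cdot> (m \<boxtimes> \<i>\<d> I)) = (?c \<cdot> (m \<boxtimes> \<i>\<d> S)) \<cdot> (\<i>\<d> a \<boxtimes> s)"
  proof (rule copair_pair(4)[OF a _ _ e'])
    show "g \<cdot> (m \<boxtimes> \<i>\<d> I) \<in> hom A (a \<otimes> I) y" "h \<cdot> (m \<boxtimes> \<i>\<d> I) \<in> hom A (a \<otimes> I) y"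
      "?c \<cdot> (m \<boxtimes> \<i>\<d> S) \<in> hom A (a \<otimes> S) y"
      by (simp_all add: hom_def)
    show "(?c \<cdot> (m \<boxtimes> \<i>\<d> S)) \<cdot> (\<i>\<d> a \<boxtimes> r\<^sub>0) = h \<cdot> (m \<boxtimes> \<i>\<d> I)"
      using reassoc[OF c(2), of "m \<boxtimes> \<i>\<d> I"] by simp
    show "(?c \<cdot> (m \<boxtimes> \<i>\<d> S)) \<cdot> (\<i>\<d> a \<boxtimes> r\<^sub>1) = g \<cdot> (m \<boxtimes> \<i>\<d> I)"
      using reassoc[OF c(3), of "m \<boxtimes> \<i>\<d> I"] by simp
  qed
  then show "paste b g h \<cdot> OnArr (Cyl K) m = paste a (g \<cdot> OnArr (Cyl K) m) (h \<cdot> OnArr (Cyl K) m)"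
    by (simp add: paste_def)
next
  fix n y z b g h
  assume n: "n \<in> hom A y z" and b [simp]: "b \<in> Ob A"
    and "g \<in> hom A (OnOb (Cyl K) b) y" "h \<in> hom A (OnOb (Cyl K) b) y"
    and e: "g \<cdot> cyl_i1 K b = h \<cdot> cyl_i0 K b"
  then have g: "g \<in> hom A (b \<otimes> I) y" and h: "h \<in> hom A (b \<otimes> I) y" by simp_all
  note c = copair_pair(1-3)[OF b g h e]
  let ?c = "copair A (\<i>\<d> b \<boxtimes> r\<^sub>0) (\<i>\<d> b \<boxtimes> r\<^sub>1) h g"
  note [simp] = homD[OF c(1)] homD[OF g] homD[OF h] homD[OF n]
  have e': "(n \<cdot> g) \<cdot> cyl_i1 K b = (n \<cdot> h) \<cdot> cyl_i0 K b" using e by simp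
  have "paste b (n \<cdot> g) (n \<cdot> h) = (n \<cdot> ?c) \<cdot> (\<i>\<d> b \<boxtimes> s)"
    by (rule copair_pair(4)[OF b _ _ e']) (use c in \<open>simp_all add: hom_def\<close>)
  then show "n \<cdot> paste b g h = paste b (n \<cdot> g) (n \<cdot> h)" by (simp add: paste_def)
next
  fix b g y assume b [simp]: "b \<in> Ob A" and "g \<in> hom A (OnOb (Cyl K) b) y"
  then have g: "g \<in> hom A (b \<otimes> I) y" by simp
  note [simp] = homD[OF g]
  show "paste b g (g \<cdot> (cyl_i1 K b \<cdot> cyl_p K b)) = g"
  proof -
    obtain q where q: "q \<in> hom A S I" "q \<cdot> r\<^sub>0 = i\<^sub>1 \<cdot> p" "q \<cdot> r\<^sub>1 = \<i>\<d> I" "q \<cdot> s = \<i>\<d> I"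
      using fold_right by blast
    show ?thesis using paste_factor[OF b g q(1)] q by simp
  qed
  show "paste b (g \<cdot> (cyl_i0 K b \<cdot> cyl_p K b)) g = g"
  proof -
    obtain q where q: "q \<in> hom A S I" "q \<cdot> r\<^sub>0 = \<i>\<d> I" "q \<cdot> r\<^sub>1 = i\<^sub>0 \<cdot> p" "q \<cdot> s = \<i>\<d> I"
      using fold_left by blast
    show ?thesis using paste_factor[OF b g q(1)] q by simp
  qed
  show "paste b (g \<cdot> (\<i>\<d> b \<boxtimes> v)) g = g \<cdot> (cyl_i1 K b \<cdot> cyl_p K b)"
  proof -
    obtain q where q: "q \<in> hom A S I" "q \<cdot> r\<^sub>0 = \<i>\<d> I" "q \<cdot> r\<^sub>1 = v" "q \<cdot> s = i\<^sub>1 \<cdot> p"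
      using fold_inverse by blast
    show ?thesis using paste_factor[OF b g q(1)] q by simp
  qed
next
  fix y assume y [simp]: "y \<in> Ob A"
  show "cocyl_e0 Q y = ev y \<cdot> cyl_i0 K (OnOb (CoCyl Q) y)" "cocyl_e1 Q y = ev y \<cdot> cyl_i1 K (OnOb (CoCyl Q) y)"
    using exp_arr_endpoint[OF y, of i\<^sub>0] exp_arr_endpoint[OF y, of i\<^sub>1]
    by (simp_all add: interval_cocylinder_def hom_def)
  show "cocyl_c Q y \<in> hom A y (OnOb (CoCyl Q) y)" "ev y \<cdot> OnArr (Cyl K) (cocyl_c Q y) = cyl_p K y"
    using exp_arr_contraction[OF y] by (simp_all add: interval_cocylinder_def)
qed

end

section \<open>The model structure of an interval\<close>

theorem mainTheorem3:
  fixes A :: "('o, 'm) moncat"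
    and I S :: 'o
    and i\<^sub>0 i\<^sub>1 p v r\<^sub>0 r\<^sub>1 s \<Gamma>\<^sub>u\<^sub>l \<Gamma>\<^sub>l\<^sub>r \<Gamma>\<^sub>u\<^sub>r :: 'm
    and E :: "('o, 'm, 'o, 'm) ftr" and ev :: "'o \<Rightarrow> 'm"
  assumes "monoidal_category A"
    and "has_finite_limits A"
    and "has_finite_colimits A"
    and "interval A I i\<^sub>0 i\<^sub>1"
    and "contraction A I i\<^sub>0 i\<^sub>1 p"
    and "involution A I i\<^sub>0 i\<^sub>1 v"
    and "involution_compatible A p v"
    and "subdivision A I i\<^sub>0 i\<^sub>1 S r\<^sub>0 r\<^sub>1 s"
    and "subdivision_compatible A p r\<^sub>0 r\<^sub>1 s"
    and "connection_ul A I i\<^sub>0 i\<^sub>1 p \<Gamma>\<^sub>u\<^sub>l"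
    and "connection_lr A I i\<^sub>0 i\<^sub>1 p \<Gamma>\<^sub>l\<^sub>r"
    and "connection_lr_compatible A I p \<Gamma>\<^sub>l\<^sub>r"
    and "connection_ur A I i\<^sub>0 i\<^sub>1 p v \<Gamma>\<^sub>u\<^sub>r"
    and "connections_subdivision_compatible A I p r\<^sub>0 r\<^sub>1 s \<Gamma>\<^sub>l\<^sub>r \<Gamma>\<^sub>u\<^sub>r"
    and "exponential A I E ev"
    and "exponentiable A S"
    and "\<And>a. a \<in> Ob A \<Longrightarrow>
      pushout A (\<i>\<d>\<^bsub>A\<^esub> a \<boxtimes>\<^bsub>A\<^esub> i\<^sub>0) (\<i>\<d>\<^bsub>A\<^esub> a \<boxtimes>\<^bsub>A\<^esub> i\<^sub>1) (\<i>\<d>\<^bsub>A\<^esub> a \<boxtimes>\<^bsub>A\<^esub> r\<^sub>0) (\<i>\<d>\<^bsub>A\<^esub> a \<boxtimes>\<^bsub>A\<^esub> r\<^sub>1)"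
    and "strictness_of_identities A I i\<^sub>0 i\<^sub>1 p r\<^sub>0 r\<^sub>1 s"
  shows "model_structure A
      {f. homotopy_equivalence A (cyl_homotopic A (interval_cylinder A I i\<^sub>0 i\<^sub>1 p)) f}
      {f. normally_cloven_fibration A (interval_cocylinder A i\<^sub>0 i\<^sub>1 p E ev) f}
      {f. cofibration A (interval_cylinder A I i\<^sub>0 i\<^sub>1 p) f}
    \<and> {f. homotopy_equivalence A (cyl_homotopic A (interval_cylinder A I i\<^sub>0 i\<^sub>1 p)) f}
      = {f. homotopy_equivalence A (cocyl_homotopic A (interval_cocylinder A i\<^sub>0 i\<^sub>1 p E ev)) f}"
proof -
  interpret M: structured_interval A I S i\<^sub>0 i\<^sub>1 p v r\<^sub>0 r\<^sub>1 s \<Gamma>\<^sub>l\<^sub>r \<Gamma>\<^sub>u\<^sub>r E ev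
    using assms by (intro structured_interval.intro structured_interval_axioms.intro)
  show ?thesis
  proof
    show "model_structure A
      {f. homotopy_equivalence A (cyl_homotopic A (interval_cylinder A I i\<^sub>0 i\<^sub>1 p)) f}
      {f. normally_cloven_fibration A (interval_cocylinder A i\<^sub>0 i\<^sub>1 p E ev) f}
      {f. cofibration A (interval_cylinder A I i\<^sub>0 i\<^sub>1 p) f}"
      by (rule M.cylinder_model_structure) (rule M.has_pullbacks[OF assms(2)] M.has_pushouts[OF assms(3)]; assumption)+
    show "{f. homotopy_equivalence A (cyl_homotopic A (interval_cylinder A I i\<^sub>0 i\<^sub>1 p)) f}
      = {f. homotopy_equivalence A (cocyl_homotopic A (interval_cocylinder A i\<^sub>0 i\<^sub>1 p E ev)) f}"
      by (simp add: homotopy_equivalence_def M.cocyl_homotopic_iff)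
  qed
qed

end
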